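(* Let $R$ be a reduced local ring, and suppose that the triple $(R,\Delta,\mathfrak a_\bullet)$ is sharply $F$-pure. Then there are only finitely many uniformly $(\Delta,\mathfrak a_\bullet,F)$-compatible ideals $I\subseteq R$. In particular, there are only finitely many centers of (sharp) $F$-purity for $(R,\Delta,\mathfrak a_\bullet)$.
   Context: All rings are commutative, noetherian, excellent, of prime characteristic $p>0$ and $F$-finite (finite as modules over themselves via Frobenius). $F^e_*M$ denotes $M$ viewed as an $R$-module via the $e$-iterated Frobenius. $R^\circ$ is the set of elements of $R$ in no minimal prime. A graded system of ideals $\mathfrak a_\bullet=\{\mathfrak a_i\}_{i\ge 0}$ satisfies $\mathfrak a_i\mathfrak a_j\subseteq\mathfrak a_{i+j}$. A triple $(R,\Delta,\mathfrak a_\bullet)$ consists of a reduced ring $R$, an effective $\mathbb R$-(Weil) divisor $\Delta$ on $\operatorname{Spec}R$, and a graded system of ideals of $R$ such that: $R$ is a normal domain if $\Delta\ne0$; $\mathfrak a_0=R$; $\mathfrak a_i\cap R^\circ\neq\emptyset$ for all $i$. $R(D)$ denotes the global sections of $\mathcal O_{\operatorname{Spec}R}(D)$ (and $R(0)=R$). The triple is sharply $F$-pure if for some $e>0$ there is $d\in\mathfrak a_{p^e-1}$ such that the $R$-linear map $R\to F^e_*R(\lceil (p^e-1)\Delta\rceil)$ sending $1$ to $d$ splits. An ideal $I\subseteq R$ is uniformly $(\Delta,\mathfrak a_\bullet,F)$-compatible if for every $e>0$, every $a\in\mathfrak a_{p^e-1}$ and every $R$-linear map $\phi:F^e_*R(\lceil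 (p^e-1)\Delta\rceil)\to R$ one has $\phi(F^e_*(aI))\subseteq I$ (where $F^e_*(aI)\subseteq F^e_*R\subseteq F^e_*R(\lceil (p^e-1)\Delta\rceil)$). A prime $P\in\operatorname{Spec}R$ is a center of sharp $F$-purity for $(R,\Delta,\mathfrak a_\bullet)$ if for every $f\in PR_P$, every $e>0$ and every $a\in\mathfrak a_{p^e-1}$, the $R_P$-linear map $R_P\to F^e_*R_P(\lceil (p^e-1)\Delta|_{\operatorname{Spec}R_P}\rceil)$ sending $1$ to $fa$ does not split. *)

theory Defs
  imports "HOL-Algebra.Algebra" Complex_Main
begin

section \<open>Localization\<close>

text \<open>The fraction \<open>a / s\<close> in \<open>S\<^sup>-\<^sup>1 R\<close>, as an equivalence class of pairs. The extra factor \<open>u\<close>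
  is needed because \<open>S\<close> may contain zero divisors.\<close>

definition fraction :: "('a, 'm) ring_scheme \<Rightarrow> 'a set \<Rightarrow> 'a \<Rightarrow> 'a \<Rightarrow> ('a \<times> 'a) set" where
  "fraction R S a s =
    {(b, t) \<in> carrier R \<times> S. \<exists>u\<in>S. u \<otimes>\<^bsub>R\<^esub> (a \<otimes>\<^bsub>R\<^esub> t) = u \<otimes>\<^bsub>R\<^esub> (b \<otimes>\<^bsub>R\<^esub> s)}"

text \<open>The unions over representatives are unions of identical classes.\<close>

definition localization :: "('a, 'm) ring_scheme \<Rightarrow> 'a set \<Rightarrow> ('a \<times> 'a) set ring" where
  "localization R S =
    \<lparr> carrier = {fraction R S a s | a s. a \<in> carrier R \<and> s \<in> S},
      monoid.mult = (\<lambda>x y. \<Union>(a, s)\<in>x. \<Union>(b, t)\<in>y. fraction R S (a \<otimes>\<^bsub>R\<^esub> b) (s \<otimes>\<^bsub>R\<^esub> t)),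
      monoid.one = fraction R S \<one>\<^bsub>R\<^esub> \<one>\<^bsub>R\<^esub>,
      ring.zero = fraction R S \<zero>\<^bsub>R\<^esub> \<one>\<^bsub>R\<^esub>,
      ring.add = (\<lambda>x y. \<Union>(a, s)\<in>x. \<Union>(b, t)\<in>y.
               fraction R S (a \<otimes>\<^bsub>R\<^esub> t \<oplus>\<^bsub>R\<^esub> b \<otimes>\<^bsub>R\<^esub> s) (s \<otimes>\<^bsub>R\<^esub> t)) \<rparr>"

definition to_localization :: "('a, 'm) ring_scheme \<Rightarrow> 'a set \<Rightarrow> 'a \<Rightarrow> ('a \<times> 'a) set" where
  "to_localization R S a = fraction R S a \<one>\<^bsub>R\<^esub>"

definition local_at :: "('a, 'm) ring_scheme \<Rightarrow> 'a set \<Rightarrow> ('a \<times> 'a) set ring" where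
  "local_at R P = localization R (carrier R - P)"

definition to_local_at :: "('a, 'm) ring_scheme \<Rightarrow> 'a set \<Rightarrow> 'a \<Rightarrow> ('a \<times> 'a) set" where
  "to_local_at R P = to_localization R (carrier R - P)"

text \<open>The extended ideal \<open>P R\<^sub>P\<close>.\<close>

definition extended_prime :: "('a, 'm) ring_scheme \<Rightarrow> 'a set \<Rightarrow> ('a \<times> 'a) set set" where
  "extended_prime R P = {fraction R (carrier R - P) a s | a s. a \<in> P \<and> s \<in> carrier R - P}"

definition nonzerodivisors :: "('a, 'm) ring_scheme \<Rightarrow> 'a set" where
  "nonzerodivisors R = {s \<in> carrier R. \<forall>a\<in>carrier R. a \<otimes>\<^bsub>R\<^esub> s = \<zero>\<^bsub>R\<^esub> \<longrightarrow> a = \<zero>\<^bsub>R\<^esub>}"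

text \<open>The total ring of fractions; it is the field of fractions when \<open>R\<close> is a domain.\<close>

definition total_fractions :: "('a, 'm) ring_scheme \<Rightarrow> ('a \<times> 'a) set ring" where
  "total_fractions R = localization R (nonzerodivisors R)"

definition to_fractions :: "('a, 'm) ring_scheme \<Rightarrow> 'a \<Rightarrow> ('a \<times> 'a) set" where
  "to_fractions R = to_localization R (nonzerodivisors R)"


section \<open>Rings\<close>

definition reduced_ring :: "('a, 'm) ring_scheme \<Rightarrow> bool" where
  "reduced_ring R \<longleftrightarrow> cring R \<and>
    (\<forall>x\<in>carrier R. \<forall>n::nat. x [^]\<^bsub>R\<^esub> n = \<zero>\<^bsub>R\<^esub> \<longrightarrow> x = \<zero>\<^bsub>R\<^esub>)"

definition local_ring :: "('a, 'm) ring_scheme \<Rightarrow> bool" where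
  "local_ring R \<longleftrightarrow> cring R \<and> (\<exists>!M. maximalideal M R)"

definition integral_over :: "('a, 'm) ring_scheme \<Rightarrow> 'a set \<Rightarrow> 'a \<Rightarrow> bool" where
  "integral_over K A x \<longleftrightarrow>
    (\<exists>f. polynomial\<^bsub>K\<^esub> A f \<and> f \<noteq> [] \<and> lead_coeff f = \<one>\<^bsub>K\<^esub> \<and> ring.eval K f x = \<zero>\<^bsub>K\<^esub>)"

definition normal_domain :: "('a, 'm) ring_scheme \<Rightarrow> bool" where
  "normal_domain R \<longleftrightarrow> domain R \<and>
    (\<forall>x\<in>carrier (total_fractions R).
       integral_over (total_fractions R) (to_fractions R ` carrier R) x
         \<longrightarrow> x \<in> to_fractions R ` carrier R)"

definition minimal_prime :: "('a, 'm) ring_scheme \<Rightarrow> 'a set \<Rightarrow> bool" where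
  "minimal_prime R P \<longleftrightarrow> primeideal P R \<and> (\<forall>Q. primeideal Q R \<longrightarrow> \<not> Q \<subset> P)"

text \<open>This is \<open>R\<^sup>\<circ>\<close>.\<close>

definition off_minimal_primes :: "('a, 'm) ring_scheme \<Rightarrow> 'a set" where
  "off_minimal_primes R = {x \<in> carrier R. \<forall>P. minimal_prime R P \<longrightarrow> x \<notin> P}"

definition height_one_prime :: "('a, 'm) ring_scheme \<Rightarrow> 'a set \<Rightarrow> bool" where
  "height_one_prime R P \<longleftrightarrow> primeideal P R \<and>
    (\<exists>Q. primeideal Q R \<and> Q \<subset> P) \<and>
    \<not> (\<exists>Q Q'. primeideal Q R \<and> primeideal Q' R \<and> Q \<subset> Q' \<and> Q' \<subset> P)"


section \<open>Modules and Frobenius push-forward\<close>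

definition self_module :: "('a, 'm) ring_scheme \<Rightarrow> ('a, 'a) module" where
  "self_module R =
    \<lparr> carrier = carrier R, monoid.mult = monoid.mult R, monoid.one = \<one>\<^bsub>R\<^esub>,
      ring.zero = \<zero>\<^bsub>R\<^esub>, ring.add = ring.add R, smult = monoid.mult R \<rparr>"

definition module_hom ::
  "('a, 'm) ring_scheme \<Rightarrow> ('a, 'b, 'k) module_scheme \<Rightarrow> ('a, 'c, 'l) module_scheme \<Rightarrow> ('b \<Rightarrow> 'c) set"
  where
  "module_hom R M N = {\<phi> \<in> carrier M \<rightarrow> carrier N.
    (\<forall>x\<in>carrier M. \<forall>y\<in>carrier M. \<phi> (x \<oplus>\<^bsub>M\<^esub> y) = \<phi> x \<oplus>\<^bsub>N\<^esub> \<phi> y) \<and>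
    (\<forall>r\<in>carrier R. \<forall>x\<in>carrier M. \<phi> (r \<odot>\<^bsub>M\<^esub> x) = r \<odot>\<^bsub>N\<^esub> \<phi> x)}"

definition finitely_generated ::
  "('a, 'm) ring_scheme \<Rightarrow> ('a, 'b, 'k) module_scheme \<Rightarrow> bool" where
  "finitely_generated R M \<longleftrightarrow>
    (\<exists>B \<subseteq> carrier M. finite B \<and>
      (\<forall>x\<in>carrier M. \<exists>c \<in> B \<rightarrow> carrier R. x = (\<Oplus>\<^bsub>M\<^esub>b\<in>B. c b \<odot>\<^bsub>M\<^esub> b)))"

text \<open>\<open>F\<^sup>e\<^sub>*M\<close> for \<open>R\<close> of characteristic \<open>p\<close>: the same abelian group, with \<open>R\<close> acting through
  \<open>r \<mapsto> r\<^bsup>p\<^sup>e\<^esup>\<close>.\<close>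

definition frobenius_push ::
  "nat \<Rightarrow> nat \<Rightarrow> ('a, 'm) ring_scheme \<Rightarrow> ('a, 'b) module \<Rightarrow> ('a, 'b) module" where
  "frobenius_push p e R M = M\<lparr>smult := \<lambda>r x. (r [^]\<^bsub>R\<^esub> (p ^ e)) \<odot>\<^bsub>M\<^esub> x\<rparr>"

text \<open>The \<open>R\<close>-linear map \<open>R \<rightarrow> M\<close> sending \<open>1\<close> to \<open>d\<close> is \<open>r \<mapsto> r d\<close>; it splits if it has an
  \<open>R\<close>-linear left inverse.\<close>

definition splits_at :: "('a, 'm) ring_scheme \<Rightarrow> ('a, 'b, 'k) module_scheme \<Rightarrow> 'b \<Rightarrow> bool" where
  "splits_at R M d \<longleftrightarrow>
    (\<exists>\<psi>\<in>module_hom R M (self_module R). \<forall>r\<in>carrier R. \<psi> (r \<odot>\<^bsub>M\<^esub> d) = r)"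

text \<open>Excellence is not listed separately: an \<open>F\<close>-finite noetherian ring is excellent by a theorem
  of Kunz.\<close>

definition F_finite_noetherian :: "nat \<Rightarrow> ('a, 'm) ring_scheme \<Rightarrow> bool" where
  "F_finite_noetherian p R \<longleftrightarrow>
    cring R \<and> noetherian_ring R \<and>
    Factorial_Ring.prime p \<and> \<one>\<^bsub>R\<^esub> \<noteq> \<zero>\<^bsub>R\<^esub> \<and> add_pow R p \<one>\<^bsub>R\<^esub> = \<zero>\<^bsub>R\<^esub> \<and>
    finitely_generated R (frobenius_push p 1 R (self_module R))"


section \<open>Weil divisors\<close>

text \<open>A prime divisor of \<open>Spec R\<close> is given by a prime of height one; a divisor is its family of
  coefficients.\<close>

definition effective_divisor :: "('a, 'm) ring_scheme \<Rightarrow> ('a set \<Rightarrow> real) \<Rightarrow> bool" where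
  "effective_divisor R \<Delta> \<longleftrightarrow>
    finite {Q. \<Delta> Q \<noteq> 0} \<and> (\<forall>Q. \<Delta> Q \<noteq> 0 \<longrightarrow> height_one_prime R Q) \<and> (\<forall>Q. 0 \<le> \<Delta> Q)"

definition round_up_mult :: "nat \<Rightarrow> ('a set \<Rightarrow> real) \<Rightarrow> 'a set \<Rightarrow> int" where
  "round_up_mult n \<Delta> = (\<lambda>Q. \<lceil>real n * \<Delta> Q\<rceil>)"

text \<open>The restriction of \<open>\<Delta>\<close> to \<open>Spec R\<^sub>P\<close>: the coefficient at a height one prime of \<open>R\<^sub>P\<close> is the
  coefficient of \<open>\<Delta>\<close> at its contraction to \<open>R\<close>.\<close>

definition restrict_divisor ::
  "('a, 'm) ring_scheme \<Rightarrow> 'a set \<Rightarrow> ('a set \<Rightarrow> real) \<Rightarrow> ('a \<times> 'a) set set \<Rightarrow> real" where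
  "restrict_divisor R P \<Delta> = (\<lambda>Q. if height_one_prime (local_at R P) Q
     then \<Delta> {a \<in> carrier R. to_local_at R P a \<in> Q} else 0)"

text \<open>For \<open>R\<close> a normal noetherian domain and \<open>Q\<close> of height one, \<open>R\<^sub>Q\<close> is a discrete valuation ring;
  \<open>order_at R Q\<close> and \<open>valuation_at R Q\<close> are its normalized valuation on the nonzero elements of
  \<open>R\<close> and of the fraction field. Neither is used outside this situation.\<close>

definition order_at :: "('a, 'm) ring_scheme \<Rightarrow> 'a set \<Rightarrow> 'a \<Rightarrow> nat" where
  "order_at R Q a = (GREATEST n. to_local_at R Q a \<in>
     (ideal_prod (local_at R Q) (extended_prime R Q) ^^ n) (carrier (local_at R Q)))"

definition valuation_at :: "('a, 'm) ring_scheme \<Rightarrow> 'a set \<Rightarrow> ('a \<times> 'a) set \<Rightarrow> int" where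
  "valuation_at R Q x =
    (THE n. \<exists>(a, b)\<in>x. n = int (order_at R Q a) - int (order_at R Q b))"

text \<open>The \<open>R\<close>-module \<open>R(D)\<close> inside the total ring of fractions. The case \<open>D = 0\<close> is separated since
  then \<open>R\<close> need not be a normal domain; for a normal domain both cases agree. Only the additive
  group and the scalar multiplication are meaningful, as \<open>R(D)\<close> is in general not closed under
  products.\<close>

definition divisor_module ::
  "('a, 'm) ring_scheme \<Rightarrow> ('a set \<Rightarrow> int) \<Rightarrow> ('a, ('a \<times> 'a) set) module" where
  "divisor_module R D =
    \<lparr> carrier =
        (if D = (\<lambda>_. 0) then to_fractions R ` carrier R
         else {x \<in> carrier (total_fractions R). x = \<zero>\<^bsub>total_fractions R\<^esub> \<or>
                (\<forall>Q. height_one_prime R Q \<longrightarrow> valuation_at R Q x + D Q \<ge> 0)}),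
      monoid.mult = monoid.mult (total_fractions R),
      monoid.one = monoid.one (total_fractions R),
      ring.zero = ring.zero (total_fractions R),
      ring.add = ring.add (total_fractions R),
      smult = (\<lambda>r x. to_fractions R r \<otimes>\<^bsub>total_fractions R\<^esub> x) \<rparr>"

text \<open>\<open>F\<^sup>e\<^sub>* R(\<lceil>(p\<^sup>e - 1)\<Delta>\<rceil>)\<close>; an element \<open>x\<close> of \<open>R\<close>, viewed in this module, is
  \<open>to_fractions R x\<close>.\<close>

definition frobenius_divisor_module ::
  "nat \<Rightarrow> nat \<Rightarrow> ('a, 'm) ring_scheme \<Rightarrow> ('a set \<Rightarrow> real) \<Rightarrow> ('a, ('a \<times> 'a) set) module" where
  "frobenius_divisor_module p e R \<Delta> =
    frobenius_push p e R (divisor_module R (round_up_mult (p ^ e - 1) \<Delta>))"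


section \<open>Triples\<close>

definition graded_system :: "('a, 'm) ring_scheme \<Rightarrow> (nat \<Rightarrow> 'a set) \<Rightarrow> bool" where
  "graded_system R \<aa> \<longleftrightarrow>
    (\<forall>i. ideal (\<aa> i) R) \<and> (\<forall>i j. ideal_prod R (\<aa> i) (\<aa> j) \<subseteq> \<aa> (i + j))"

definition is_triple ::
  "('a, 'm) ring_scheme \<Rightarrow> ('a set \<Rightarrow> real) \<Rightarrow> (nat \<Rightarrow> 'a set) \<Rightarrow> bool" where
  "is_triple R \<Delta> \<aa> \<longleftrightarrow>
    reduced_ring R \<and> effective_divisor R \<Delta> \<and> graded_system R \<aa> \<and>
    (\<Delta> \<noteq> (\<lambda>_. 0) \<longrightarrow> normal_domain R) \<and>
    \<aa> 0 = carrier R \<and>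
    (\<forall>i. \<aa> i \<inter> off_minimal_primes R \<noteq> {})"

definition sharply_F_pure ::
  "nat \<Rightarrow> ('a, 'm) ring_scheme \<Rightarrow> ('a set \<Rightarrow> real) \<Rightarrow> (nat \<Rightarrow> 'a set) \<Rightarrow> bool" where
  "sharply_F_pure p R \<Delta> \<aa> \<longleftrightarrow>
    (\<exists>e>0. \<exists>d\<in>\<aa> (p ^ e - 1).
       splits_at R (frobenius_divisor_module p e R \<Delta>) (to_fractions R d))"

definition uniformly_F_compatible ::
  "nat \<Rightarrow> ('a, 'm) ring_scheme \<Rightarrow> ('a set \<Rightarrow> real) \<Rightarrow> (nat \<Rightarrow> 'a set) \<Rightarrow> 'a set \<Rightarrow> bool" where
  "uniformly_F_compatible p R \<Delta> \<aa> I \<longleftrightarrow>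
    ideal I R \<and>
    (\<forall>e>0. \<forall>a\<in>\<aa> (p ^ e - 1).
      \<forall>\<phi>\<in>module_hom R (frobenius_divisor_module p e R \<Delta>) (self_module R).
      \<forall>x\<in>I. \<phi> (to_fractions R (a \<otimes>\<^bsub>R\<^esub> x)) \<in> I)"

definition center_of_sharp_F_purity ::
  "nat \<Rightarrow> ('a, 'm) ring_scheme \<Rightarrow> ('a set \<Rightarrow> real) \<Rightarrow> (nat \<Rightarrow> 'a set) \<Rightarrow> 'a set \<Rightarrow> bool" where
  "center_of_sharp_F_purity p R \<Delta> \<aa> P \<longleftrightarrow>
    primeideal P R \<and>
    (\<forall>f\<in>extended_prime R P. \<forall>e>0. \<forall>a\<in>\<aa> (p ^ e - 1).
      \<not> splits_at (local_at R P)
          (frobenius_divisor_module p e (local_at R P) (restrict_divisor R P \<Delta>))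
          (to_fractions (local_at R P) (f \<otimes>\<^bsub>local_at R P\<^esub> to_local_at R P a)))"

end

theory Submission
  imports Defs
begin

text \<open>Let \<open>\<psi>\<close> split \<open>1 \<mapsto> d\<close> at level \<open>e\<close>, and put \<open>q = p\<^sup>e\<close>. Then \<open>\<phi>(x) = \<psi>(dx)\<close> is an additive map
  \<open>R \<rightarrow> R\<close> with \<open>\<phi>(r\<^sup>q x) = r \<phi>(x)\<close> and \<open>\<phi>(1) = 1\<close>, and every uniformly compatible ideal is stable
  under \<open>\<phi>\<close>. So it suffices that \<open>\<phi>\<close> has only finitely many stable ideals
  (\<open>finite_stable_ideals\<close>).

  Stable ideals are radical, because \<open>x = \<phi>(x\<^sup>q)\<close>, and they are closed under sums, intersections and
  colons. By noetherian induction one considers a maximal stable \<open>I\<close> with infinitely many stable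
  ideals above it. If \<open>I\<close> is not prime, there are larger stable ideals \<open>A\<close> and \<open>B\<close> with
  \<open>AB \<subseteq> I\<close>, and every stable \<open>J \<supseteq> I\<close> equals \<open>(J + A) \<inter> (J + B)\<close> since it is radical; only finitely
  many pairs are possible. If \<open>I\<close> is prime, there is a test element: some \<open>c \<notin> I\<close> lies in every
  stable \<open>J\<close> strictly above \<open>I\<close>, so that all these \<open>J\<close> contain a single stable ideal strictly above
  \<open>I\<close>. To find \<open>c\<close>, one uses \<open>F\<close>-finiteness to build an operator
  \<open>T(x) = \<Sum> \<phi>(g\<^sub>i x)\<^sup>q b\<^sub>i\<close> that is multiplication by \<open>c\<close> modulo \<open>I\<close>. It maps a stable \<open>J\<close> into
  \<open>J\<^sup>2\<close>, hence \<open>cJ \<subseteq> J\<^sup>2 + I\<close>, and the determinant trick puts \<open>c\<close> into the radical ideal \<open>J\<close>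
  (\<open>trace_operator_scalar_finite\<close>, \<open>scalar_in_radical\<close>, \<open>common_element_of_larger_stable\<close>).

  A center \<open>P\<close> is itself uniformly compatible (\<open>center_is_compatible\<close>): if \<open>\<phi>(ax) \<notin> P\<close> for some
  \<open>x \<in> P\<close>, then the localization of \<open>\<phi>\<close> at \<open>P\<close>, divided by the unit \<open>\<phi>(ax)\<close>, splits \<open>1 \<mapsto> xa\<close>. The
  localization of \<open>\<phi>\<close> is defined on all of \<open>R\<^sub>P(D|\<^sub>P)\<close>, where \<open>D\<close> is the rounded-up divisor, because
  every element of this module becomes an element of \<open>R(D)\<close> after multiplication by some \<open>s \<notin> P\<close>
  (\<open>local_divisor_module_subset\<close>). This, like the inclusion \<open>R \<subseteq> R(D)\<close> and the fact that \<open>R(D)\<close> is a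
  module, rests on \<open>R\<^sub>Q\<close> being a discrete valuation ring for every height one prime \<open>Q\<close> of a normal
  noetherian domain (\<open>height_one_uniformizer\<close>).\<close>

section \<open>Frobenius in prime characteristic\<close>

lemma (in cring) binomial_expansion:
  assumes x: "x \<in> carrier R" and y: "y \<in> carrier R"
  shows "(x \<oplus> y) [^] (n::nat) =
    (\<Oplus>k\<in>{..n}. add_pow R (n choose k) (x [^] k \<otimes> y [^] (n - k)))"
proof (induction n)
  case 0
  then show ?case using x y by simp
next
  case (Suc n)
  let ?t = "\<lambda>n k. add_pow R (n choose k) (x [^] k \<otimes> y [^] (n - k))"
  let ?u = "\<lambda>k. add_pow R (n choose k) (x [^] Suc k \<otimes> y [^] (n - k))"
  let ?v = "\<lambda>k. add_pow R (n choose Suc k) (x [^] Suc k \<otimes> y [^] (n - k))"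
  have tc: "?t m k \<in> carrier R" "?u k \<in> carrier R" "?v k \<in> carrier R" for m k
    using x y by simp_all
  have X: "x \<otimes> (\<Oplus>k\<in>{..n}. ?t n k) = (\<Oplus>k\<in>{..n}. ?u k)"
  proof -
    have "x \<otimes> (\<Oplus>k\<in>{..n}. ?t n k) = (\<Oplus>k\<in>{..n}. x \<otimes> ?t n k)"
      using finsum_rdistr[of "{..n}" x "?t n"] tc x by (simp add: Pi_iff)
    also have "\<dots> = (\<Oplus>k\<in>{..n}. ?u k)"
      using x y by (intro finsum_cong') (auto simp: add_pow_rdistr m_ac)
    finally show ?thesis .
  qed
  have y_split: "(\<Oplus>k\<in>{..n}. y \<otimes> ?t n k) = y [^] Suc n \<oplus> (\<Oplus>k\<in>{..n}. ?v k)"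
  proof -
    let ?w = "\<lambda>k. add_pow R (n choose k) (x [^] k \<otimes> y [^] (Suc n - k))"
    have wc: "?w k \<in> carrier R" for k using x y by simp
    have "(\<Oplus>k\<in>{..n}. y \<otimes> ?t n k) = (\<Oplus>k\<in>{..n}. ?w k)"
      using x y by (intro finsum_cong') (auto simp: add_pow_rdistr m_ac Suc_diff_le)
    also have "\<dots> = (\<Oplus>k\<in>{..Suc n}. ?w k)"
      using x y wc by (simp add: binomial_eq_0 Pi_iff)
    also have "\<dots> = (\<Oplus>k\<in>{..n}. ?w (Suc k)) \<oplus> ?w 0"
      using finsum_Suc2[of ?w n] wc by (simp add: Pi_iff)
    also have "(\<Oplus>k\<in>{..n}. ?w (Suc k)) = (\<Oplus>k\<in>{..n}. ?v k)" by simp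
    finally show ?thesis using x y tc by (simp add: a_comm finsum_closed Pi_iff del: nat_pow_Suc)
  qed
  have "(x \<oplus> y) [^] Suc n = x \<otimes> (\<Oplus>k\<in>{..n}. ?t n k) \<oplus> y \<otimes> (\<Oplus>k\<in>{..n}. ?t n k)"
    using Suc x y tc by (simp add: m_comm[of _ "x \<oplus> y"] l_distr finsum_closed Pi_iff)
  also have "y \<otimes> (\<Oplus>k\<in>{..n}. ?t n k) = (\<Oplus>k\<in>{..n}. y \<otimes> ?t n k)"
    using finsum_rdistr[of "{..n}" y "?t n"] tc y by (simp add: Pi_iff)
  also note y_split
  also note X
  finally have "(x \<oplus> y) [^] Suc n = ((\<Oplus>k\<in>{..n}. ?u k) \<oplus> (\<Oplus>k\<in>{..n}. ?v k)) \<oplus> y [^] Suc n"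
    using tc x y by (simp add: a_ac finsum_closed Pi_iff del: nat_pow_Suc)
  also have "(\<Oplus>k\<in>{..n}. ?u k) \<oplus> (\<Oplus>k\<in>{..n}. ?v k) = (\<Oplus>k\<in>{..n}. ?u k \<oplus> ?v k)"
    using tc by (simp add: finsum_addf Pi_iff)
  also have "\<dots> = (\<Oplus>k\<in>{..n}. ?t (Suc n) (Suc k))"
    using x y by (intro finsum_cong') (auto simp: add.nat_pow_mult)
  also have "\<dots> \<oplus> y [^] Suc n = (\<Oplus>k\<in>{..Suc n}. ?t (Suc n) k)"
    using finsum_Suc2[of "?t (Suc n)" n] tc x y by (simp add: Pi_iff del: nat_pow_Suc)
  finally show ?case .
qed

lemma (in cring) char_multiple_zero:
  assumes "add_pow R p \<one> = \<zero>" "p dvd n" "x \<in> carrier R"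
  shows "add_pow R (n::nat) x = \<zero>"
proof -
  obtain k where n: "n = p * k" using assms(2) by blast
  have "add_pow R p x = add_pow R p \<one> \<otimes> x" using add_pow_ldistr[of \<one> x p] assms(3) by simp
  then have "add_pow R p x = \<zero>" using assms by simp
  then show ?thesis unfolding n using add.nat_pow_pow[of x k p] assms(3) by simp
qed

lemma (in cring) frobenius_add:
  assumes p: "Factorial_Ring.prime (p::nat)" and char: "add_pow R p \<one> = \<zero>"
    and x: "x \<in> carrier R" and y: "y \<in> carrier R"
  shows "(x \<oplus> y) [^] p = x [^] p \<oplus> y [^] p"
proof -
  let ?t = "\<lambda>k. add_pow R (p choose k) (x [^] k \<otimes> y [^] (p - k))"
  have p2: "2 \<le> p" using p by (rule prime_ge_2_nat)
  obtain m where m: "p = Suc (Suc m)" using p2 by (metis add_2_eq_Suc le_Suc_ex)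
  have tc: "?t k \<in> carrier R" for k using x y by simp
  have mid: "(\<Oplus>k\<in>{..m}. ?t (Suc k)) = (\<Oplus>k\<in>{..m}. \<zero>)"
  proof (rule finsum_cong')
    fix k assume "k \<in> {..m}"
    then have "p dvd (p choose Suc k)" using p m by (intro dvd_choose_prime) auto
    then show "?t (Suc k) = \<zero>" using char_multiple_zero[OF char] x y by simp
  qed auto
  have "(x \<oplus> y) [^] p = (\<Oplus>k\<in>{..Suc (Suc m)}. ?t k)"
    using binomial_expansion[OF x y, of p] m by simp
  also have "\<dots> = ?t p \<oplus> ((\<Oplus>k\<in>{..m}. ?t (Suc k)) \<oplus> ?t 0)"
    using finsum_Suc[of ?t "Suc m"] finsum_Suc2[of ?t m] tc m by (simp add: Pi_iff)
  also have "\<dots> = x [^] p \<oplus> y [^] p" unfolding mid using x y by (simp del: nat_pow_Suc)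
  finally show ?thesis .
qed

lemma (in cring) iterated_frobenius_add:
  assumes p: "Factorial_Ring.prime (p::nat)" and char: "add_pow R p \<one> = \<zero>"
    and x: "x \<in> carrier R" and y: "y \<in> carrier R"
  shows "(x \<oplus> y) [^] (p ^ e) = x [^] (p ^ e) \<oplus> y [^] (p ^ e)"
proof (induction e)
  case 0
  then show ?case using x y by simp
next
  case (Suc e)
  have pw: "z [^] (p ^ Suc e) = (z [^] (p ^ e)) [^] p" if "z \<in> carrier R" for z
    using that by (simp add: nat_pow_pow mult.commute)
  show ?case using Suc x y frobenius_add[OF p char, of "x [^] (p ^ e)" "y [^] (p ^ e)"]
    by (simp add: pw del: power_Suc)
qed

text \<open>The \<open>R\<close>-submodules of \<open>F\<^sup>e\<^sub>*R\<close>, where \<open>q = p\<^sup>e\<close>. Generation is phrased through them, and not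
  through finite sums, so that a generating set can be used by checking closure properties only.\<close>

definition power_submodule :: "('a, 'm) ring_scheme \<Rightarrow> nat \<Rightarrow> 'a set \<Rightarrow> bool" where
  "power_submodule R q H \<longleftrightarrow> H \<subseteq> carrier R \<and> \<zero>\<^bsub>R\<^esub> \<in> H \<and> (\<forall>x\<in>H. \<forall>y\<in>H. x \<oplus>\<^bsub>R\<^esub> y \<in> H) \<and>
     (\<forall>r\<in>carrier R. \<forall>x\<in>H. r [^]\<^bsub>R\<^esub> q \<otimes>\<^bsub>R\<^esub> x \<in> H)"

definition power_generating :: "('a, 'm) ring_scheme \<Rightarrow> nat \<Rightarrow> 'a set \<Rightarrow> bool" where
  "power_generating R q B \<longleftrightarrow> finite B \<and> B \<subseteq> carrier R \<and>
     (\<forall>H. power_submodule R q H \<longrightarrow> B \<subseteq> H \<longrightarrow> carrier R \<subseteq> H)"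

lemma (in cring) F_finite_generating:
  assumes fg: "finitely_generated R (frobenius_push p 1 R (self_module R))"
  shows "\<exists>B. power_generating R p B"
proof -
  let ?M = "frobenius_push p 1 R (self_module R)"
  obtain B where B: "B \<subseteq> carrier R" "finite B"
    and gen: "\<forall>x\<in>carrier R. \<exists>c \<in> B \<rightarrow> carrier R. x = (\<Oplus>\<^bsub>?M\<^esub>b\<in>B. c b \<odot>\<^bsub>?M\<^esub> b)"
    using fg unfolding finitely_generated_def by (auto simp: frobenius_push_def self_module_def)
  have M: "(\<Oplus>\<^bsub>?M\<^esub>b\<in>B. c b \<odot>\<^bsub>?M\<^esub> b) = (\<Oplus>b\<in>B. c b [^] p \<otimes> b)" for c
    unfolding finsum_def finprod_def by (simp add: frobenius_push_def self_module_def)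
  have "carrier R \<subseteq> H" if H: "power_submodule R p H" and BH: "B \<subseteq> H" for H
  proof
    fix x assume "x \<in> carrier R"
    then obtain c where c: "c \<in> B \<rightarrow> carrier R" and x: "x = (\<Oplus>b\<in>B. c b [^] p \<otimes> b)"
      using gen M by metis
    have "(\<Oplus>b\<in>A. c b [^] p \<otimes> b) \<in> H" if "A \<subseteq> B" for A
      using finite_subset[OF that B(2)] that
    proof (induction A rule: finite_induct)
      case empty
      then show ?case using H by (simp add: power_submodule_def)
    next
      case (insert a A)
      have "(\<Oplus>b\<in>insert a A. c b [^] p \<otimes> b) = c a [^] p \<otimes> a \<oplus> (\<Oplus>b\<in>A. c b [^] p \<otimes> b)"
        using insert c B by (intro finsum_insert) (auto simp: Pi_iff subset_iff)
      moreover have "c a \<in> carrier R" "a \<in> H" using insert c BH by auto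
      then have "c a [^] p \<otimes> a \<in> H" using H unfolding power_submodule_def by blast
      moreover have "(\<Oplus>b\<in>A. c b [^] p \<otimes> b) \<in> H" using insert by blast
      moreover have "x \<oplus> y \<in> H" if "x \<in> H" "y \<in> H" for x y
        using H that unfolding power_submodule_def by blast
      ultimately show ?case by simp
    qed
    then show "x \<in> H" using x by simp
  qed
  then show ?thesis using B unfolding power_generating_def by auto
qed

text \<open>Finiteness over \<open>p\<close>-th powers passes to \<open>p\<^sup>e\<close>-th powers: writing \<open>x = \<Sum> r\<^sub>b\<^sup>p b\<close> and
  expanding each coefficient \<open>r\<^sub>b\<close> over \<open>p\<^sup>e\<close>-th powers, the products \<open>b c\<^sup>p\<close> of old generators
  generate over \<open>p\<^bsup>e+1\<^esup>\<close>-th powers.\<close>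

lemma (in cring) power_generating_iterate:
  assumes p: "Factorial_Ring.prime (p::nat)" and char: "add_pow R p \<one> = \<zero>"
    and fg: "power_generating R p B"
  shows "\<exists>C. power_generating R (p ^ e) C"
proof (induction e)
  case 0
  have "carrier R \<subseteq> H" if H: "power_submodule R (p ^ 0) H" "{\<one>} \<subseteq> H" for H
  proof
    fix x assume x: "x \<in> carrier R"
    then have "x [^] (p ^ 0) \<otimes> \<one> \<in> H" using H unfolding power_submodule_def by blast
    then show "x \<in> H" using x by simp
  qed
  then have "power_generating R (p ^ 0) {\<one>}" unfolding power_generating_def by simp
  then show ?case ..
next
  case (Suc e)
  then obtain C where C: "power_generating R (p ^ e) C" by blast
  let ?D = "(\<lambda>(b, c). c [^] p \<otimes> b) ` (B \<times> C)"
  have Bc: "B \<subseteq> carrier R" and Cc: "C \<subseteq> carrier R"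
    using fg C by (auto simp: power_generating_def)
  have "carrier R \<subseteq> H" if H: "power_submodule R (p ^ Suc e) H" and DH: "?D \<subseteq> H" for H
  proof -
    have Hc: "H \<subseteq> carrier R" and Hz: "\<zero> \<in> H" and Ha: "\<And>x y. x \<in> H \<Longrightarrow> y \<in> H \<Longrightarrow> x \<oplus> y \<in> H"
      and Hm: "\<And>r x. r \<in> carrier R \<Longrightarrow> x \<in> H \<Longrightarrow> r [^] (p ^ Suc e) \<otimes> x \<in> H"
      using H unfolding power_submodule_def by auto
    have p0: "p \<noteq> 0" using p by (simp add: prime_gt_0_nat)
    have coeff: "r [^] p \<otimes> b \<in> H" if b: "b \<in> B" and r: "r \<in> carrier R" for b r
    proof -
      \<comment> \<open>The coefficients allowed at \<open>b\<close> form a submodule over \<open>p\<^sup>e\<close>-th powers, and it contains \<open>C\<close>.\<close>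
      let ?K = "{r \<in> carrier R. r [^] p \<otimes> b \<in> H}"
      have bc: "b \<in> carrier R" using b Bc by auto
      have "power_submodule R (p ^ e) ?K"
        unfolding power_submodule_def
      proof (intro conjI ballI)
        show "\<zero> \<in> ?K" using Hz p0 bc by (simp add: nat_pow_zero)
        fix x y assume "x \<in> ?K" "y \<in> ?K"
        then show "x \<oplus> y \<in> ?K" using Ha bc by (simp add: frobenius_add[OF p char] l_distr)
      next
        fix s x assume s: "s \<in> carrier R" and x: "x \<in> ?K"
        have "(s [^] (p ^ e) \<otimes> x) [^] p \<otimes> b = s [^] (p ^ Suc e) \<otimes> (x [^] p \<otimes> b)"
          using s x bc by (simp add: nat_pow_distrib nat_pow_pow m_assoc mult.commute)
        then show "s [^] (p ^ e) \<otimes> x \<in> ?K" using Hm s x by simp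
      qed auto
      moreover have "C \<subseteq> ?K" using DH b Cc by auto
      ultimately show ?thesis using C r unfolding power_generating_def by blast
    qed
    \<comment> \<open>\<open>H\<close> is closed only under \<open>p\<^bsup>e+1\<^esup>\<close>-th powers; its largest subset closed under \<open>p\<close>-th powers
      contains \<open>B\<close>.\<close>
    let ?K = "{x \<in> carrier R. \<forall>r\<in>carrier R. r [^] p \<otimes> x \<in> H}"
    have "power_submodule R p ?K"
      unfolding power_submodule_def
    proof (intro conjI ballI)
      show "\<zero> \<in> ?K" using Hz by simp
      fix x y assume "x \<in> ?K" "y \<in> ?K"
      then show "x \<oplus> y \<in> ?K" using Ha by (auto simp: r_distr)
    next
      fix s x assume s: "s \<in> carrier R" and x: "x \<in> ?K"
      have "r [^] p \<otimes> (s [^] p \<otimes> x) \<in> H" if r: "r \<in> carrier R" for r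
      proof -
        have "r [^] p \<otimes> (s [^] p \<otimes> x) = (r \<otimes> s) [^] p \<otimes> x"
          using r s x by (simp add: nat_pow_distrib m_assoc)
        then show ?thesis using r s x by simp
      qed
      then show "s [^] p \<otimes> x \<in> ?K" using s x by simp
    qed auto
    moreover have "B \<subseteq> ?K" using coeff Bc by auto
    ultimately have "carrier R \<subseteq> ?K" using fg unfolding power_generating_def by blast
    then have "\<one> [^] p \<otimes> x \<in> H" if "x \<in> carrier R" for x using that one_closed by fast
    then show ?thesis by (metis l_one nat_pow_one subsetI)
  qed
  moreover have "finite ?D" using fg C by (auto simp: power_generating_def)
  moreover have "?D \<subseteq> carrier R" using Bc Cc by auto
  ultimately have "power_generating R (p ^ Suc e) ?D" unfolding power_generating_def by simp
  then show ?case ..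
qed

section \<open>Ideals\<close>

lemma (in cring) ideal_by_closure:
  assumes sub: "I \<subseteq> carrier R" and zero: "\<zero> \<in> I"
    and add: "\<And>x y. \<lbrakk>x \<in> I; y \<in> I\<rbrakk> \<Longrightarrow> x \<oplus> y \<in> I"
    and mult: "\<And>r x. \<lbrakk>r \<in> carrier R; x \<in> I\<rbrakk> \<Longrightarrow> r \<otimes> x \<in> I"
  shows "ideal I R"
proof (rule idealI)
  show "subgroup I (add_monoid R)"
  proof (rule add.subgroupI)
    show "I \<noteq> {}" using zero by blast
    fix x assume x: "x \<in> I"
    have "(\<ominus> \<one>) \<otimes> x \<in> I" using x by (intro mult) auto
    moreover have "x \<in> carrier R" using x sub by blast
    ultimately show "\<ominus> x \<in> I" by (simp add: l_minus)
  qed (rule sub, rule add)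
  fix x r assume x: "x \<in> I" and r: "r \<in> carrier R"
  show "r \<otimes> x \<in> I" using r x by (rule mult)
  moreover have "x \<otimes> r = r \<otimes> x" using x r sub by (intro m_comm) auto
  ultimately show "x \<otimes> r \<in> I" by simp
qed (rule ring_axioms)

lemma (in cring) ideal_principal_multiple:
  assumes "ideal J R" "a \<in> carrier R"
  shows "ideal {j \<otimes> a | j. j \<in> J} R"
proof -
  interpret J: ideal J R by (rule assms(1))
  show ?thesis
  proof (rule ideal_by_closure)
    show "{j \<otimes> a | j. j \<in> J} \<subseteq> carrier R" using assms(2) J.Icarr by auto
    have "\<zero> \<otimes> a \<in> {j \<otimes> a | j. j \<in> J}" using J.zero_closed by blast
    then show "\<zero> \<in> {j \<otimes> a | j. j \<in> J}" using assms(2) by simp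
  next
    fix x y assume "x \<in> {j \<otimes> a | j. j \<in> J}" "y \<in> {j \<otimes> a | j. j \<in> J}"
    then obtain j k where j: "j \<in> J" "x = j \<otimes> a" and k: "k \<in> J" "y = k \<otimes> a" by blast
    have "x \<oplus> y = (j \<oplus> k) \<otimes> a" using j k assms(2) J.Icarr by (simp add: l_distr)
    then show "x \<oplus> y \<in> {j \<otimes> a | j. j \<in> J}" using J.a_closed[OF j(1) k(1)] by blast
  next
    fix r x assume r: "r \<in> carrier R" and "x \<in> {j \<otimes> a | j. j \<in> J}"
    then obtain j where j: "j \<in> J" "x = j \<otimes> a" by blast
    have "r \<otimes> x = (r \<otimes> j) \<otimes> a" using j r assms(2) J.Icarr by (simp add: m_assoc)
    then show "r \<otimes> x \<in> {j \<otimes> a | j. j \<in> J}" using J.I_l_closed[OF j(1) r] by blast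
  qed
qed

lemma (in cring) ideal_prod_principal:
  assumes "a \<in> carrier R" "b \<in> carrier R"
  shows "(PIdl a) \<cdot> (PIdl b) = PIdl (a \<otimes> b)"
proof -
  have id: "ideal (PIdl (a \<otimes> b)) R" using assms by (intro cgenideal_ideal) auto
  have sub: "PIdl (a \<otimes> b) \<subseteq> carrier R" using ideal.Icarr[OF id] by blast
  have "(PIdl a) \<cdot> (PIdl b) = Idl (PIdl (a \<otimes> b))"
    using ideal_prod_eq_genideal[OF cgenideal_ideal cgenideal_ideal] cgenideal_prod assms by simp
  also have "\<dots> = PIdl (a \<otimes> b)"
    using genideal_minimal[OF id] genideal_self[OF sub] by blast
  finally show ?thesis .
qed

definition colon :: "('a, 'm) ring_scheme \<Rightarrow> 'a set \<Rightarrow> 'a set \<Rightarrow> 'a set" where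
  "colon R I A = {x \<in> carrier R. \<forall>a\<in>A. a \<otimes>\<^bsub>R\<^esub> x \<in> I}"

lemma (in cring) ideal_colon:
  assumes "ideal I R" "A \<subseteq> carrier R"
  shows "ideal (colon R I A) R"
proof -
  interpret I: ideal I R by (rule assms(1))
  have mem: "x \<in> colon R I A \<longleftrightarrow> x \<in> carrier R \<and> (\<forall>a\<in>A. a \<otimes> x \<in> I)" for x
    by (auto simp: colon_def)
  have Ac: "a \<in> carrier R" if "a \<in> A" for a using that assms(2) by blast
  show ?thesis
  proof (rule ideal_by_closure)
    show "colon R I A \<subseteq> carrier R" by (auto simp: mem)
    show "\<zero> \<in> colon R I A" using Ac I.zero_closed by (simp add: mem)
    show "x \<oplus> y \<in> colon R I A" if "x \<in> colon R I A" "y \<in> colon R I A" for x y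
      using that Ac I.a_closed by (simp add: mem r_distr)
    fix r x assume r: "r \<in> carrier R" and x: "x \<in> colon R I A"
    have "a \<otimes> (r \<otimes> x) \<in> I" if "a \<in> A" for a
    proof -
      have "a \<otimes> (r \<otimes> x) = r \<otimes> (a \<otimes> x)" using Ac[OF that] r x by (intro m_lcomm) (auto simp: mem)
      then show ?thesis using that x r I.I_l_closed by (simp add: mem)
    qed
    then show "r \<otimes> x \<in> colon R I A" using r x by (simp add: mem)
  qed
qed

lemma (in noetherian_ring) maximal_ideal_in_family:
  assumes "F \<noteq> {}" "\<And>I. I \<in> F \<Longrightarrow> ideal I R"
  shows "\<exists>M\<in>F. \<forall>I\<in>F. M \<subseteq> I \<longrightarrow> I = M"
proof (rule subset_Zorn_nonempty[OF assms(1)])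
  fix C assume C: "C \<noteq> {}" "subset.chain F C"
  then have "subset.chain {I. ideal I R} C" using assms(2) unfolding pred_on.chain_def by auto
  then have "\<Union>C \<in> C" using ideal_chain_is_trivial C(1) by blast
  then show "\<Union>C \<in> F" using C(2) unfolding pred_on.chain_def by auto
qed

text \<open>A maximal element \<open>(J : r)\<close> among the colon ideals inside \<open>P\<close> is prime. For suppose that \<open>xy\<close> lies
  in it. If \<open>(J : rx) \<subseteq> P\<close>, maximality gives \<open>(J : rx) = (J : r)\<close>, and \<open>y\<close> lies in it. Otherwise some
  \<open>s \<notin> P\<close> has \<open>rxs \<in> J\<close>; then \<open>(J : rs)\<close> contains \<open>x\<close>, is again inside \<open>P\<close>, and equals \<open>(J : r)\<close>.\<close>

lemma (in cring) exists_prime_colon: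
  assumes noeth: "noetherian_ring R" and J: "ideal J R" and P: "primeideal P R" and JP: "J \<subseteq> P"
  shows "\<exists>r\<in>carrier R. primeideal (colon R J {r}) R \<and> colon R J {r} \<subseteq> P"
proof -
  interpret P: primeideal P R by (rule P)
  interpret J: ideal J R by (rule J)
  let ?F = "{colon R J {r} | r. r \<in> carrier R \<and> colon R J {r} \<subseteq> P}"
  have "colon R J {\<one>} \<subseteq> P" using JP by (auto simp: colon_def)
  then have "colon R J {\<one>} \<in> ?F" by blast
  then have "?F \<noteq> {}" by blast
  moreover have "ideal I R" if "I \<in> ?F" for I using that ideal_colon[OF J] by auto
  ultimately have "\<exists>M\<in>?F. \<forall>I\<in>?F. M \<subseteq> I \<longrightarrow> I = M"
    by (rule noetherian_ring.maximal_ideal_in_family[OF noeth])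
  then obtain M where M: "M \<in> ?F" and max': "\<forall>I\<in>?F. M \<subseteq> I \<longrightarrow> I = M" by (rule bexE)
  have max: "I = M" if "I \<in> ?F" "M \<subseteq> I" for I using bspec[OF max' that(1)] that(2) by (rule mp)
  obtain r where r: "r \<in> carrier R" and Mr: "M = colon R J {r}" and MP: "M \<subseteq> P" using M by blast
  have mem: "x \<in> colon R J {s} \<longleftrightarrow> x \<in> carrier R \<and> s \<otimes> x \<in> J" for x s by (auto simp: colon_def)
  have step: "colon R J {r \<otimes> s} = M" if s: "s \<in> carrier R" and "colon R J {r \<otimes> s} \<subseteq> P" for s
  proof (rule max)
    show "colon R J {r \<otimes> s} \<in> ?F" using that m_closed[OF r s] by blast
    show "M \<subseteq> colon R J {r \<otimes> s}"
    proof
      fix x assume x: "x \<in> M"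
      then have "r \<otimes> s \<otimes> x = s \<otimes> (r \<otimes> x)" using r s by (simp add: Mr mem m_ac)
      then show "x \<in> colon R J {r \<otimes> s}" using x s J.I_l_closed by (simp add: Mr mem)
    qed
  qed
  have "primeideal M R"
  proof (rule primeidealI)
    show "ideal M R" unfolding Mr using ideal_colon[OF J] r by simp
    show "carrier R \<noteq> M" using MP P.I_notcarr P.Icarr by blast
    fix x y assume x: "x \<in> carrier R" and y: "y \<in> carrier R" and xy: "x \<otimes> y \<in> M"
    show "x \<in> M \<or> y \<in> M"
    proof (cases "colon R J {r \<otimes> x} \<subseteq> P")
      case True
      have "y \<in> colon R J {r \<otimes> x}" using xy x y r by (simp add: Mr mem m_assoc)
      then show ?thesis using step[OF x True] by simp
    next
      case False
      then obtain s where s: "s \<in> carrier R" "r \<otimes> x \<otimes> s \<in> J" "s \<notin> P" using mem by blast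
      have "colon R J {r \<otimes> s} \<subseteq> P"
      proof
        fix s' assume s': "s' \<in> colon R J {r \<otimes> s}"
        then have s'c: "s' \<in> carrier R" "r \<otimes> s \<otimes> s' \<in> J" unfolding mem by auto
        then have "s \<otimes> s' \<in> M" using r s by (simp add: Mr mem m_assoc[symmetric])
        then have "s \<otimes> s' \<in> P" using MP by blast
        then show "s' \<in> P" using P.I_prime[OF s(1) s'c(1)] s(3) by blast
      qed
      then have "colon R J {r \<otimes> s} = M" by (rule step[OF s(1)])
      moreover have "x \<in> colon R J {r \<otimes> s}" using s x r by (simp add: mem m_ac)
      ultimately show ?thesis by simp
    qed
  qed (rule is_cring)
  then show ?thesis using r MP Mr by blast
qed

lemma (in cring) genideal_insert:
  assumes a: "a \<in> carrier R" and A: "A \<subseteq> carrier R" and w: "w \<in> Idl (insert a A)"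
  shows "\<exists>r\<in>carrier R. \<exists>v\<in>Idl A. w = r \<otimes> a \<oplus> v"
proof -
  interpret N: ideal "Idl A" R using A by (rule genideal_ideal)
  let ?S = "{r \<otimes> a | r. r \<in> carrier R} <+>\<^bsub>R\<^esub> Idl A"
  have id: "ideal ?S R"
    using ideal_principal_multiple[OF oneideal a] N.ideal_axioms by (rule add_ideals)
  have memI: "r \<otimes> a \<oplus> v \<in> ?S" if "r \<in> carrier R" "v \<in> Idl A" for r v
    using that unfolding set_add_def' by blast
  have "insert a A \<subseteq> ?S"
  proof
    fix x assume "x \<in> insert a A"
    then consider "x = a" | "x \<in> Idl A" using genideal_self[OF A] by blast
    then show "x \<in> ?S"
    proof cases
      case 1
      then show ?thesis using memI[of \<one> \<zero>] a N.zero_closed by simp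
    next
      case 2
      then show ?thesis using memI[of \<zero> x] a N.Icarr by simp
    qed
  qed
  then have "Idl (insert a A) \<subseteq> ?S" by (rule genideal_minimal[OF id])
  then show ?thesis using w unfolding set_add_def' by blast
qed

section \<open>Ideals stable under a Frobenius splitting\<close>

text \<open>The map \<open>\<phi>\<close> is an \<open>R\<close>-linear retraction \<open>F\<^sup>e\<^sub>*R \<rightarrow> R\<close> of the iterated Frobenius, viewed as a map on the
  set \<open>R\<close>.\<close>

locale frobenius_split = noetherian_ring R + cring R for R :: "('a, 'm) ring_scheme" (structure) +
  fixes q :: nat and \<phi> :: "'a \<Rightarrow> 'a"
  assumes q_ge_2: "2 \<le> q"
    and power_q_add: "\<lbrakk>x \<in> carrier R; y \<in> carrier R\<rbrakk> \<Longrightarrow> (x \<oplus> y) [^] q = x [^] q \<oplus> y [^] q"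
    and trace_closed [simp, intro]: "x \<in> carrier R \<Longrightarrow> \<phi> x \<in> carrier R"
    and trace_add: "\<lbrakk>x \<in> carrier R; y \<in> carrier R\<rbrakk> \<Longrightarrow> \<phi> (x \<oplus> y) = \<phi> x \<oplus> \<phi> y"
    and trace_mult: "\<lbrakk>r \<in> carrier R; x \<in> carrier R\<rbrakk> \<Longrightarrow> \<phi> (r [^] q \<otimes> x) = r \<otimes> \<phi> x"
    and trace_one: "\<phi> \<one> = \<one>"
begin

definition stable :: "'a set \<Rightarrow> bool" where
  "stable I \<longleftrightarrow> ideal I R \<and> (\<forall>x\<in>I. \<phi> x \<in> I)"

lemma trace_power: "x \<in> carrier R \<Longrightarrow> \<phi> (x [^] q) = x"
  using trace_mult[of x \<one>] trace_one by simp

lemma trace_zero: "\<phi> \<zero> = \<zero>"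
  using trace_power[of \<zero>] q_ge_2 by (simp add: nat_pow_zero)

lemma power_q_split: "x \<in> carrier R \<Longrightarrow> x [^] q = x [^] (q - 1) \<otimes> x"
  using q_ge_2 nat_pow_Suc[of x "q - 1"] by simp

lemma power_q_split2: "x \<in> carrier R \<Longrightarrow> x [^] q = x \<otimes> x \<otimes> x [^] (q - 2)"
proof -
  assume x: "x \<in> carrier R"
  obtain m where m: "q = Suc (Suc m)" using q_ge_2 by (metis add_2_eq_Suc le_Suc_ex)
  show ?thesis unfolding m using x by (simp add: m_ac)
qed

text \<open>If \<open>x\<^sup>2 \<in> I\<close> then \<open>x\<^sup>q \<in> I\<close>, and \<open>\<phi>\<close> carries \<open>x\<^sup>q\<close> back to \<open>x\<close>.\<close>

lemma stable_radical:
  assumes "stable I" "x \<in> carrier R" "x \<otimes> x \<in> I"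
  shows "x \<in> I"
proof -
  interpret I: ideal I R using assms(1) by (simp add: stable_def)
  have "x [^] q \<in> I" using I.I_r_closed[OF assms(3)] assms(2) by (simp add: power_q_split2)
  then have "\<phi> (x [^] q) \<in> I" using assms(1) by (simp add: stable_def)
  then show ?thesis using assms(2) by (simp add: trace_power)
qed

lemma stable_sum:
  assumes "stable I" "stable J"
  shows "stable (I <+>\<^bsub>R\<^esub> J)"
proof -
  have id: "ideal I R" "ideal J R" using assms by (auto simp: stable_def)
  then have sub: "I \<subseteq> carrier R" "J \<subseteq> carrier R" using ideal.Icarr by fast+
  have "\<phi> z \<in> I <+>\<^bsub>R\<^esub> J" if z: "z \<in> I <+>\<^bsub>R\<^esub> J" for z
  proof -
    obtain i j where "i \<in> I" "j \<in> J" "z = i \<oplus> j" using z by (auto simp: set_add_def')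
    then have "\<phi> z = \<phi> i \<oplus> \<phi> j" "\<phi> i \<in> I" "\<phi> j \<in> J"
      using assms sub trace_add by (auto simp: stable_def)
    then show ?thesis by (auto simp: set_add_def')
  qed
  then show ?thesis using add_ideals id by (simp add: stable_def)
qed

lemma stable_Inter:
  assumes "F \<noteq> {}" "\<And>I. I \<in> F \<Longrightarrow> stable I"
  shows "stable (\<Inter>F)"
  using assms i_Intersect[of F] unfolding stable_def by blast

text \<open>Since \<open>a \<phi>(x) = \<phi>(a\<^sup>q x)\<close>, stability passes to colon ideals.\<close>

lemma stable_colon:
  assumes "stable I" "A \<subseteq> carrier R"
  shows "stable (colon R I A)"
proof -
  interpret I: ideal I R using assms(1) by (simp add: stable_def)
  have "ideal (colon R I A) R" using I.ideal_axioms assms(2) by (rule ideal_colon)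
  moreover have "\<phi> x \<in> colon R I A" if x: "x \<in> colon R I A" for x
  proof -
    have "a \<otimes> \<phi> x \<in> I" if a: "a \<in> A" for a
    proof -
      have c: "a \<in> carrier R" "x \<in> carrier R" "a \<otimes> x \<in> I"
        using a x assms(2) by (auto simp: colon_def)
      then have "a [^] q \<otimes> x = a [^] (q - 1) \<otimes> (a \<otimes> x)" by (simp add: power_q_split m_assoc)
      then have "a [^] q \<otimes> x \<in> I" using c I.I_l_closed by simp
      then have "\<phi> (a [^] q \<otimes> x) \<in> I" using assms(1) by (simp add: stable_def)
      then show ?thesis using c trace_mult by simp
    qed
    then show ?thesis using x by (auto simp: colon_def)
  qed
  ultimately show ?thesis by (simp add: stable_def)
qed

subsection \<open>Elements forced into every larger stable ideal\<close>

text \<open>The properties of the operators \<open>x \<mapsto> \<Sum> \<phi>(g\<^sub>i x)\<^sup>q b\<^sub>i\<close> that matter: they are \<open>q\<close>-linear, they turn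
  functionals \<open>\<phi>(g \<cdot>)\<close> into functionals of the same form, and they map stable ideals into their
  squares. Working with these properties avoids carrying the families of the \<open>g\<^sub>i\<close> and \<open>b\<^sub>i\<close> along.\<close>

definition trace_operator :: "('a \<Rightarrow> 'a) \<Rightarrow> bool" where
  "trace_operator T \<longleftrightarrow> T \<in> carrier R \<rightarrow> carrier R \<and>
     (\<forall>x\<in>carrier R. \<forall>y\<in>carrier R. T (x \<oplus> y) = T x \<oplus> T y) \<and>
     (\<forall>r\<in>carrier R. \<forall>x\<in>carrier R. T (r [^] q \<otimes> x) = r [^] q \<otimes> T x) \<and>
     (\<forall>g\<in>carrier R. \<exists>h\<in>carrier R. \<forall>x\<in>carrier R. \<phi> (g \<otimes> T x) = \<phi> (h \<otimes> x)) \<and>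
     (\<forall>I. stable I \<longrightarrow> (\<forall>x\<in>I. T x \<in> I \<cdot> I))"

lemma trace_operator_zero: "trace_operator (\<lambda>_. \<zero>)"
proof -
  have "\<zero> \<in> I \<cdot> I" if "stable I" for I
    using ideal_prod_is_ideal[of I I] that
    by (simp add: stable_def additive_subgroup.zero_closed ideal.axioms(1))
  moreover have "\<exists>h\<in>carrier R. \<forall>x\<in>carrier R. \<phi> (g \<otimes> \<zero>) = \<phi> (h \<otimes> x)" if "g \<in> carrier R" for g
    using that by (intro bexI[of _ \<zero>]) auto
  ultimately show ?thesis unfolding trace_operator_def by auto
qed

text \<open>The functional \<open>\<phi>(k \<cdot>)\<close> of the new summand is
  \<open>\<phi>(\<phi>(gx)\<^sup>q kb) = \<phi>(gx) \<phi>(kb) = \<phi>(\<phi>(kb)\<^sup>q g x)\<close>, again of the required form. A stable \<open>I\<close> containing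
  \<open>x\<close> contains \<open>\<phi>(gx)\<close>, whose \<open>q\<close>-th power lies in \<open>I\<^sup>2\<close> because \<open>q \<ge> 2\<close>.\<close>

lemma trace_operator_step:
  assumes T: "trace_operator T" and u: "u \<in> carrier R" and g: "g \<in> carrier R" and b: "b \<in> carrier R"
  shows "trace_operator (\<lambda>x. u [^] q \<otimes> T x \<oplus> \<phi> (g \<otimes> x) [^] q \<otimes> b)"
proof -
  let ?T = "\<lambda>x. u [^] q \<otimes> T x \<oplus> \<phi> (g \<otimes> x) [^] q \<otimes> b"
  have Tc [simp]: "T x \<in> carrier R" if "x \<in> carrier R" for x
    using T that by (auto simp: trace_operator_def)
  have Ta: "T (x \<oplus> y) = T x \<oplus> T y" if "x \<in> carrier R" "y \<in> carrier R" for x y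
    using T that by (auto simp: trace_operator_def)
  have Tm: "T (r [^] q \<otimes> x) = r [^] q \<otimes> T x" if "r \<in> carrier R" "x \<in> carrier R" for r x
    using T that by (auto simp: trace_operator_def)
  have add: "?T (x \<oplus> y) = ?T x \<oplus> ?T y" if x: "x \<in> carrier R" and y: "y \<in> carrier R" for x y
  proof -
    have "\<phi> (g \<otimes> (x \<oplus> y)) [^] q = \<phi> (g \<otimes> x) [^] q \<oplus> \<phi> (g \<otimes> y) [^] q"
      using x y g by (simp add: r_distr trace_add power_q_add)
    then show ?thesis using x y g u b by (simp add: Ta l_distr r_distr a_ac)
  qed
  have mult: "?T (r [^] q \<otimes> x) = r [^] q \<otimes> ?T x" if r: "r \<in> carrier R" and x: "x \<in> carrier R" for r x
  proof -
    have "g \<otimes> (r [^] q \<otimes> x) = r [^] q \<otimes> (g \<otimes> x)" using r x g by (simp add: m_lcomm)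
    then have "\<phi> (g \<otimes> (r [^] q \<otimes> x)) [^] q = r [^] q \<otimes> \<phi> (g \<otimes> x) [^] q"
      using r x g by (simp add: trace_mult nat_pow_distrib)
    then show ?thesis
      unfolding Tm[OF r x] using r x g u b by (simp add: r_distr m_assoc m_lcomm[of "u [^] q"])
  qed
  have factor: "\<exists>h\<in>carrier R. \<forall>x\<in>carrier R. \<phi> (k \<otimes> ?T x) = \<phi> (h \<otimes> x)" if k: "k \<in> carrier R" for k
  proof -
    have "k \<otimes> u [^] q \<in> carrier R" using k u by simp
    then obtain h where h: "h \<in> carrier R"
      "\<forall>x\<in>carrier R. \<phi> (k \<otimes> u [^] q \<otimes> T x) = \<phi> (h \<otimes> x)"
      using T unfolding trace_operator_def by blast
    let ?h = "h \<oplus> \<phi> (k \<otimes> b) [^] q \<otimes> g"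
    have "\<phi> (k \<otimes> ?T x) = \<phi> (?h \<otimes> x)" if x: "x \<in> carrier R" for x
    proof -
      have "k \<otimes> ?T x = k \<otimes> u [^] q \<otimes> T x \<oplus> \<phi> (g \<otimes> x) [^] q \<otimes> (k \<otimes> b)"
        using k u x g b by (simp add: r_distr m_ac)
      then have "\<phi> (k \<otimes> ?T x) = \<phi> (h \<otimes> x) \<oplus> \<phi> (g \<otimes> x) \<otimes> \<phi> (k \<otimes> b)"
        using k u x g b h by (simp add: trace_add trace_mult)
      also have "\<dots> = \<phi> (h \<otimes> x) \<oplus> \<phi> (\<phi> (k \<otimes> b) [^] q \<otimes> (g \<otimes> x))"
        using k x g b by (simp add: trace_mult m_comm[of "\<phi> (g \<otimes> x)"])
      also have "\<dots> = \<phi> (?h \<otimes> x)"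
        using k x g b h by (simp add: l_distr trace_add m_assoc)
      finally show ?thesis .
    qed
    moreover have "?h \<in> carrier R" using h k g b by simp
    ultimately show ?thesis by blast
  qed
  have square: "?T x \<in> I \<cdot> I" if stI: "stable I" and x: "x \<in> I" for I x
  proof -
    interpret I: ideal I R using stI by (simp add: stable_def)
    interpret II: ideal "I \<cdot> I" R using ideal_prod_is_ideal I.ideal_axioms by blast
    have xc: "x \<in> carrier R" using x I.Icarr by blast
    have "T x \<in> I \<cdot> I" using T stI x by (auto simp: trace_operator_def)
    then have 1: "u [^] q \<otimes> T x \<in> I \<cdot> I" using u II.I_l_closed by simp
    have "g \<otimes> x \<in> I" using x g I.I_l_closed by simp
    then have "\<phi> (g \<otimes> x) \<in> I" using stI by (simp add: stable_def)
    from this this have "\<phi> (g \<otimes> x) \<otimes> \<phi> (g \<otimes> x) \<in> I \<cdot> I" by (rule ideal_prod.prod)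
    then have "\<phi> (g \<otimes> x) [^] q \<in> I \<cdot> I" using II.I_r_closed g xc by (simp add: power_q_split2)
    then have "\<phi> (g \<otimes> x) [^] q \<otimes> b \<in> I \<cdot> I" using II.I_r_closed b by simp
    then show ?thesis using 1 by (rule II.a_closed[rotated])
  qed
  show ?thesis
    unfolding trace_operator_def
    using add mult factor square u g b by auto
qed

text \<open>Given \<open>T\<close> that is multiplication by \<open>c\<close> modulo \<open>P\<close> on \<open>B\<close>, let \<open>y = c\<beta> - T\<beta>\<close> be the defect at
  a further element \<open>\<beta>\<close>. If \<open>y \<notin> P\<close>, the functional \<open>x \<mapsto> \<phi>(y\<^bsup>q-1\<^esup>(cx - Tx))\<close> vanishes on \<open>B\<close> modulo \<open>P\<close>
  and takes the value \<open>\<phi>(y\<^sup>q) = y\<close> at \<open>\<beta>\<close>, and it is again of the form \<open>x \<mapsto> \<phi>(hx)\<close>; it corrects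
  \<open>T\<close> at \<open>\<beta>\<close> at the price of replacing \<open>c\<close> by \<open>y\<^sup>q c\<close>.\<close>

lemma trace_operator_scalar_finite:
  assumes P: "stable P" "primeideal P R" and B: "finite B" "B \<subseteq> carrier R"
  shows "\<exists>T c. trace_operator T \<and> c \<in> carrier R \<and> c \<notin> P \<and> (\<forall>x\<in>B. c \<otimes> x \<ominus> T x \<in> P)"
  using B
proof (induction B rule: finite_induct)
  case empty
  have "\<one> \<notin> P" using P(2) primeideal.I_notcarr ideal.one_imp_carrier primeideal.axioms(1) by metis
  then show ?case using trace_operator_zero by blast
next
  case (insert \<beta> B)
  interpret P: primeideal P R by (rule P(2))
  obtain T c where T: "trace_operator T" and c: "c \<in> carrier R" "c \<notin> P"
    and TB: "\<And>x. x \<in> B \<Longrightarrow> c \<otimes> x \<ominus> T x \<in> P"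
    using insert by auto
  have \<beta>: "\<beta> \<in> carrier R" and Bc: "\<And>x. x \<in> B \<Longrightarrow> x \<in> carrier R" using insert by auto
  have Tc [simp]: "T x \<in> carrier R" if "x \<in> carrier R" for x
    using T that by (auto simp: trace_operator_def)
  define y where "y = c \<otimes> \<beta> \<ominus> T \<beta>"
  have y: "y \<in> carrier R" using c \<beta> by (simp add: y_def)
  show ?case
  proof (cases "y \<in> P")
    case True
    then show ?thesis using T c TB unfolding y_def by blast
  next
    case False
    define g where "g = y [^] (q - 1)"
    have g: "g \<in> carrier R" using y by (simp add: g_def)
    have "\<exists>h\<in>carrier R. \<forall>x\<in>carrier R. \<phi> (g \<otimes> T x) = \<phi> (h \<otimes> x)"
      using T g by (simp add: trace_operator_def)
    then obtain h where h: "h \<in> carrier R" "\<And>x. x \<in> carrier R \<Longrightarrow> \<phi> (g \<otimes> T x) = \<phi> (h \<otimes> x)"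
      by auto
    define g' where "g' = g \<otimes> c \<ominus> h"
    have g': "g' \<in> carrier R" using g c h by (simp add: g'_def)
    have L: "\<phi> (g' \<otimes> x) = \<phi> (g \<otimes> (c \<otimes> x \<ominus> T x))" if x: "x \<in> carrier R" for x
    proof -
      have neg: "\<phi> (\<ominus> z) = \<ominus> \<phi> z" if z: "z \<in> carrier R" for z
      proof -
        have "\<phi> (\<ominus> z) \<oplus> \<phi> z = \<phi> (\<ominus> z \<oplus> z)" using z trace_add[of "\<ominus> z" z] by simp
        also have "\<dots> = \<zero>" using z by (simp add: l_neg trace_zero)
        finally show ?thesis using z by (simp add: minus_equality)
      qed
      have "g' \<otimes> x = g \<otimes> (c \<otimes> x) \<oplus> \<ominus> (h \<otimes> x)"
        using x g c h by (simp add: g'_def minus_eq l_distr m_assoc l_minus)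
      then have "\<phi> (g' \<otimes> x) = \<phi> (g \<otimes> (c \<otimes> x)) \<oplus> \<ominus> \<phi> (h \<otimes> x)"
        using x g c h by (simp add: trace_add neg)
      also have "\<dots> = \<phi> (g \<otimes> (c \<otimes> x)) \<oplus> \<phi> (\<ominus> (g \<otimes> T x))"
        using x g c h by (simp add: neg)
      also have "\<dots> = \<phi> (g \<otimes> (c \<otimes> x \<ominus> T x))"
        using x g c by (simp add: trace_add[symmetric] minus_eq r_distr r_minus)
      finally show ?thesis .
    qed
    have L\<beta>: "\<phi> (g' \<otimes> \<beta>) = y"
      using L[OF \<beta>] y power_q_split[OF y] trace_power[OF y] by (simp add: y_def[symmetric] g_def)
    have LB: "\<phi> (g' \<otimes> x) \<in> P" if "x \<in> B" for x
      using L[OF Bc[OF that]] TB[OF that] g P(1) P.I_l_closed by (simp add: stable_def)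
    define T' where "T' = (\<lambda>x. y [^] q \<otimes> T x \<oplus> \<phi> (g' \<otimes> x) [^] q \<otimes> y)"
    define c' where "c' = y [^] q \<otimes> c"
    have "trace_operator T'" unfolding T'_def using T y g' by (intro trace_operator_step)
    moreover have c': "c' \<in> carrier R" using y c by (simp add: c'_def)
    moreover have "c' \<notin> P"
    proof
      assume "c' \<in> P"
      then have "y [^] q \<in> P" using P.I_prime[of "y [^] q" c] c y by (auto simp: c'_def)
      then have "\<phi> (y [^] q) \<in> P" using P(1) by (simp add: stable_def)
      then show False using False y by (simp add: trace_power)
    qed
    moreover have "c' \<otimes> x \<ominus> T' x \<in> P" if x: "x \<in> insert \<beta> B" for x
    proof (cases "x = \<beta>")
      case True
      have "T' \<beta> = y [^] q \<otimes> (T \<beta> \<oplus> y)" using y \<beta> by (simp add: T'_def L\<beta> r_distr)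
      also have "T \<beta> \<oplus> y = c \<otimes> \<beta>" using c \<beta> by (simp add: y_def minus_eq a_comm[of "T \<beta>"] a_assoc l_neg)
      finally have "T' \<beta> = c' \<otimes> \<beta>" using y c \<beta> by (simp add: c'_def m_assoc)
      then show ?thesis using True c' \<beta> by (simp add: minus_eq r_neg)
    next
      case False
      then have xB: "x \<in> B" using x by simp
      then have xc: "x \<in> carrier R" using Bc by blast
      let ?l = "\<phi> (g' \<otimes> x)"
      have l: "?l \<in> carrier R" using xc g' by simp
      have "?l [^] q \<otimes> y \<in> P"
      proof -
        have "?l [^] (q - 1) \<otimes> ?l \<in> P" using LB[OF xB] l P.I_l_closed by simp
        then have "?l [^] q \<in> P" using power_q_split[OF l] by simp
        then show ?thesis using y P.I_r_closed by simp
      qed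
      moreover have "y [^] q \<otimes> (c \<otimes> x \<ominus> T x) \<in> P" using TB[OF xB] y P.I_l_closed by simp
      ultimately have "y [^] q \<otimes> (c \<otimes> x \<ominus> T x) \<ominus> ?l [^] q \<otimes> y \<in> P"
        using P.a_closed P.a_inv_closed by (simp add: minus_eq)
      moreover have "y [^] q \<otimes> (c \<otimes> x \<ominus> T x) \<ominus> ?l [^] q \<otimes> y = c' \<otimes> x \<ominus> T' x"
        using y c xc l by (simp add: T'_def c'_def minus_eq r_distr minus_add r_minus m_assoc a_assoc)
      ultimately show ?thesis by simp
    qed
    ultimately show ?thesis by blast
  qed
qed

text \<open>By \<open>q\<close>-linearity, the elements on which \<open>T\<close> is multiplication by \<open>c\<close> modulo \<open>P\<close> form a submodule of
  \<open>F\<^sup>e\<^sub>*R\<close>.\<close>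

lemma trace_operator_scalar:
  assumes P: "stable P" "primeideal P R" and gen: "power_generating R q B"
  shows "\<exists>T c. trace_operator T \<and> c \<in> carrier R \<and> c \<notin> P \<and> (\<forall>x\<in>carrier R. c \<otimes> x \<ominus> T x \<in> P)"
proof -
  interpret P: primeideal P R by (rule P(2))
  have "finite B" "B \<subseteq> carrier R" using gen by (auto simp: power_generating_def)
  then obtain T c where T: "trace_operator T" and c: "c \<in> carrier R" "c \<notin> P"
    and TB: "\<forall>x\<in>B. c \<otimes> x \<ominus> T x \<in> P"
    using trace_operator_scalar_finite[OF P] by blast
  have Tc [simp]: "T x \<in> carrier R" if "x \<in> carrier R" for x
    using T that by (auto simp: trace_operator_def)
  let ?H = "{x \<in> carrier R. c \<otimes> x \<ominus> T x \<in> P}"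
  have "power_submodule R q ?H"
    unfolding power_submodule_def
  proof (intro conjI ballI)
    show "?H \<subseteq> carrier R" by auto
    have "T (\<zero> [^] q \<otimes> \<zero>) = \<zero> [^] q \<otimes> T \<zero>"
      using T zero_closed unfolding trace_operator_def by blast
    then have "T \<zero> = \<zero>" using q_ge_2 by (simp add: nat_pow_zero)
    then show "\<zero> \<in> ?H" using c P.zero_closed by (simp add: minus_eq)
  next
    fix x y assume xy: "x \<in> ?H" "y \<in> ?H"
    then have "T (x \<oplus> y) = T x \<oplus> T y" using T by (auto simp: trace_operator_def)
    then have "c \<otimes> (x \<oplus> y) \<ominus> T (x \<oplus> y) = (c \<otimes> x \<ominus> T x) \<oplus> (c \<otimes> y \<ominus> T y)"
      using xy c by (simp add: minus_eq r_distr minus_add a_ac)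
    then show "x \<oplus> y \<in> ?H" using xy P.a_closed by simp
  next
    fix r x assume r: "r \<in> carrier R" and x: "x \<in> ?H"
    then have "T (r [^] q \<otimes> x) = r [^] q \<otimes> T x" using T by (auto simp: trace_operator_def)
    then have "c \<otimes> (r [^] q \<otimes> x) \<ominus> T (r [^] q \<otimes> x) = r [^] q \<otimes> (c \<otimes> x \<ominus> T x)"
      using r x c by (simp add: minus_eq r_distr r_minus m_lcomm)
    then show "r [^] q \<otimes> x \<in> ?H" using r x P.I_l_closed by simp
  qed
  then have "carrier R \<subseteq> ?H" using gen TB unfolding power_generating_def by blast
  then show ?thesis using T c by blast
qed

subsection \<open>Finiteness\<close>

text \<open>The ideal \<open>P + J A\<close>.\<close>

definition span_over :: "'a set \<Rightarrow> 'a set \<Rightarrow> 'a set \<Rightarrow> 'a set" where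
  "span_over P J A = Idl (P \<union> {j \<otimes> a | j a. j \<in> J \<and> a \<in> A})"

lemma span_over_ideal:
  assumes "ideal P R" "ideal J R" "A \<subseteq> carrier R"
  shows "ideal (span_over P J A) R" "P \<subseteq> span_over P J A"
    and "\<And>j a. \<lbrakk>j \<in> J; a \<in> A\<rbrakk> \<Longrightarrow> j \<otimes> a \<in> span_over P J A"
proof -
  have sub: "P \<union> {j \<otimes> a | j a. j \<in> J \<and> a \<in> A} \<subseteq> carrier R"
    using assms ideal.Icarr by fastforce
  then show "ideal (span_over P J A) R" unfolding span_over_def by (rule genideal_ideal)
  show "P \<subseteq> span_over P J A" "\<And>j a. \<lbrakk>j \<in> J; a \<in> A\<rbrakk> \<Longrightarrow> j \<otimes> a \<in> span_over P J A"
    using genideal_self[OF sub] unfolding span_over_def by auto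
qed

lemma span_over_insert:
  assumes "ideal P R" "ideal J R" "a \<in> carrier R" "A \<subseteq> carrier R" "z \<in> span_over P J (insert a A)"
  shows "\<exists>j\<in>J. \<exists>n\<in>span_over P J A. z = j \<otimes> a \<oplus> n"
proof -
  let ?S = "{j \<otimes> a | j. j \<in> J} <+>\<^bsub>R\<^esub> span_over P J A"
  note S = span_over_ideal[OF assms(1,2,4)]
  interpret J: ideal J R by (rule assms(2))
  interpret N: ideal "span_over P J A" R by (rule S(1))
  have id: "ideal ?S R" using ideal_principal_multiple[OF assms(2,3)] S(1) by (rule add_ideals)
  have "P \<union> {j \<otimes> b | j b. j \<in> J \<and> b \<in> insert a A} \<subseteq> ?S"
  proof
    fix x assume "x \<in> P \<union> {j \<otimes> b | j b. j \<in> J \<and> b \<in> insert a A}"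
    then consider "x \<in> span_over P J A" | j where "j \<in> J" "x = j \<otimes> a" using S by auto
    then show "x \<in> ?S"
    proof cases
      case 1
      then have "x = \<zero> \<otimes> a \<oplus> x" using assms(3) N.Icarr by simp
      moreover have "\<zero> \<otimes> a \<in> {j \<otimes> a | j. j \<in> J}" using J.zero_closed by blast
      ultimately show ?thesis using 1 unfolding set_add_def' by blast
    next
      case 2
      then have "x = j \<otimes> a \<oplus> \<zero>" using assms(3) J.Icarr by simp
      then show ?thesis using 2 N.zero_closed unfolding set_add_def' by blast
    qed
  qed
  then have "span_over P J (insert a A) \<subseteq> ?S"
    unfolding span_over_def by (rule genideal_minimal[OF id[unfolded span_over_def]])
  then show ?thesis using assms(5) by (fastforce simp: set_add_def')
qed

text \<open>This replaces the determinant trick: a generator is eliminated at each step, which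
  changes the scalar \<open>c\<close> into its square modulo \<open>J\<close>.\<close>

lemma scalar_in_radical:
  assumes P: "primeideal P R" and J: "ideal J R" "P \<subseteq> J"
    and rad: "\<And>x. \<lbrakk>x \<in> carrier R; x \<otimes> x \<in> J\<rbrakk> \<Longrightarrow> x \<in> J"
    and A: "finite A" "A \<subseteq> carrier R" "\<not> A \<subseteq> P"
    and c: "c \<in> carrier R" "\<And>x. x \<in> A \<Longrightarrow> c \<otimes> x \<in> span_over P J A"
  shows "c \<in> J"
  using A c
proof (induction A arbitrary: c rule: finite_induct)
  case empty
  then show ?case by simp
next
  case (insert a A)
  interpret P: primeideal P R by (rule P)
  interpret J: ideal J R by (rule J(1))
  have a: "a \<in> carrier R" and Ac: "A \<subseteq> carrier R" using insert by auto
  note S = span_over_ideal[OF P.ideal_axioms J(1) Ac]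
  interpret N: ideal "span_over P J A" R by (rule S(1))
  note c = \<open>c \<in> carrier R\<close>
  have decomp: "\<exists>j\<in>J. \<exists>n\<in>span_over P J A. c \<otimes> x = j \<otimes> a \<oplus> n" if "x \<in> insert a A" for x
    using span_over_insert[OF P.ideal_axioms J(1) a Ac] insert.prems that by blast
  obtain k m where k: "k \<in> J" and m: "m \<in> span_over P J A" and ca: "c \<otimes> a = k \<otimes> a \<oplus> m"
    using decomp[of a] by blast
  have kc: "k \<in> carrier R" and mc: "m \<in> carrier R" using k m J.Icarr N.Icarr by auto
  \<comment> \<open>The relation \<open>(c - k)a = m\<close> eliminates \<open>a\<close>; as \<open>k \<in> J\<close>, the scalars \<open>c\<close> and \<open>d\<close> agree modulo \<open>J\<close>.\<close>
  define d where "d = c \<ominus> k"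
  have d: "d \<in> carrier R" using c kc by (simp add: d_def)
  have da: "d \<otimes> a = m"
  proof -
    have "d \<otimes> a = \<ominus> (k \<otimes> a) \<oplus> (k \<otimes> a \<oplus> m)"
      using c kc a mc by (simp add: d_def minus_eq l_distr l_minus ca a_comm)
    then show ?thesis using kc a mc by (simp add: a_assoc[symmetric] l_neg)
  qed
  have cJ: "c \<in> J" if "d \<in> J"
  proof -
    have "d \<oplus> k = c" using c kc by (simp add: d_def minus_eq a_assoc l_neg)
    then show ?thesis using J.a_closed[OF that k] by simp
  qed
  show ?case
  proof (cases "A \<subseteq> P")
    case True
    have "P \<union> {j \<otimes> b | j b. j \<in> J \<and> b \<in> A} \<subseteq> P"
      using True P.I_l_closed J.Icarr by auto
    then have "span_over P J A \<subseteq> P"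
      unfolding span_over_def by (rule genideal_minimal[OF P.ideal_axioms])
    then have "d \<otimes> a \<in> P" using da m by auto
    moreover have "a \<notin> P" using True insert.prems by auto
    ultimately show ?thesis using P.I_prime d a cJ J(2) by blast
  next
    case False
    have "d \<otimes> c \<otimes> x \<in> span_over P J A" if x: "x \<in> A" for x
    proof -
      obtain j n where j: "j \<in> J" and n: "n \<in> span_over P J A" and cx: "c \<otimes> x = j \<otimes> a \<oplus> n"
        using decomp[of x] x by blast
      have carr: "j \<in> carrier R" "n \<in> carrier R" "x \<in> carrier R"
        using j n x Ac J.Icarr N.Icarr by auto
      have "d \<otimes> c \<otimes> x = d \<otimes> (j \<otimes> a \<oplus> n)" using c d carr by (simp add: m_assoc cx)
      also have "\<dots> = j \<otimes> (d \<otimes> a) \<oplus> d \<otimes> n" using c d a carr by (simp add: r_distr m_lcomm)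
      finally have "d \<otimes> c \<otimes> x = j \<otimes> m \<oplus> d \<otimes> n" using da by simp
      then show ?thesis using N.a_closed N.I_l_closed m n d carr by simp
    qed
    then have dc: "d \<otimes> c \<in> J" using insert.IH[OF Ac False, of "d \<otimes> c"] c d by simp
    have "d \<otimes> d = d \<otimes> c \<oplus> \<ominus> (d \<otimes> k)" using c kc d by (simp add: d_def minus_eq r_distr r_minus)
    then have "d \<otimes> d \<in> J" using dc J.a_closed J.a_inv_closed J.I_l_closed[OF k d] by simp
    then show ?thesis using rad[OF d] cJ by blast
  qed
qed

text \<open>Modulo \<open>P\<close> the operator \<open>T\<close> is multiplication by \<open>c\<close>, and it maps a stable \<open>J\<close> into \<open>J\<^sup>2\<close>, whence
  \<open>cJ \<subseteq> J\<^sup>2 + P\<close>. This forces \<open>c\<close> into the radical of \<open>J\<close>, which is \<open>J\<close>.\<close>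

lemma common_element_of_larger_stable:
  assumes P: "stable P" "primeideal P R" and gen: "power_generating R q B"
  shows "\<exists>c\<in>carrier R. c \<notin> P \<and> (\<forall>J. stable J \<longrightarrow> P \<subset> J \<longrightarrow> c \<in> J)"
proof -
  interpret P: primeideal P R by (rule P(2))
  obtain T c where T: "trace_operator T" and c: "c \<in> carrier R" "c \<notin> P"
    and Tc: "\<forall>x\<in>carrier R. c \<otimes> x \<ominus> T x \<in> P"
    using trace_operator_scalar[OF assms] by blast
  have "c \<in> J" if J: "stable J" "P \<subset> J" for J
  proof -
    interpret J: ideal J R using J by (simp add: stable_def)
    obtain A where A: "A \<subseteq> carrier R" "finite A" "J = Idl A"
      using finetely_gen[OF J.ideal_axioms] by blast
    note S = span_over_ideal[OF P.ideal_axioms J.ideal_axioms A(1)]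
    interpret N: ideal "span_over P J A" R by (rule S(1))
    have JJ: "J \<cdot> J \<subseteq> span_over P J A"
    proof
      fix z assume "z \<in> J \<cdot> J"
      then show "z \<in> span_over P J A"
      proof (induction rule: ideal_prod.induct)
        case (prod i j)
        let ?K = "colon R (span_over P J A) {i}"
        have i: "i \<in> carrier R" using prod J.Icarr by blast
        then have "ideal ?K R" using N.ideal_axioms by (intro ideal_colon) auto
        moreover have "A \<subseteq> ?K" using A(1) S(3)[OF prod(1)] by (auto simp: colon_def)
        ultimately have "Idl A \<subseteq> ?K" by (rule genideal_minimal)
        then show ?case using prod(2) A(3) by (auto simp: colon_def)
      next
        case (sum s1 s2)
        then show ?case by (intro N.a_closed)
      qed
    qed
    have "c \<otimes> x \<in> span_over P J A" if "x \<in> A" for x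
    proof -
      have x: "x \<in> carrier R" "x \<in> J" using that A genideal_self[OF A(1)] by auto
      have Tx: "T x \<in> carrier R" using T x by (auto simp: trace_operator_def)
      have "T x \<in> J \<cdot> J" using T x J by (simp add: trace_operator_def)
      then have "T x \<in> span_over P J A" using JJ by blast
      moreover have "c \<otimes> x \<ominus> T x \<in> span_over P J A" using Tc x S(2) by blast
      ultimately have "(c \<otimes> x \<ominus> T x) \<oplus> T x \<in> span_over P J A" by (intro N.a_closed)
      then show ?thesis using c x Tx by (simp add: minus_eq a_assoc l_neg)
    qed
    moreover have "\<not> A \<subseteq> P" using genideal_minimal[OF P.ideal_axioms, of A] A(3) J(2) by auto
    moreover have "x \<in> J" if "x \<in> carrier R" "x \<otimes> x \<in> J" for x
      using stable_radical[OF J(1) that] .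
    ultimately show ?thesis
      using scalar_in_radical[OF P(2) J.ideal_axioms _ _ A(2,1), of c] J(2) c(1) by blast
  qed
  then show ?thesis using c by blast
qed

text \<open>For \<open>x\<close> in the intersection, \<open>x\<^sup>2 \<in> (J + A)(J + B) \<subseteq> J + AB \<subseteq> J\<close>, and \<open>J\<close> is radical. Thus \<open>J\<close> is
  determined by two stable ideals, one above \<open>A\<close> and one above \<open>B\<close>.\<close>

lemma stable_recover:
  assumes A: "stable A" and B: "stable B" and J: "stable J" "I \<subseteq> J"
    and AB: "\<And>a b. \<lbrakk>a \<in> A; b \<in> B\<rbrakk> \<Longrightarrow> a \<otimes> b \<in> I"
  shows "(J <+>\<^bsub>R\<^esub> A) \<inter> (J <+>\<^bsub>R\<^esub> B) = J"
proof
  interpret A: ideal A R using A by (simp add: stable_def)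
  interpret B: ideal B R using B by (simp add: stable_def)
  interpret J: ideal J R using J by (simp add: stable_def)
  show "J \<subseteq> (J <+>\<^bsub>R\<^esub> A) \<inter> (J <+>\<^bsub>R\<^esub> B)"
  proof
    fix x assume x: "x \<in> J"
    then have "x = x \<oplus> \<zero>" using J.Icarr by simp
    then show "x \<in> (J <+>\<^bsub>R\<^esub> A) \<inter> (J <+>\<^bsub>R\<^esub> B)"
      using x A.zero_closed B.zero_closed unfolding set_add_def' by blast
  qed
  show "(J <+>\<^bsub>R\<^esub> A) \<inter> (J <+>\<^bsub>R\<^esub> B) \<subseteq> J"
  proof
    fix x assume "x \<in> (J <+>\<^bsub>R\<^esub> A) \<inter> (J <+>\<^bsub>R\<^esub> B)"
    then obtain j a k b where j: "j \<in> J" and a: "a \<in> A" and k: "k \<in> J" and b: "b \<in> B"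
      and x: "x = j \<oplus> a" "x = k \<oplus> b"
      unfolding set_add_def' by blast
    have carr: "j \<in> carrier R" "a \<in> carrier R" "k \<in> carrier R" "b \<in> carrier R"
      using j a k b A.Icarr B.Icarr J.Icarr by auto
    have "x \<otimes> x = (j \<oplus> a) \<otimes> (k \<oplus> b)" using x by simp
    also have "\<dots> = j \<otimes> (k \<oplus> b) \<oplus> (a \<otimes> k \<oplus> a \<otimes> b)"
      using carr by (simp add: l_distr r_distr a_ac)
    finally have xx: "x \<otimes> x = j \<otimes> (k \<oplus> b) \<oplus> (a \<otimes> k \<oplus> a \<otimes> b)" .
    have "a \<otimes> b \<in> J" using AB[OF a b] J(2) by blast
    then have "x \<otimes> x \<in> J"
      unfolding xx using j k carr by (intro J.a_closed J.I_r_closed[OF j] J.I_l_closed[OF k]) auto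
    moreover have "x \<in> carrier R" unfolding x(1) using carr by simp
    ultimately show "x \<in> J" using stable_radical[OF J(1)] by blast
  qed
qed

text \<open>Noetherian induction: a maximal stable \<open>I\<close> with infinitely many stable ideals above it is
  impossible. If \<open>xy \<in> I\<close> with \<open>x, y \<notin> I\<close>, the ideals above \<open>I\<close> are recovered from those above the
  larger stable ideals \<open>A = (I : x)\<close> and \<open>B = (I : A)\<close>. If \<open>I\<close> is prime, the intersection of all
  stable ideals strictly above \<open>I\<close> is itself strictly above \<open>I\<close>.\<close>

theorem finite_stable_ideals:
  assumes gen: "power_generating R q B"
  shows "finite {I. stable I}"
proof (rule ccontr)
  assume inf: "infinite {I. stable I}"
  define above where "above = (\<lambda>I. {J. stable J \<and> I \<subseteq> J})"
  let ?F = "{I. stable I \<and> infinite (above I)}"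
  have "stable {\<zero>}" using zeroideal trace_zero by (simp add: stable_def)
  moreover have "above {\<zero>} = {I. stable I}"
    unfolding above_def stable_def
    by (auto simp: additive_subgroup.zero_closed ideal.axioms(1))
  ultimately have "?F \<noteq> {}" using inf by auto
  moreover have "ideal I R" if "I \<in> ?F" for I using that by (simp add: stable_def)
  ultimately obtain I where I: "I \<in> ?F" "\<And>J. \<lbrakk>J \<in> ?F; I \<subseteq> J\<rbrakk> \<Longrightarrow> J = I"
    using maximal_ideal_in_family[of ?F] by blast
  have stI: "stable I" and infI: "infinite (above I)" using I by auto
  have fin: "finite (above J)" if "stable J" "I \<subset> J" for J
    using I(2)[of J] that by blast
  interpret I: ideal I R using stI by (simp add: stable_def)
  have sub: "J \<subseteq> carrier R" if "stable J" for J
    using that ideal.Icarr[of J R] by (auto simp: stable_def)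
  show False
  proof (cases "primeideal I R")
    case True
    obtain c where c: "c \<in> carrier R" "c \<notin> I" "\<And>J. \<lbrakk>stable J; I \<subset> J\<rbrakk> \<Longrightarrow> c \<in> J"
      using common_element_of_larger_stable[OF stI True gen] by blast
    let ?G = "{J. stable J \<and> I \<subset> J}"
    let ?K = "\<Inter>?G"
    have aI: "above I = insert I ?G" unfolding above_def psubset_eq using stI by auto
    have ne: "?G \<noteq> {}"
    proof
      assume e: "?G = {}"
      have "above I = {I}" unfolding aI e ..
      then show False using infI by simp
    qed
    have "stable ?K" by (rule stable_Inter[OF ne]) blast
    moreover have "I \<subset> ?K"
    proof
      show "I \<subseteq> ?K" by blast
      have "c \<in> ?K" using c(3) by blast
      then show "I \<noteq> ?K" using c(2) by blast
    qed
    ultimately have "finite (above ?K)" by (rule fin)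
    moreover have "?G \<subseteq> above ?K" by (auto simp: above_def)
    ultimately have "finite ?G" using finite_subset by blast
    then have "finite (above I)" unfolding aI by (rule finite.insertI)
    then show False using infI by contradiction
  next
    case False
    have "above I \<subseteq> {carrier R}" if "I = carrier R"
      using that sub unfolding above_def by blast
    then have "I \<noteq> carrier R" using infI finite_subset[of "above I"] by blast
    then have "\<exists>x y. x \<in> carrier R \<and> y \<in> carrier R \<and> x \<otimes> y \<in> I \<and> x \<notin> I \<and> y \<notin> I"
      using False primeidealI[OF I.ideal_axioms is_cring] by metis
    then obtain x y where xy: "x \<in> carrier R" "y \<in> carrier R" "x \<otimes> y \<in> I" "x \<notin> I" "y \<notin> I"
      by blast
    \<comment> \<open>\<open>A\<close> contains \<open>y\<close> and \<open>B\<close> contains \<open>x\<close>, so both are strictly larger than \<open>I\<close>.\<close>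
    define A where "A = colon R I {x}"
    define B where "B = colon R I A"
    have stA: "stable A" using stable_colon[OF stI] xy by (simp add: A_def)
    have stB: "stable B" using stable_colon[OF stI sub[OF stA]] by (simp add: B_def)
    have IA: "I \<subset> A"
      using xy I.I_l_closed I.Icarr by (auto simp: A_def colon_def)
    have "I \<subseteq> B"
      using I.I_l_closed I.Icarr sub[OF stA] by (auto simp: B_def colon_def)
    moreover have "x \<in> B" using xy by (auto simp: A_def B_def colon_def m_comm)
    ultimately have IB: "I \<subset> B" using xy by blast
    have AB: "a \<otimes> b \<in> I" if "a \<in> A" "b \<in> B" for a b
      using that by (auto simp: B_def colon_def)
    have up: "J <+>\<^bsub>R\<^esub> C \<in> above C" if J: "stable J" and C: "stable C" for J C
    proof -
      have "C \<subseteq> J <+>\<^bsub>R\<^esub> C"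
      proof
        fix z assume z: "z \<in> C"
        then have "z = \<zero> \<oplus> z" using sub[OF C] by auto
        moreover have "\<zero> \<in> J"
          using J by (simp add: stable_def additive_subgroup.zero_closed ideal.axioms(1))
        ultimately show "z \<in> J <+>\<^bsub>R\<^esub> C" using z unfolding set_add_def' by blast
      qed
      then show ?thesis using stable_sum[OF J C] by (simp add: above_def)
    qed
    let ?f = "\<lambda>J. (J <+>\<^bsub>R\<^esub> A, J <+>\<^bsub>R\<^esub> B)"
    have "inj_on ?f (above I)"
    proof (rule inj_onI)
      fix J J' assume J: "J \<in> above I" and J': "J' \<in> above I" and eq: "?f J = ?f J'"
      have rec: "(K <+>\<^bsub>R\<^esub> A) \<inter> (K <+>\<^bsub>R\<^esub> B) = K" if "K \<in> above I" for K
        using that by (intro stable_recover[OF stA stB _ _ AB]) (simp_all add: above_def)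
      have "J <+>\<^bsub>R\<^esub> A = J' <+>\<^bsub>R\<^esub> A" "J <+>\<^bsub>R\<^esub> B = J' <+>\<^bsub>R\<^esub> B" using eq by simp_all
      then show "J = J'" using rec[OF J] rec[OF J'] by metis
    qed
    moreover have "?f ` above I \<subseteq> above A \<times> above B"
    proof
      fix z assume "z \<in> ?f ` above I"
      then obtain J where "stable J" "z = ?f J" by (auto simp: above_def)
      then show "z \<in> above A \<times> above B" using up stA stB by simp
    qed
    moreover have "finite (above A \<times> above B)"
      using fin[OF stA IA] fin[OF stB IB] by (rule finite_cartesian_product)
    ultimately have "finite (above I)" by (rule inj_on_finite)
    then show False using infI by contradiction
  qed
qed

end

section \<open>Rings of fractions\<close>

locale localized = cring R for R :: "('a, 'm) ring_scheme" (structure) +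
  fixes S :: "'a set"
  assumes S_sub: "S \<subseteq> carrier R"
    and S_one: "\<one> \<in> S"
    and S_mult: "\<lbrakk>s \<in> S; t \<in> S\<rbrakk> \<Longrightarrow> s \<otimes> t \<in> S"
begin

abbreviation fr :: "'a \<Rightarrow> 'a \<Rightarrow> ('a \<times> 'a) set" where "fr \<equiv> fraction R S"
abbreviation L :: "('a \<times> 'a) set ring" where "L \<equiv> localization R S"

lemma S_carr: "s \<in> S \<Longrightarrow> s \<in> carrier R" using S_sub by blast

context
  notes S_carr [simp]
begin

lemma mem_fraction:
  "(b, t) \<in> fr a s \<longleftrightarrow> b \<in> carrier R \<and> t \<in> S \<and> (\<exists>u\<in>S. u \<otimes> (a \<otimes> t) = u \<otimes> (b \<otimes> s))"
  by (simp add: fraction_def)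

lemma fraction_trans:
  assumes carr: "a \<in> carrier R" "b \<in> carrier R" "c \<in> carrier R" "s \<in> S" "t \<in> S" "r \<in> S"
    and ab: "\<exists>u\<in>S. u \<otimes> (a \<otimes> t) = u \<otimes> (b \<otimes> s)"
    and bc: "\<exists>u\<in>S. u \<otimes> (b \<otimes> r) = u \<otimes> (c \<otimes> t)"
  shows "\<exists>u\<in>S. u \<otimes> (a \<otimes> r) = u \<otimes> (c \<otimes> s)"
proof -
  obtain u v where u: "u \<in> S" "u \<otimes> (a \<otimes> t) = u \<otimes> (b \<otimes> s)"
    and v: "v \<in> S" "v \<otimes> (b \<otimes> r) = v \<otimes> (c \<otimes> t)" using ab bc by blast
  have "u \<otimes> v \<otimes> t \<otimes> (a \<otimes> r) = v \<otimes> r \<otimes> (u \<otimes> (a \<otimes> t))"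
    using carr u(1) v(1) by (simp add: m_ac)
  also have "\<dots> = u \<otimes> s \<otimes> (v \<otimes> (b \<otimes> r))"
    unfolding u(2) using carr u(1) v(1) by (simp add: m_ac)
  also have "\<dots> = u \<otimes> v \<otimes> t \<otimes> (c \<otimes> s)"
    unfolding v(2) using carr u(1) v(1) by (simp add: m_ac)
  finally show ?thesis using u(1) v(1) carr S_mult by blast
qed

lemma fraction_eq_iff:
  assumes "a \<in> carrier R" "b \<in> carrier R" "s \<in> S" "t \<in> S"
  shows "fr a s = fr b t \<longleftrightarrow> (\<exists>u\<in>S. u \<otimes> (a \<otimes> t) = u \<otimes> (b \<otimes> s))" (is "?l \<longleftrightarrow> ?r")
proof
  have "(b, t) \<in> fr b t" using assms S_one by (auto simp: mem_fraction)
  then show "?l \<Longrightarrow> ?r" using mem_fraction[of b t a s] by simp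
next
  assume r: ?r
  then obtain u where u: "u \<in> S" "u \<otimes> (a \<otimes> t) = u \<otimes> (b \<otimes> s)" by blast
  then have r': "\<exists>u\<in>S. u \<otimes> (b \<otimes> s) = u \<otimes> (a \<otimes> t)" by (intro bexI[of _ u]) auto
  show ?l
  proof (rule Set.set_eqI)
    fix z :: "'a \<times> 'a"
    obtain c w where z: "z = (c, w)" by (cases z)
    have "(\<exists>u\<in>S. u \<otimes> (a \<otimes> w) = u \<otimes> (c \<otimes> s)) \<longleftrightarrow> (\<exists>u\<in>S. u \<otimes> (b \<otimes> w) = u \<otimes> (c \<otimes> t))"
      if "c \<in> carrier R" "w \<in> S"
      using fraction_trans[OF assms(2,1) that(1) assms(4,3) that(2) r']
        fraction_trans[OF assms(1,2) that(1) assms(3,4) that(2) r] by blast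
    then show "z \<in> fr a s \<longleftrightarrow> z \<in> fr b t" unfolding z mem_fraction by blast
  qed
qed

lemma fraction_eqI:
  assumes "a \<in> carrier R" "b \<in> carrier R" "s \<in> S" "t \<in> S" "a \<otimes> t = b \<otimes> s"
  shows "fr a s = fr b t"
  using fraction_eq_iff[OF assms(1-4)] S_one assms(5) by auto

lemma self_mem_fraction: "\<lbrakk>a \<in> carrier R; s \<in> S\<rbrakk> \<Longrightarrow> (a, s) \<in> fr a s"
  using S_one by (auto simp: mem_fraction)

lemma carrier_L: "x \<in> carrier L \<longleftrightarrow> (\<exists>a s. a \<in> carrier R \<and> s \<in> S \<and> x = fr a s)"
  by (auto simp: localization_def)

lemma fraction_carrier [simp, intro]: "\<lbrakk>a \<in> carrier R; s \<in> S\<rbrakk> \<Longrightarrow> fr a s \<in> carrier L"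
  by (auto simp: carrier_L)

lemma fraction_mult:
  assumes "a \<in> carrier R" "b \<in> carrier R" "s \<in> S" "t \<in> S"
  shows "fr a s \<otimes>\<^bsub>L\<^esub> fr b t = fr (a \<otimes> b) (s \<otimes> t)"
proof -
  have "fr (a' \<otimes> b') (s' \<otimes> t') = fr (a \<otimes> b) (s \<otimes> t)"
    if mem: "(a', s') \<in> fr a s" "(b', t') \<in> fr b t" for a' s' b' t'
  proof -
    obtain u v where u: "u \<in> S" "u \<otimes> (a \<otimes> s') = u \<otimes> (a' \<otimes> s)"
      and v: "v \<in> S" "v \<otimes> (b \<otimes> t') = v \<otimes> (b' \<otimes> t)" using mem unfolding mem_fraction by blast
    have carr: "a' \<in> carrier R" "b' \<in> carrier R" "s' \<in> S" "t' \<in> S"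
      using mem by (auto simp: mem_fraction)
    have "u \<otimes> v \<otimes> (a' \<otimes> b' \<otimes> (s \<otimes> t)) = (u \<otimes> (a' \<otimes> s)) \<otimes> (v \<otimes> (b' \<otimes> t))"
      using assms carr u(1) v(1) by (simp add: m_ac)
    also have "\<dots> = u \<otimes> v \<otimes> (a \<otimes> b \<otimes> (s' \<otimes> t'))"
      unfolding u(2)[symmetric] v(2)[symmetric] using assms carr u(1) v(1) by (simp add: m_ac)
    finally have "\<exists>w\<in>S. w \<otimes> (a' \<otimes> b' \<otimes> (s \<otimes> t)) = w \<otimes> (a \<otimes> b \<otimes> (s' \<otimes> t'))"
      using u v S_mult by blast
    then show ?thesis using assms carr S_mult by (subst fraction_eq_iff) auto
  qed
  then have "(\<Union>(a', s')\<in>fr a s. \<Union>(b', t')\<in>fr b t. fr (a' \<otimes> b') (s' \<otimes> t')) =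
      (\<Union>(a', s')\<in>fr a s. \<Union>(b', t')\<in>fr b t. fr (a \<otimes> b) (s \<otimes> t))"
    by (intro SUP_cong) auto
  also have "\<dots> = fr (a \<otimes> b) (s \<otimes> t)"
    using self_mem_fraction[of a s] self_mem_fraction[of b t] assms by auto
  finally show ?thesis by (simp add: localization_def)
qed

lemma fraction_add:
  assumes "a \<in> carrier R" "b \<in> carrier R" "s \<in> S" "t \<in> S"
  shows "fr a s \<oplus>\<^bsub>L\<^esub> fr b t = fr (a \<otimes> t \<oplus> b \<otimes> s) (s \<otimes> t)"
proof -
  have "fr (a' \<otimes> t' \<oplus> b' \<otimes> s') (s' \<otimes> t') = fr (a \<otimes> t \<oplus> b \<otimes> s) (s \<otimes> t)"
    if mem: "(a', s') \<in> fr a s" "(b', t') \<in> fr b t" for a' s' b' t'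
  proof -
    obtain u v where u: "u \<in> S" "u \<otimes> (a \<otimes> s') = u \<otimes> (a' \<otimes> s)"
      and v: "v \<in> S" "v \<otimes> (b \<otimes> t') = v \<otimes> (b' \<otimes> t)" using mem unfolding mem_fraction by blast
    have carr: "a' \<in> carrier R" "b' \<in> carrier R" "s' \<in> S" "t' \<in> S"
      using mem by (auto simp: mem_fraction)
    have "u \<otimes> v \<otimes> ((a' \<otimes> t' \<oplus> b' \<otimes> s') \<otimes> (s \<otimes> t)) =
        v \<otimes> t \<otimes> t' \<otimes> (u \<otimes> (a' \<otimes> s)) \<oplus> u \<otimes> s \<otimes> s' \<otimes> (v \<otimes> (b' \<otimes> t))"
      using assms carr u(1) v(1) by (simp add: l_distr r_distr m_ac)
    also have "\<dots> = u \<otimes> v \<otimes> ((a \<otimes> t \<oplus> b \<otimes> s) \<otimes> (s' \<otimes> t'))"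
      unfolding u(2)[symmetric] v(2)[symmetric] using assms carr u(1) v(1)
      by (simp add: l_distr r_distr m_ac)
    finally have "\<exists>w\<in>S. w \<otimes> ((a' \<otimes> t' \<oplus> b' \<otimes> s') \<otimes> (s \<otimes> t)) = w \<otimes> ((a \<otimes> t \<oplus> b \<otimes> s) \<otimes> (s' \<otimes> t'))"
      using u v S_mult by blast
    then show ?thesis using assms carr S_mult by (subst fraction_eq_iff) auto
  qed
  then have "(\<Union>(a', s')\<in>fr a s. \<Union>(b', t')\<in>fr b t. fr (a' \<otimes> t' \<oplus> b' \<otimes> s') (s' \<otimes> t')) =
      (\<Union>(a', s')\<in>fr a s. \<Union>(b', t')\<in>fr b t. fr (a \<otimes> t \<oplus> b \<otimes> s) (s \<otimes> t))"
    by (intro SUP_cong) auto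
  also have "\<dots> = fr (a \<otimes> t \<oplus> b \<otimes> s) (s \<otimes> t)"
    using self_mem_fraction[of a s] self_mem_fraction[of b t] assms by auto
  finally show ?thesis by (simp add: localization_def)
qed

lemma one_L: "\<one>\<^bsub>L\<^esub> = fr \<one> \<one>" by (simp add: localization_def)

lemma zero_L: "\<zero>\<^bsub>L\<^esub> = fr \<zero> \<one>" by (simp add: localization_def)

lemma fraction_zero: "s \<in> S \<Longrightarrow> fr \<zero> s = \<zero>\<^bsub>L\<^esub>"
  unfolding zero_L using S_one by (intro fraction_eqI) auto

lemma fraction_eq_zero_iff:
  assumes "a \<in> carrier R" "s \<in> S"
  shows "fr a s = \<zero>\<^bsub>L\<^esub> \<longleftrightarrow> (\<exists>u\<in>S. u \<otimes> a = \<zero>)"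
  unfolding zero_L using assms S_one by (subst fraction_eq_iff) auto

lemma fraction_common_denominator:
  assumes "a \<in> carrier R" "b \<in> carrier R" "s \<in> S"
  shows "fr a s \<oplus>\<^bsub>L\<^esub> fr b s = fr (a \<oplus> b) s"
proof -
  have "fr a s \<oplus>\<^bsub>L\<^esub> fr b s = fr (a \<otimes> s \<oplus> b \<otimes> s) (s \<otimes> s)" using assms by (simp add: fraction_add)
  also have "\<dots> = fr (a \<oplus> b) s"
    using assms S_mult by (intro fraction_eqI) (auto simp: l_distr m_assoc)
  finally show ?thesis .
qed

lemma cring_L: "cring L"
proof (rule cringI)
  show "abelian_group L"
  proof (rule abelian_groupI)
    fix x y z assume "x \<in> carrier L" "y \<in> carrier L" "z \<in> carrier L"
    then obtain a s b t c r where [simp]: "a \<in> carrier R" "b \<in> carrier R" "c \<in> carrier R"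
      "s \<in> S" "t \<in> S" "r \<in> S" and xyz: "x = fr a s" "y = fr b t" "z = fr c r"
      unfolding carrier_L by blast
    note [simp] = S_mult
    show "x \<oplus>\<^bsub>L\<^esub> y \<in> carrier L" unfolding xyz by (simp add: fraction_add)
    show "x \<oplus>\<^bsub>L\<^esub> y = y \<oplus>\<^bsub>L\<^esub> x" unfolding xyz by (simp add: fraction_add m_comm a_comm)
    show "x \<oplus>\<^bsub>L\<^esub> y \<oplus>\<^bsub>L\<^esub> z = x \<oplus>\<^bsub>L\<^esub> (y \<oplus>\<^bsub>L\<^esub> z)"
      unfolding xyz by (simp add: fraction_add l_distr r_distr m_ac a_ac)
    show "\<zero>\<^bsub>L\<^esub> \<oplus>\<^bsub>L\<^esub> x = x" unfolding xyz zero_L using S_one by (simp add: fraction_add)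
    show "\<exists>y\<in>carrier L. y \<oplus>\<^bsub>L\<^esub> x = \<zero>\<^bsub>L\<^esub>"
      unfolding xyz
      by (intro bexI[of _ "fr (\<ominus> a) s"]) (auto simp: fraction_common_denominator l_neg fraction_zero)
  qed (auto simp: zero_L S_one)
  show "Group.comm_monoid L"
  proof (rule comm_monoidI)
    fix x y z assume "x \<in> carrier L" "y \<in> carrier L" "z \<in> carrier L"
    then obtain a s b t c r where [simp]: "a \<in> carrier R" "b \<in> carrier R" "c \<in> carrier R"
      "s \<in> S" "t \<in> S" "r \<in> S" and xyz: "x = fr a s" "y = fr b t" "z = fr c r"
      unfolding carrier_L by blast
    note [simp] = S_mult
    show "x \<otimes>\<^bsub>L\<^esub> y \<in> carrier L" unfolding xyz by (simp add: fraction_mult)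
    show "x \<otimes>\<^bsub>L\<^esub> y = y \<otimes>\<^bsub>L\<^esub> x" unfolding xyz by (simp add: fraction_mult m_comm)
    show "x \<otimes>\<^bsub>L\<^esub> y \<otimes>\<^bsub>L\<^esub> z = x \<otimes>\<^bsub>L\<^esub> (y \<otimes>\<^bsub>L\<^esub> z)" unfolding xyz by (simp add: fraction_mult m_assoc)
    show "\<one>\<^bsub>L\<^esub> \<otimes>\<^bsub>L\<^esub> x = x" unfolding xyz one_L using S_one by (simp add: fraction_mult)
  qed (auto simp: one_L S_one)
  fix x y z assume "x \<in> carrier L" "y \<in> carrier L" "z \<in> carrier L"
  then obtain a s b t c r where [simp]: "a \<in> carrier R" "b \<in> carrier R" "c \<in> carrier R"
    "s \<in> S" "t \<in> S" "r \<in> S" and xyz: "x = fr a s" "y = fr b t" "z = fr c r"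
    unfolding carrier_L by blast
  note [simp] = S_mult
  have "fr (a \<otimes> t \<oplus> b \<otimes> s) (s \<otimes> t) \<otimes>\<^bsub>L\<^esub> fr c r = fr (a \<otimes> c) (s \<otimes> r) \<oplus>\<^bsub>L\<^esub> fr (b \<otimes> c) (t \<otimes> r)"
    by (simp add: fraction_add fraction_mult, intro fraction_eqI)
      (auto simp: l_distr r_distr m_ac a_ac)
  then show "(x \<oplus>\<^bsub>L\<^esub> y) \<otimes>\<^bsub>L\<^esub> z = x \<otimes>\<^bsub>L\<^esub> z \<oplus>\<^bsub>L\<^esub> y \<otimes>\<^bsub>L\<^esub> z"
    unfolding xyz by (simp add: fraction_add fraction_mult)
qed

end

sublocale L: cring L by (rule cring_L)

context
  notes S_carr [simp]
begin

lemma to_localization_hom: "to_localization R S \<in> ring_hom R L"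
  unfolding to_localization_def using S_one
  by (intro ring_hom_memI) (auto simp: fraction_mult fraction_common_denominator one_L)

lemma fraction_times_denominator:
  assumes "a \<in> carrier R" "s \<in> S"
  shows "to_localization R S s \<otimes>\<^bsub>L\<^esub> fr a s = to_localization R S a"
  unfolding to_localization_def using assms S_one S_mult
  by (simp add: fraction_mult) (intro fraction_eqI; simp add: m_ac)

lemma denominator_unit:
  assumes "s \<in> S"
  shows "to_localization R S s \<otimes>\<^bsub>L\<^esub> fr \<one> s = \<one>\<^bsub>L\<^esub>"
  using fraction_times_denominator[of \<one> s] assms by (simp add: to_localization_def one_L)

lemma fraction_cancel_left:
  assumes "a \<in> carrier R" "s \<in> S" "u \<in> S"
  shows "fr (u \<otimes> a) (u \<otimes> s) = fr a s"
  using assms S_mult by (intro fraction_eqI) (auto simp: m_ac)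

end

end

lemma (in cring) localized_nonzerodivisors: "localized R (nonzerodivisors R)"
proof
  show "nonzerodivisors R \<subseteq> carrier R" "\<one> \<in> nonzerodivisors R"
    by (auto simp: nonzerodivisors_def)
  fix s t assume st: "s \<in> nonzerodivisors R" "t \<in> nonzerodivisors R"
  have carr: "s \<in> carrier R" "t \<in> carrier R" using st by (auto simp: nonzerodivisors_def)
  have nz: "a = \<zero>" if "a \<in> carrier R" "a \<otimes> u = \<zero>" "u \<in> nonzerodivisors R" for a u
    using that unfolding nonzerodivisors_def by blast
  show "s \<otimes> t \<in> nonzerodivisors R"
    unfolding nonzerodivisors_def
  proof (intro CollectI conjI ballI impI)
    show "s \<otimes> t \<in> carrier R" using carr by simp
    fix a assume a: "a \<in> carrier R" "a \<otimes> (s \<otimes> t) = \<zero>"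
    then have "a \<otimes> s \<otimes> t = \<zero>" using carr by (simp add: m_assoc)
    then have "a \<otimes> s = \<zero>" using nz[OF _ _ st(2)] a carr by simp
    then show "a = \<zero>" using nz[OF _ _ st(1)] a by simp
  qed
qed

lemma (in cring) nonzerodivisor_cancel:
  assumes u: "u \<in> nonzerodivisors R" and eq: "u \<otimes> x = u \<otimes> y"
    and x: "x \<in> carrier R" and y: "y \<in> carrier R"
  shows "x = y"
proof -
  have uc: "u \<in> carrier R" using u by (simp add: nonzerodivisors_def)
  have "u \<otimes> (x \<ominus> y) = \<zero>"
    using eq uc x y by (simp add: minus_eq r_distr r_minus r_neg)
  then have "(x \<ominus> y) \<otimes> u = \<zero>" using uc x y by (simp add: m_comm)
  then have "x \<ominus> y = \<zero>" using u x y unfolding nonzerodivisors_def by blast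
  then show ?thesis using x y by simp
qed

lemma (in primeideal) localized_complement: "localized R (carrier R - I)"
proof
  show "carrier R - I \<subseteq> carrier R" by blast
  show "\<one> \<in> carrier R - I" using I_notcarr one_imp_carrier by auto
  fix s t assume "s \<in> carrier R - I" "t \<in> carrier R - I"
  then show "s \<otimes> t \<in> carrier R - I" using I_prime by blast
qed

section \<open>Primes with a uniformizer\<close>

lemma (in domain) nonzerodivisors_eq: "nonzerodivisors R = carrier R - {\<zero>}"
proof
  show "nonzerodivisors R \<subseteq> carrier R - {\<zero>}"
  proof
    fix s assume s: "s \<in> nonzerodivisors R"
    have "s \<noteq> \<zero>" using s one_not_zero unfolding nonzerodivisors_def by force
    then show "s \<in> carrier R - {\<zero>}" using s unfolding nonzerodivisors_def by simp
  qed
  show "carrier R - {\<zero>} \<subseteq> nonzerodivisors R"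
    using integral unfolding nonzerodivisors_def by blast
qed

lemma (in domain) cancel_left:
  "\<lbrakk>a \<otimes> b = a \<otimes> c; a \<noteq> \<zero>; a \<in> carrier R; b \<in> carrier R; c \<in> carrier R\<rbrakk> \<Longrightarrow> b = c"
  using m_lcancel by blast

text \<open>The local ring \<open>R\<^sub>Q\<close> is a discrete valuation ring with uniformizer \<open>t\<close>. This is expressed by elements
  of \<open>R\<close>, with the elements outside \<open>Q\<close> in the role of units, so that the property passes to further
  localizations without comparing iterated rings of fractions.\<close>

locale uniformized_prime = domain R + Q: primeideal Q R
  for R :: "('a, 'm) ring_scheme" (structure) and Q :: "'a set" +
  fixes t :: 'a
  assumes t_in: "t \<in> Q" and t_nonzero: "t \<noteq> \<zero>"
    and factorization: "\<And>a. \<lbrakk>a \<in> carrier R; a \<noteq> \<zero>\<rbrakk> \<Longrightarrow>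
      \<exists>(n::nat) s u. s \<in> carrier R - Q \<and> u \<in> carrier R - Q \<and> s \<otimes> a = t [^] n \<otimes> u"
begin

sublocale loc: localized R "carrier R - Q" by (rule Q.localized_complement)

lemma t_carrier [simp]: "t \<in> carrier R" using t_in Q.Icarr by blast

lemma t_power_nonzero: "t [^] (n::nat) \<noteq> \<zero>"
  using t_nonzero by (induction n) (auto simp: integral_iff)

lemma complement_nonzero: "s \<in> carrier R - Q \<Longrightarrow> s \<noteq> \<zero>" using Q.zero_closed by auto

text \<open>If \<open>m > n\<close>, cancelling \<open>t\<^sup>n\<close> would put the product \<open>s' u\<close> of two elements outside \<open>Q\<close> into \<open>Q\<close>.\<close>

lemma t_power_dvd_le:
  assumes s: "s \<in> carrier R - Q" and u: "u \<in> carrier R - Q"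
    and s': "s' \<in> carrier R - Q" and b: "b \<in> carrier R" and a: "a \<in> carrier R"
    and eq: "s \<otimes> a = t [^] (n::nat) \<otimes> u" and eq': "s' \<otimes> a = t [^] (m::nat) \<otimes> b"
  shows "m \<le> n"
proof (rule ccontr)
  assume "\<not> m \<le> n"
  then obtain k where m: "m = n + Suc k" using less_imp_Suc_add by (metis add_Suc_right not_le)
  have c: "s \<in> carrier R" "u \<in> carrier R" "s' \<in> carrier R" using s u s' by auto
  have "t [^] n \<otimes> (s' \<otimes> u) = s' \<otimes> (s \<otimes> a)" unfolding eq using c by (simp add: m_ac)
  also have "\<dots> = s \<otimes> (s' \<otimes> a)" using c a by (simp add: m_ac)
  also have "\<dots> = t [^] n \<otimes> (t [^] k \<otimes> s \<otimes> b \<otimes> t)"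
    unfolding eq' m using c b by (simp add: nat_pow_mult[symmetric] m_ac)
  finally have "s' \<otimes> u = t [^] k \<otimes> s \<otimes> b \<otimes> t"
    using cancel_left[OF _ t_power_nonzero] c b by simp
  moreover have "t [^] k \<otimes> s \<otimes> b \<otimes> t \<in> Q" using Q.I_l_closed[OF t_in] c b by simp
  ultimately show False using Q.I_prime[of s' u] s' u by auto
qed

lemma extended_prime_eq: "extended_prime R Q = PIdl\<^bsub>loc.L\<^esub> (to_local_at R Q t)"
proof
  note tl = to_local_at_def to_localization_def
  show "extended_prime R Q \<subseteq> PIdl\<^bsub>loc.L\<^esub> (to_local_at R Q t)"
  proof
    fix x assume "x \<in> extended_prime R Q"
    then obtain a s where a: "a \<in> Q" and s: "s \<in> carrier R - Q" and x: "x = loc.fr a s"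
      unfolding extended_prime_def by blast
    have ac: "a \<in> carrier R" using a Q.Icarr by blast
    have "\<exists>b\<in>carrier R. \<exists>s'\<in>carrier R - Q. s' \<otimes> a = b \<otimes> t"
    proof (cases "a = \<zero>")
      case True
      then show ?thesis using loc.S_one by (intro bexI[of _ \<zero>] bexI[of _ \<one>]) auto
    next
      case False
      obtain n s' u where s': "s' \<in> carrier R - Q" and u: "u \<in> carrier R - Q"
        and eq: "s' \<otimes> a = t [^] (n::nat) \<otimes> u" using factorization[OF ac False] by blast
      have "s' \<otimes> a \<in> Q" using a s' Q.I_l_closed by simp
      then have "n \<noteq> 0" using eq u by (cases n) auto
      then obtain k where n: "n = Suc k" using not0_implies_Suc by blast
      have "s' \<otimes> a = t [^] k \<otimes> u \<otimes> t" unfolding eq n using u by (simp add: m_ac)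
      then show ?thesis using s' u by (intro bexI[of _ "t [^] k \<otimes> u"] bexI[of _ s']) auto
    qed
    then obtain b s' where b: "b \<in> carrier R" and s': "s' \<in> carrier R - Q" and eq: "s' \<otimes> a = b \<otimes> t"
      by blast
    have "x = loc.fr (b \<otimes> t) (s' \<otimes> s)"
      unfolding x eq[symmetric] using loc.fraction_cancel_left[OF ac s s'] by simp
    also have "\<dots> = loc.fr b (s' \<otimes> s) \<otimes>\<^bsub>loc.L\<^esub> to_local_at R Q t"
      unfolding tl using b loc.S_mult[OF s' s] loc.S_one by (simp add: loc.fraction_mult)
    finally show "x \<in> PIdl\<^bsub>loc.L\<^esub> (to_local_at R Q t)"
      unfolding cgenideal_def using b loc.S_mult[OF s' s] by blast
  qed
  show "PIdl\<^bsub>loc.L\<^esub> (to_local_at R Q t) \<subseteq> extended_prime R Q"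
  proof
    fix x assume "x \<in> PIdl\<^bsub>loc.L\<^esub> (to_local_at R Q t)"
    then obtain b s where b: "b \<in> carrier R" and s: "s \<in> carrier R - Q"
      and x: "x = loc.fr b s \<otimes>\<^bsub>loc.L\<^esub> to_local_at R Q t"
      unfolding cgenideal_def loc.carrier_L by blast
    have "x = loc.fr (b \<otimes> t) s"
      unfolding x tl using b s loc.S_one by (simp add: loc.fraction_mult)
    moreover have "b \<otimes> t \<in> Q" using b Q.I_l_closed[OF t_in] by blast
    ultimately show "x \<in> extended_prime R Q" using s unfolding extended_prime_def by blast
  qed
qed

lemma extended_prime_power:
  "(ideal_prod loc.L (extended_prime R Q) ^^ n) (carrier loc.L) =
     PIdl\<^bsub>loc.L\<^esub> (to_local_at R Q (t [^] n))"
proof (induction n)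
  case 0
  have "PIdl\<^bsub>loc.L\<^esub> (to_local_at R Q \<one>) = carrier loc.L"
    unfolding to_local_at_def to_localization_def loc.one_L[symmetric]
    using loc.L.cgenideal_eq_genideal[OF loc.L.one_closed] loc.L.genideal_one by simp
  then show ?case by simp
next
  case (Suc n)
  have hom: "to_local_at R Q \<in> ring_hom R loc.L"
    unfolding to_local_at_def by (rule loc.to_localization_hom)
  have "(ideal_prod loc.L (extended_prime R Q) ^^ Suc n) (carrier loc.L) =
      ideal_prod loc.L (PIdl\<^bsub>loc.L\<^esub> (to_local_at R Q t)) (PIdl\<^bsub>loc.L\<^esub> (to_local_at R Q (t [^] n)))"
    using Suc by (simp add: extended_prime_eq)
  also have "\<dots> = PIdl\<^bsub>loc.L\<^esub> (to_local_at R Q t \<otimes>\<^bsub>loc.L\<^esub> to_local_at R Q (t [^] n))"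
    using ring_hom_closed[OF hom] by (intro loc.L.ideal_prod_principal) auto
  also have "to_local_at R Q t \<otimes>\<^bsub>loc.L\<^esub> to_local_at R Q (t [^] n) = to_local_at R Q (t [^] Suc n)"
    using ring_hom_mult[OF hom, of t "t [^] n"] by (simp add: m_comm)
  finally show ?case .
qed

lemma in_extended_prime_power_iff:
  assumes a: "a \<in> carrier R"
  shows "to_local_at R Q a \<in> (ideal_prod (local_at R Q) (extended_prime R Q) ^^ n) (carrier (local_at R Q))
    \<longleftrightarrow> (\<exists>s\<in>carrier R - Q. \<exists>b\<in>carrier R. s \<otimes> a = t [^] n \<otimes> b)" (is "?l \<longleftrightarrow> ?r")
proof -
  note tl = to_local_at_def to_localization_def
  have fe: "loc.fr b s \<otimes>\<^bsub>loc.L\<^esub> to_local_at R Q (t [^] n) = loc.fr (b \<otimes> t [^] n) s"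
    if "b \<in> carrier R" "s \<in> carrier R - Q" for b s
    unfolding tl using that loc.S_one by (simp add: loc.fraction_mult)
  have "?l \<longleftrightarrow> to_local_at R Q a \<in> PIdl\<^bsub>loc.L\<^esub> (to_local_at R Q (t [^] n))"
    unfolding local_at_def extended_prime_power ..
  also have "\<dots> \<longleftrightarrow> (\<exists>b\<in>carrier R. \<exists>s\<in>carrier R - Q. to_local_at R Q a = loc.fr (b \<otimes> t [^] n) s)"
    unfolding cgenideal_def using fe by (fastforce simp: loc.carrier_L)
  also have "\<dots> \<longleftrightarrow> (\<exists>b\<in>carrier R. \<exists>s\<in>carrier R - Q. s \<otimes> a = b \<otimes> t [^] n)"
  proof (intro bex_cong refl)
    fix b s assume b: "b \<in> carrier R" and s: "s \<in> carrier R - Q"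
    have "to_local_at R Q a = loc.fr (b \<otimes> t [^] n) s \<longleftrightarrow>
        (\<exists>u\<in>carrier R - Q. u \<otimes> (a \<otimes> s) = u \<otimes> (b \<otimes> t [^] n \<otimes> \<one>))"
      unfolding tl using a b s loc.S_one by (intro loc.fraction_eq_iff) auto
    also have "\<dots> \<longleftrightarrow> (\<exists>u\<in>carrier R - Q. a \<otimes> s = b \<otimes> t [^] n)"
      using a b s m_lcancel complement_nonzero by (intro bex_cong refl) auto
    also have "\<dots> \<longleftrightarrow> s \<otimes> a = b \<otimes> t [^] n" using loc.S_one a s by (auto simp: m_comm)
    finally show "to_local_at R Q a = loc.fr (b \<otimes> t [^] n) s \<longleftrightarrow> s \<otimes> a = b \<otimes> t [^] n" .
  qed
  also have "\<dots> \<longleftrightarrow> ?r" using m_comm by (metis nat_pow_closed t_carrier)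
  finally show ?thesis .
qed

text \<open>The exponent in a factorization with respect to \<open>t\<close> is the order, which is defined through powers of
  \<open>Q R\<^sub>Q\<close>. All later computations with orders are carried out in \<open>R\<close> by means of such
  factorizations.\<close>

lemma order_atI:
  assumes a: "a \<in> carrier R" and s: "s \<in> carrier R - Q" and u: "u \<in> carrier R - Q"
    and eq: "s \<otimes> a = t [^] n \<otimes> u"
  shows "order_at R Q a = n"
  unfolding order_at_def in_extended_prime_power_iff[OF a]
proof (rule Greatest_equality)
  show "\<exists>s\<in>carrier R - Q. \<exists>b\<in>carrier R. s \<otimes> a = t [^] n \<otimes> b" using s u eq by blast
  show "m \<le> n" if "\<exists>s\<in>carrier R - Q. \<exists>b\<in>carrier R. s \<otimes> a = t [^] m \<otimes> b" for m
    using that t_power_dvd_le[OF s u _ _ a eq] by blast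
qed

lemma order_at_factorization:
  assumes "a \<in> carrier R" "a \<noteq> \<zero>"
  shows "\<exists>s u. s \<in> carrier R - Q \<and> u \<in> carrier R - Q \<and> s \<otimes> a = t [^] order_at R Q a \<otimes> u"
  using factorization[OF assms] order_atI[OF assms(1)] by blast

lemma order_at_mult:
  assumes a: "a \<in> carrier R" "a \<noteq> \<zero>" and b: "b \<in> carrier R" "b \<noteq> \<zero>"
  shows "order_at R Q (a \<otimes> b) = order_at R Q a + order_at R Q b"
proof -
  obtain s u s' u' where s: "s \<in> carrier R - Q" "u \<in> carrier R - Q"
    and eq: "s \<otimes> a = t [^] order_at R Q a \<otimes> u"
    and s': "s' \<in> carrier R - Q" "u' \<in> carrier R - Q"
    and eq': "s' \<otimes> b = t [^] order_at R Q b \<otimes> u'"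
    using order_at_factorization[OF a] order_at_factorization[OF b] by blast
  have c: "s \<in> carrier R" "u \<in> carrier R" "s' \<in> carrier R" "u' \<in> carrier R" using s s' by auto
  have "s \<otimes> s' \<otimes> (a \<otimes> b) = (s \<otimes> a) \<otimes> (s' \<otimes> b)" using c a b by (simp add: m_ac)
  also have "\<dots> = t [^] (order_at R Q a + order_at R Q b) \<otimes> (u \<otimes> u')"
    unfolding eq eq' using c by (simp add: nat_pow_mult[symmetric] m_ac)
  finally show ?thesis
    using a b by (intro order_atI[OF _ loc.S_mult[OF s(1) s'(1)] loc.S_mult[OF s(2) s'(2)]]) auto
qed

lemma order_at_ge:
  assumes a: "a \<in> carrier R" "a \<noteq> \<zero>" and s: "s \<in> carrier R - Q" and b: "b \<in> carrier R"
    and eq: "s \<otimes> a = t [^] (n::nat) \<otimes> b"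
  shows "n \<le> order_at R Q a"
proof -
  obtain s' u where "s' \<in> carrier R - Q" "u \<in> carrier R - Q" "s' \<otimes> a = t [^] order_at R Q a \<otimes> u"
    using order_at_factorization[OF a] by blast
  then show ?thesis using t_power_dvd_le[OF _ _ s b a(1) _ eq] by blast
qed

lemma order_at_add:
  assumes a: "a \<in> carrier R" "a \<noteq> \<zero>" and b: "b \<in> carrier R" "b \<noteq> \<zero>" and ab: "a \<oplus> b \<noteq> \<zero>"
  shows "min (order_at R Q a) (order_at R Q b) \<le> order_at R Q (a \<oplus> b)"
proof -
  let ?m = "min (order_at R Q a) (order_at R Q b)"
  have "\<exists>s\<in>carrier R - Q. \<exists>c\<in>carrier R. s \<otimes> x = t [^] ?m \<otimes> c"
    if x: "x \<in> carrier R" "x \<noteq> \<zero>" and le: "?m \<le> order_at R Q x" for x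
  proof -
    obtain s u where s: "s \<in> carrier R - Q" "u \<in> carrier R - Q"
      and eq: "s \<otimes> x = t [^] order_at R Q x \<otimes> u" using order_at_factorization[OF x] by blast
    obtain k where k: "order_at R Q x = ?m + k" using le le_Suc_ex by blast
    have "s \<otimes> x = t [^] ?m \<otimes> (t [^] k \<otimes> u)"
      unfolding eq k using s by (simp add: nat_pow_mult[symmetric] m_ac)
    moreover have "t [^] k \<otimes> u \<in> carrier R" using s by simp
    ultimately show ?thesis using s(1) by blast
  qed
  note div = this
  obtain s c where s: "s \<in> carrier R - Q" "c \<in> carrier R" and eq: "s \<otimes> a = t [^] ?m \<otimes> c"
    using div[OF a min.cobounded1] by blast
  obtain s' c' where s': "s' \<in> carrier R - Q" "c' \<in> carrier R"
    and eq': "s' \<otimes> b = t [^] ?m \<otimes> c'"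
    using div[OF b min.cobounded2] by blast
  have sc: "s \<in> carrier R" "s' \<in> carrier R" using s s' by auto
  have "s \<otimes> s' \<otimes> (a \<oplus> b) = s' \<otimes> (s \<otimes> a) \<oplus> s \<otimes> (s' \<otimes> b)"
    using a b sc by (simp add: r_distr m_ac)
  also have "\<dots> = t [^] ?m \<otimes> (s' \<otimes> c \<oplus> s \<otimes> c')"
    unfolding eq eq' using s s' sc by (simp add: l_distr r_distr m_ac)
  finally show ?thesis
    using order_at_ge[of "a \<oplus> b" "s \<otimes> s'" "s' \<otimes> c \<oplus> s \<otimes> c'" ?m] loc.S_mult[OF s(1) s'(1)]
      a b ab s s' by simp
qed

lemma order_at_zero_iff:
  assumes a: "a \<in> carrier R" "a \<noteq> \<zero>"
  shows "order_at R Q a = 0 \<longleftrightarrow> a \<notin> Q"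
proof -
  obtain s u where s: "s \<in> carrier R - Q" "u \<in> carrier R - Q"
    and eq: "s \<otimes> a = t [^] order_at R Q a \<otimes> u" using order_at_factorization[OF a] by blast
  show ?thesis
  proof
    assume "order_at R Q a = 0"
    then have "s \<otimes> a = u" using eq s by simp
    then show "a \<notin> Q" using s Q.I_l_closed by auto
  next
    assume "a \<notin> Q"
    then show "order_at R Q a = 0" using order_atI[OF a(1), of \<one> a 0] a loc.S_one by simp
  qed
qed

lemma valuation_at_fraction:
  assumes a: "a \<in> carrier R" "a \<noteq> \<zero>" and b: "b \<in> carrier R" "b \<noteq> \<zero>"
  shows "valuation_at R Q (fraction R (nonzerodivisors R) a b) =
    int (order_at R Q a) - int (order_at R Q b)"
  unfolding valuation_at_def
proof (rule the_equality)
  interpret K: localized R "nonzerodivisors R" by (rule localized_nonzerodivisors)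
  have bN: "b \<in> nonzerodivisors R" using b by (simp add: nonzerodivisors_eq)
  show "\<exists>(c, d)\<in>K.fr a b. int (order_at R Q a) - int (order_at R Q b) =
      int (order_at R Q c) - int (order_at R Q d)"
    using K.self_mem_fraction[OF a(1) bN] by blast
  fix n assume "\<exists>(c, d)\<in>K.fr a b. n = int (order_at R Q c) - int (order_at R Q d)"
  then obtain c d where cd: "(c, d) \<in> K.fr a b"
    and n: "n = int (order_at R Q c) - int (order_at R Q d)" by blast
  from cd[unfolded K.mem_fraction, unfolded nonzerodivisors_eq]
  obtain u where c: "c \<in> carrier R" and d: "d \<in> carrier R" "d \<noteq> \<zero>"
    and u: "u \<in> carrier R" "u \<noteq> \<zero>" "u \<otimes> (a \<otimes> d) = u \<otimes> (c \<otimes> b)"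
    by blast
  have eq: "a \<otimes> d = c \<otimes> b" using cancel_left[OF u(3,2,1)] a b c d by simp
  then have "c \<noteq> \<zero>" using a b d integral_iff[of a d] by auto
  then have "order_at R Q a + order_at R Q d = order_at R Q c + order_at R Q b"
    using order_at_mult[OF a d] order_at_mult[of c b] b c eq by simp
  then show "n = int (order_at R Q a) - int (order_at R Q b)" using n by simp
qed

end

section \<open>Height one primes of normal noetherian domains\<close>

text \<open>Put \<open>y = c / b\<close> and start from \<open>0 \<noteq> x \<in> I\<close>. All \<open>z\<^sub>n = y\<^sup>n x\<close> stay in \<open>I \<subseteq> R\<close>, and by the ascending
  chain condition some \<open>z\<^sub>n\<close> lies in the ideal generated by its predecessors. Cancelling \<open>x\<close> gives an
  integral equation for \<open>y\<close>.\<close>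

lemma (in domain) multiplier_integral:
  assumes noeth: "noetherian_ring R" and I: "I \<subseteq> carrier R" and x: "x \<in> I" "x \<noteq> \<zero>"
    and c: "c \<in> carrier R" and b: "b \<in> carrier R" "b \<noteq> \<zero>"
    and mult: "\<And>x. x \<in> I \<Longrightarrow> \<exists>z\<in>I. c \<otimes> x = b \<otimes> z"
  shows "integral_over (total_fractions R) (to_fractions R ` carrier R)
    (fraction R (nonzerodivisors R) c b)"
proof -
  interpret K: localized R "nonzerodivisors R" by (rule localized_nonzerodivisors)
  let ?f = "to_localization R (nonzerodivisors R)"
  have hom: "?f \<in> ring_hom R K.L" by (rule K.to_localization_hom)
  have fc: "?f a \<in> carrier K.L" if "a \<in> carrier R" for a using ring_hom_closed[OF hom that] .
  define y where "y = K.fr c b"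
  have N: "b \<in> nonzerodivisors R" "x \<in> nonzerodivisors R" using b x I by (auto simp: nonzerodivisors_eq)
  have y: "y \<in> carrier K.L" using c N by (simp add: y_def)
  obtain g where g: "\<And>x. x \<in> I \<Longrightarrow> g x \<in> I \<and> c \<otimes> x = b \<otimes> g x" using mult by metis
  define z where "z n = (g ^^ n) x" for n
  have zI: "z n \<in> I" for n unfolding z_def using x g by (induction n) auto
  have zc: "z n \<in> carrier R" for n using zI I by blast
  have zS: "c \<otimes> z n = b \<otimes> z (Suc n)" for n using g[OF zI[of n]] by (simp add: z_def)
  have zf: "?f (z n) = y [^]\<^bsub>K.L\<^esub> n \<otimes>\<^bsub>K.L\<^esub> ?f x" for n
  proof (induction n)
    case 0
    show ?case using fc x I by (auto simp: z_def)
  next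
    case (Suc n)
    have "y \<otimes>\<^bsub>K.L\<^esub> ?f (z n) = ?f (z (Suc n))"
      unfolding y_def to_localization_def using c N zc K.S_one b
      by (simp add: K.fraction_mult zS, intro K.fraction_eqI) (auto simp: K.S_carr m_comm)
    then have "?f (z (Suc n)) = y \<otimes>\<^bsub>K.L\<^esub> (y [^]\<^bsub>K.L\<^esub> n \<otimes>\<^bsub>K.L\<^esub> ?f x)" using Suc by simp
    also have "\<dots> = y [^]\<^bsub>K.L\<^esub> Suc n \<otimes>\<^bsub>K.L\<^esub> ?f x" using y fc x I
      by (simp add: subset_iff K.L.m_ac)
    finally show ?case .
  qed
  have sub: "z ` {..<n} \<subseteq> carrier R" for n using zc by auto
  have rel: "\<exists>cs. length cs = n \<and> set cs \<subseteq> ?f ` carrier R \<and> ?f w = K.L.eval cs y \<otimes>\<^bsub>K.L\<^esub> ?f x"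
    if "w \<in> Idl (z ` {..<n})" for w n
    using that
  proof (induction n arbitrary: w)
    case 0
    have "Idl {} \<subseteq> {\<zero>}" by (rule genideal_minimal[OF zeroideal]) simp
    then have "w = \<zero>" using 0 by auto
    moreover have "?f \<zero> = \<zero>\<^bsub>K.L\<^esub>" by (simp add: to_localization_def K.zero_L)
    ultimately show ?case using fc x I by (intro exI[of _ "[]"]) auto
  next
    case (Suc n)
    have "z ` {..<Suc n} = insert (z n) (z ` {..<n})" by (simp add: lessThan_Suc)
    then obtain r v where r: "r \<in> carrier R" and v: "v \<in> Idl (z ` {..<n})" and w: "w = r \<otimes> z n \<oplus> v"
      using genideal_insert[OF zc sub] Suc.prems by metis
    obtain cs where cs: "length cs = n" "set cs \<subseteq> ?f ` carrier R"
      and ev: "?f v = K.L.eval cs y \<otimes>\<^bsub>K.L\<^esub> ?f x" using Suc.IH[OF v] by blast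
    have vc: "v \<in> carrier R" using ideal.Icarr[OF genideal_ideal[OF sub] v] .
    have csc: "set cs \<subseteq> carrier K.L" using cs(2) fc by blast
    have ec: "K.L.eval cs y \<in> carrier K.L" using K.L.eval_in_carrier[OF csc y] .
    have xc: "?f x \<in> carrier K.L" using fc x I by blast
    have "?f w = ?f r \<otimes>\<^bsub>K.L\<^esub> ?f (z n) \<oplus>\<^bsub>K.L\<^esub> ?f v"
      unfolding w using ring_hom_add[OF hom] ring_hom_mult[OF hom] r zc vc by simp
    also have "\<dots> = (?f r \<otimes>\<^bsub>K.L\<^esub> y [^]\<^bsub>K.L\<^esub> n \<oplus>\<^bsub>K.L\<^esub> K.L.eval cs y) \<otimes>\<^bsub>K.L\<^esub> ?f x"
      unfolding ev zf using fc[OF r] y ec xc by (simp add: K.L.l_distr K.L.m_assoc)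
    also have "?f r \<otimes>\<^bsub>K.L\<^esub> y [^]\<^bsub>K.L\<^esub> n \<oplus>\<^bsub>K.L\<^esub> K.L.eval cs y = K.L.eval (?f r # cs) y"
      using cs by simp
    finally show ?case using cs r by (intro exI[of _ "?f r # cs"]) auto
  qed
  obtain n where n: "z n \<in> Idl (z ` {..<n})"
  proof -
    let ?C = "range (\<lambda>n. Idl (z ` {..<n}))"
    have mono: "Idl (z ` {..<n}) \<subseteq> Idl (z ` {..<m})" if "n \<le> m" for n m
      by (rule genideal_minimal[OF genideal_ideal[OF sub]])
        (use genideal_self[OF sub[of m]] that in auto)
    have "subset.chain {I. ideal I R} ?C"
      unfolding subset_chain_def
    proof (intro conjI ballI)
      show "?C \<subseteq> {I. ideal I R}" using genideal_ideal[OF sub] by blast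
      fix U V assume "U \<in> ?C" "V \<in> ?C"
      then obtain n m where "U = Idl (z ` {..<n})" "V = Idl (z ` {..<m})" by blast
      then show "U \<subseteq> V \<or> V \<subseteq> U" using mono[of n m] mono[of m n] by (cases "n \<le> m") auto
    qed
    then have "\<Union>?C \<in> ?C" using noetherian_ring.ideal_chain_is_trivial[OF noeth] by blast
    then obtain n where n: "\<Union>?C = Idl (z ` {..<n})" by blast
    have "z n \<in> Idl (z ` {..<Suc n})" using genideal_self[OF sub[of "Suc n"]] by auto
    then have "z n \<in> \<Union>?C" by blast
    then show ?thesis using n that by blast
  qed
  have "\<ominus> z n \<in> Idl (z ` {..<n})"
    using n genideal_ideal[OF sub, of n]
    by (simp add: additive_subgroup.a_inv_closed ideal.axioms(1))
  then obtain cs where cs: "length cs = n" "set cs \<subseteq> ?f ` carrier R"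
    and ev: "?f (\<ominus> z n) = K.L.eval cs y \<otimes>\<^bsub>K.L\<^esub> ?f x" using rel by blast
  let ?p = "\<one>\<^bsub>K.L\<^esub> # cs"
  have csc: "set cs \<subseteq> carrier K.L" using cs(2) fc by blast
  have ec: "K.L.eval cs y \<in> carrier K.L" using K.L.eval_in_carrier[OF csc y] .
  have pc: "K.L.eval ?p y \<in> carrier K.L" using y ec by simp
  have xc: "?f x \<in> carrier K.L" using fc x I by blast
  have "K.L.eval ?p y \<otimes>\<^bsub>K.L\<^esub> ?f x = ?f (z n) \<oplus>\<^bsub>K.L\<^esub> ?f (\<ominus> z n)"
    unfolding ev zf using y ec xc cs by (simp add: K.L.l_distr)
  also have "\<dots> = ?f \<zero>" using ring_hom_add[OF hom, of "z n" "\<ominus> z n"] zc by (simp add: r_neg)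
  also have "\<dots> = \<zero>\<^bsub>K.L\<^esub>" by (simp add: to_localization_def K.zero_L)
  finally have zero: "K.L.eval ?p y \<otimes>\<^bsub>K.L\<^esub> ?f x = \<zero>\<^bsub>K.L\<^esub>" .
  have "K.L.eval ?p y = K.L.eval ?p y \<otimes>\<^bsub>K.L\<^esub> (?f x \<otimes>\<^bsub>K.L\<^esub> K.fr \<one> x)"
    using K.denominator_unit[OF N(2)] pc by (simp del: K.L.eval.simps)
  also have "\<dots> = (K.L.eval ?p y \<otimes>\<^bsub>K.L\<^esub> ?f x) \<otimes>\<^bsub>K.L\<^esub> K.fr \<one> x"
    using pc xc N(2) by (simp add: K.L.m_assoc del: K.L.eval.simps)
  also have "\<dots> = \<zero>\<^bsub>K.L\<^esub>" using N(2) by (simp add: zero del: K.L.eval.simps)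
  finally have root: "K.L.eval ?p y = \<zero>\<^bsub>K.L\<^esub>" .
  have one: "?f \<one> = \<one>\<^bsub>K.L\<^esub>" using ring_hom_one[OF hom] .
  have "\<one>\<^bsub>K.L\<^esub> \<noteq> \<zero>\<^bsub>K.L\<^esub>"
    unfolding K.one_L using K.fraction_eq_zero_iff[of \<one> \<one>] K.S_one by (auto simp: nonzerodivisors_eq)
  moreover have "set ?p \<subseteq> ?f ` carrier R" using cs one by (metis image_eqI insert_subset list.simps(15) one_closed)
  ultimately have "polynomial\<^bsub>K.L\<^esub> (?f ` carrier R) ?p" by (simp add: polynomial_def)
  then show ?thesis
    unfolding integral_over_def total_fractions_def to_fractions_def
    using root by (intro exI[of _ ?p]) (simp add: y_def del: K.L.eval.simps)
qed

text \<open>The form in which normality is used: an integral fraction \<open>c / b\<close> lies in \<open>R\<close>.\<close>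

lemma normal_domain_multiplier:
  fixes R :: "('a, 'm) ring_scheme" (structure)
  assumes norm: "normal_domain R" and noeth: "noetherian_ring R"
    and I: "I \<subseteq> carrier R" and x: "x \<in> I" "x \<noteq> \<zero>"
    and c: "c \<in> carrier R" and b: "b \<in> carrier R" "b \<noteq> \<zero>"
    and mult: "\<And>x. x \<in> I \<Longrightarrow> \<exists>z\<in>I. c \<otimes> x = b \<otimes> z"
  shows "\<exists>r\<in>carrier R. c = b \<otimes> r"
proof -
  interpret domain R using norm by (simp add: normal_domain_def)
  interpret K: localized R "nonzerodivisors R" by (rule localized_nonzerodivisors)
  have bN: "b \<in> nonzerodivisors R" using b by (simp add: nonzerodivisors_eq)
  have "K.fr c b \<in> carrier (total_fractions R)"
    using K.fraction_carrier[OF c bN] by (simp add: total_fractions_def)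
  then have "K.fr c b \<in> to_fractions R ` carrier R"
    using multiplier_integral[OF noeth I x c b mult] norm unfolding normal_domain_def by blast
  then obtain r where r: "r \<in> carrier R" and eq: "K.fr c b = K.fr r \<one>"
    by (auto simp: to_fractions_def to_localization_def)
  obtain u where "u \<in> nonzerodivisors R" "u \<otimes> (c \<otimes> \<one>) = u \<otimes> (r \<otimes> b)"
    using eq K.fraction_eq_iff[OF c r bN K.S_one] by blast
  then have "c = r \<otimes> b" using cancel_left[of u c "r \<otimes> b"] c r b by (simp add: nonzerodivisors_eq)
  then show ?thesis using r b m_comm by blast
qed

lemma (in domain) height_one_minimal:
  assumes "height_one_prime R Q" "primeideal M R" "M \<subseteq> Q" "M \<noteq> {\<zero>}"
  shows "M = Q"
proof (rule ccontr)
  assume "M \<noteq> Q"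
  then have "M \<subset> Q" using assms(3) by blast
  moreover have "\<zero> \<in> M"
    using assms(2) by (simp add: additive_subgroup.zero_closed ideal.axioms(1) primeideal.axioms(1))
  then have "{\<zero>} \<subset> M" using assms(4) by blast
  ultimately show False using assms(1,2) zeroprimeideal unfolding height_one_prime_def by blast
qed

lemma (in domain) height_one_nonzero:
  assumes "height_one_prime R Q"
  shows "\<exists>b\<in>Q. b \<noteq> \<zero>"
proof -
  obtain Q0 where "primeideal Q0 R" "Q0 \<subset> Q" using assms unfolding height_one_prime_def by blast
  moreover then have "\<zero> \<in> Q0"
    by (simp add: additive_subgroup.zero_closed ideal.axioms(1) primeideal.axioms(1))
  moreover obtain x where "x \<in> Q" "x \<notin> Q0"
    using psubset_imp_ex_mem[OF \<open>Q0 \<subset> Q\<close>] by blast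
  ultimately show ?thesis by metis
qed

text \<open>Pick \<open>0 \<noteq> b \<in> Q\<close>. Since \<open>Q\<close> is minimal over \<open>b\<close>, it is a colon ideal \<open>Q = (bR : c)\<close>. Then
  \<open>(c / b) Q \<subseteq> R\<close>, and \<open>(c / b) Q \<subseteq> Q\<close> is impossible by normality, so that \<open>ct = bw\<close> with \<open>t \<in> Q\<close> and
  \<open>w \<notin> Q\<close>. For \<open>a \<in> Q\<close> with \<open>ca = bz\<close> this gives \<open>wa = tz\<close>: division by \<open>t\<close> up to the unit \<open>w\<close> of
  \<open>R\<^sub>Q\<close>. The ascending chain condition makes repeated division stop.\<close>

lemma height_one_uniformizer:
  fixes R :: "('a, 'm) ring_scheme" (structure)
  assumes norm: "normal_domain R" and noeth: "noetherian_ring R" and Q: "height_one_prime R Q"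
  shows "\<exists>t. uniformized_prime R Q t"
proof -
  interpret domain R using norm by (simp add: normal_domain_def)
  interpret noetherian_ring R by (rule noeth)
  interpret Q: primeideal Q R using Q by (simp add: height_one_prime_def)
  interpret loc: localized R "carrier R - Q" by (rule Q.localized_complement)
  obtain b where b: "b \<in> Q" "b \<noteq> \<zero>" using height_one_nonzero[OF Q] by blast
  have bc: "b \<in> carrier R" using b Q.Icarr by blast
  have J: "ideal (PIdl b) R" using bc by (rule cgenideal_ideal)
  have "PIdl b \<subseteq> Q" using b Q.I_l_closed by (auto simp: cgenideal_def)
  then obtain c where c: "c \<in> carrier R" and prime: "primeideal (colon R (PIdl b) {c}) R"
    and sub: "colon R (PIdl b) {c} \<subseteq> Q"
    using exists_prime_colon[OF noeth J Q.primeideal_axioms] by blast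
  have mem: "x \<in> colon R (PIdl b) {c} \<longleftrightarrow> x \<in> carrier R \<and> (\<exists>z\<in>carrier R. c \<otimes> x = b \<otimes> z)" for x
    using bc by (auto simp: colon_def cgenideal_def m_comm)
  have "b \<in> colon R (PIdl b) {c}" unfolding mem using bc c m_comm by blast
  then have "colon R (PIdl b) {c} \<noteq> {\<zero>}" using b by blast
  then have eqQ: "colon R (PIdl b) {c} = Q" by (rule height_one_minimal[OF Q prime sub])
  have div: "\<exists>z\<in>carrier R. c \<otimes> x = b \<otimes> z" if "x \<in> Q" for x
    using that mem unfolding eqQ by blast
  have "\<exists>t\<in>Q. \<exists>w\<in>carrier R - Q. c \<otimes> t = b \<otimes> w"
  proof (rule ccontr)
    assume neg: "\<not> ?thesis"
    have "\<exists>z\<in>Q. c \<otimes> x = b \<otimes> z" if "x \<in> Q" for x using div[OF that] neg that by blast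
    then obtain r where r: "r \<in> carrier R" "c = b \<otimes> r"
      using normal_domain_multiplier[OF norm noeth _ b c bc b(2)] Q.Icarr by blast
    then have "\<one> \<in> colon R (PIdl b) {c}" unfolding mem using bc by auto
    then show False using sub loc.S_one by blast
  qed
  then obtain t w where t: "t \<in> Q" and w: "w \<in> carrier R" "w \<notin> Q" and ct: "c \<otimes> t = b \<otimes> w"
    by blast
  have tc: "t \<in> carrier R" using t Q.Icarr by blast
  have wa: "\<exists>z\<in>carrier R. w \<otimes> a = t \<otimes> z" if a: "a \<in> Q" for a
  proof -
    obtain z where z: "z \<in> carrier R" "c \<otimes> a = b \<otimes> z" using div[OF a] by blast
    have ac: "a \<in> carrier R" using a Q.Icarr by blast
    have "b \<otimes> (w \<otimes> a) = (c \<otimes> t) \<otimes> a" unfolding ct using ac bc w by (simp add: m_assoc)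
    also have "\<dots> = t \<otimes> (c \<otimes> a)" using ac c tc by (simp add: m_ac)
    also have "\<dots> = b \<otimes> (t \<otimes> z)" unfolding z(2) using bc tc z by (simp add: m_lcomm)
    finally have "w \<otimes> a = t \<otimes> z" by (rule cancel_left) (use ac bc w tc z b in auto)
    then show ?thesis using z by blast
  qed
  have t0: "t \<noteq> \<zero>"
  proof
    assume "t = \<zero>"
    then have "w \<otimes> b = \<zero>" using wa[OF b(1)] by auto
    then have "w = \<zero>" using integral w bc b by blast
    then show False using w Q.zero_closed by blast
  qed
  \<comment> \<open>The contraction of \<open>aR\<^sub>Q\<close> to \<open>R\<close>; it strictly increases when \<open>a\<close> is divided by \<open>t\<close>.\<close>
  define I where "I a = {r \<in> carrier R. \<exists>s\<in>carrier R - Q. \<exists>k\<in>carrier R. s \<otimes> r = k \<otimes> a}" for a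
  have idI: "ideal (I a) R" if a: "a \<in> carrier R" for a
  proof (rule ideal_by_closure)
    show "I a \<subseteq> carrier R" unfolding I_def by blast
    have "\<one> \<otimes> \<zero> = \<zero> \<otimes> a" using a by simp
    then show "\<zero> \<in> I a" unfolding I_def using loc.S_one by blast
  next
    fix x y assume x: "x \<in> I a" and y: "y \<in> I a"
    obtain s k s' k' where s: "s \<in> carrier R - Q" "k \<in> carrier R" "s \<otimes> x = k \<otimes> a"
      and s': "s' \<in> carrier R - Q" "k' \<in> carrier R" "s' \<otimes> y = k' \<otimes> a"
      using x y unfolding I_def by blast
    have xc: "x \<in> carrier R" and yc: "y \<in> carrier R" using x y unfolding I_def by auto
    have sc: "s \<in> carrier R" "s' \<in> carrier R" using s s' by auto
    have "s \<otimes> s' \<otimes> (x \<oplus> y) = s' \<otimes> (s \<otimes> x) \<oplus> s \<otimes> (s' \<otimes> y)"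
      using sc xc yc by (simp add: r_distr m_ac)
    also have "\<dots> = (s' \<otimes> k \<oplus> s \<otimes> k') \<otimes> a"
      unfolding s(3) s'(3) using sc s s' a by (simp add: l_distr m_assoc)
    finally show "x \<oplus> y \<in> I a"
      unfolding I_def using loc.S_mult[OF s(1) s'(1)] s s' sc xc yc by blast
  next
    fix r x assume r: "r \<in> carrier R" and x: "x \<in> I a"
    obtain s k where s: "s \<in> carrier R - Q" and k: "k \<in> carrier R" and eq: "s \<otimes> x = k \<otimes> a"
      and xc: "x \<in> carrier R" using x unfolding I_def by blast
    have "s \<otimes> (r \<otimes> x) = r \<otimes> (s \<otimes> x)" using s r xc by (simp add: m_lcomm)
    also have "\<dots> = (r \<otimes> k) \<otimes> a" unfolding eq using k r a by (simp add: m_assoc)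
    finally show "r \<otimes> x \<in> I a" unfolding I_def using s k r xc by blast
  qed
  have fact: "\<exists>(n::nat) s u. s \<in> carrier R - Q \<and> u \<in> carrier R - Q \<and> s \<otimes> a = t [^] n \<otimes> u"
    if a: "a \<in> carrier R" "a \<noteq> \<zero>" for a
  proof (rule ccontr)
    assume bad: "\<not> ?thesis"
    let ?B = "{a \<in> carrier R. a \<noteq> \<zero> \<and> \<not> (\<exists>(n::nat) s u. s \<in> carrier R - Q \<and> u \<in> carrier R - Q \<and>
      s \<otimes> a = t [^] n \<otimes> u)}"
    have "I ` ?B \<noteq> {}" using a bad by blast
    moreover have "ideal i R" if "i \<in> I ` ?B" for i using that idI by blast
    ultimately have "\<exists>M\<in>I ` ?B. \<forall>i\<in>I ` ?B. M \<subseteq> i \<longrightarrow> i = M" by (rule maximal_ideal_in_family)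
    then obtain M where "M \<in> I ` ?B" and max: "\<forall>i\<in>I ` ?B. M \<subseteq> i \<longrightarrow> i = M" by (rule bexE)
    then obtain a where a: "a \<in> ?B" and M: "M = I a" by blast
    have ac: "a \<in> carrier R" and a0: "a \<noteq> \<zero>"
      and nf: "\<And>(n::nat) s u. s \<in> carrier R - Q \<Longrightarrow> u \<in> carrier R - Q \<Longrightarrow>
        s \<otimes> a \<noteq> t [^] n \<otimes> u" using a by auto
    have "a \<in> Q"
    proof (rule ccontr)
      assume "a \<notin> Q"
      then show False using nf[OF loc.S_one, of a 0] ac by simp
    qed
    then obtain z where z: "z \<in> carrier R" and wz: "w \<otimes> a = t \<otimes> z" using wa by blast
    have wS: "w \<in> carrier R - Q" using w by blast
    have "z \<in> ?B"
    proof (intro CollectI conjI notI)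
      show "z \<in> carrier R" by (rule z)
      assume "z = \<zero>"
      then have "w \<otimes> a = \<zero>" using wz tc by simp
      then show False using integral w ac a0 Q.zero_closed by blast
    next
      assume "\<exists>(n::nat) s u. s \<in> carrier R - Q \<and> u \<in> carrier R - Q \<and> s \<otimes> z = t [^] n \<otimes> u"
      then obtain n :: nat and s u where s: "s \<in> carrier R - Q" and u: "u \<in> carrier R - Q"
        and eq: "s \<otimes> z = t [^] n \<otimes> u" by blast
      have "s \<otimes> w \<otimes> a = s \<otimes> (w \<otimes> a)" using s w ac by (simp add: m_assoc)
      also have "\<dots> = t \<otimes> (s \<otimes> z)" unfolding wz using s tc z by (simp add: m_lcomm)
      also have "\<dots> = t [^] Suc n \<otimes> u" unfolding eq using u tc by (simp add: m_ac)
      finally show False using nf[OF loc.S_mult[OF s wS] u] by blast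
    qed
    moreover have "I a \<subseteq> I z"
    proof
      fix r assume "r \<in> I a"
      then obtain s k where rc: "r \<in> carrier R" and s: "s \<in> carrier R - Q" and k: "k \<in> carrier R"
        and eq: "s \<otimes> r = k \<otimes> a" unfolding I_def by blast
      have sc: "s \<in> carrier R" using s by blast
      have "w \<otimes> s \<otimes> r = w \<otimes> (s \<otimes> r)" using w sc rc by (simp add: m_assoc)
      also have "\<dots> = k \<otimes> (w \<otimes> a)" unfolding eq using w k ac by (simp add: m_lcomm)
      also have "\<dots> = (k \<otimes> t) \<otimes> z" unfolding wz using k tc z by (simp add: m_assoc)
      finally show "r \<in> I z" unfolding I_def using rc loc.S_mult[OF wS s] k tc by blast
    qed
    ultimately have "I z = I a" using max M by blast
    moreover have "z \<in> I z" unfolding I_def using z loc.S_one by auto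
    ultimately have "z \<in> I a" by simp
    then obtain s k where s: "s \<in> carrier R - Q" and k: "k \<in> carrier R" and eq: "s \<otimes> z = k \<otimes> a"
      unfolding I_def by blast
    have sc: "s \<in> carrier R" using s by blast
    have "a \<otimes> (s \<otimes> w) = s \<otimes> (w \<otimes> a)" using ac sc w by (simp add: m_ac)
    also have "\<dots> = t \<otimes> (s \<otimes> z)" unfolding wz using sc tc z by (simp add: m_lcomm)
    also have "\<dots> = a \<otimes> (k \<otimes> t)" unfolding eq using k tc ac by (simp add: m_ac)
    finally have "s \<otimes> w = k \<otimes> t" by (rule cancel_left) (use a0 ac sc w k tc in auto)
    then have "s \<otimes> w \<in> Q" using Q.I_l_closed[OF t k] by simp
    then show False using loc.S_mult[OF s wS] by blast
  qed
  have "uniformized_prime R Q t"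
    by (intro uniformized_prime.intro uniformized_prime_axioms.intro fact t t0
      domain_axioms Q.primeideal_axioms)
  then show ?thesis ..
qed

section \<open>The module of a divisor\<close>

text \<open>The divisors \<open>\<lceil>(p\<^sup>e - 1)\<Delta>\<rceil>\<close> of a triple satisfy these assumptions. For \<open>D = 0\<close> the ring need not be a
  domain, which is why the two cases of the module are treated separately throughout.\<close>

locale divisor_data = cring R for R :: "('a, 'm) ring_scheme" (structure) +
  fixes D :: "'a set \<Rightarrow> int"
  assumes D_nonneg: "0 \<le> D Q"
    and normal_or_zero: "D \<noteq> (\<lambda>_. 0) \<Longrightarrow> normal_domain R \<and> noetherian_ring R"
begin

sublocale K: localized R "nonzerodivisors R" by (rule localized_nonzerodivisors)

abbreviation DM :: "('a, ('a \<times> 'a) set) module" where "DM \<equiv> divisor_module R D"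

lemma total_fractions_K: "total_fractions R = K.L" by (simp add: total_fractions_def)

lemma to_fractions_K: "to_fractions R r = K.fr r \<one>" by (simp add: to_fractions_def to_localization_def)

lemma to_fractions_carrier: "r \<in> carrier R \<Longrightarrow> to_fractions R r \<in> carrier K.L"
  using K.S_one by (simp add: to_fractions_K)

lemma Mod_carrier_zero: "D = (\<lambda>_. 0) \<Longrightarrow> carrier DM = to_fractions R ` carrier R"
  by (simp add: divisor_module_def)

lemma Mod_subset: "carrier DM \<subseteq> carrier K.L"
  using to_fractions_carrier by (auto simp: divisor_module_def total_fractions_K split: if_splits)

lemma fraction_zero_iff:
  assumes "domain R" "a \<in> carrier R" "b \<in> nonzerodivisors R"
  shows "K.fr a b = \<zero>\<^bsub>K.L\<^esub> \<longleftrightarrow> a = \<zero>"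
proof -
  interpret domain R by (rule assms(1))
  show ?thesis
  proof
    assume "K.fr a b = \<zero>\<^bsub>K.L\<^esub>"
    then obtain u where "u \<in> nonzerodivisors R" "u \<otimes> a = \<zero>"
      using K.fraction_eq_zero_iff[OF assms(2,3)] by blast
    then show "a = \<zero>" using integral[of u a] assms(2) unfolding nonzerodivisors_eq by blast
  qed (simp add: K.fraction_zero assms(3))
qed

lemma domain_if_nonzero: "D \<noteq> (\<lambda>_. 0) \<Longrightarrow> domain R"
  using normal_or_zero by (simp add: normal_domain_def)

lemma uniformizer: "\<lbrakk>D \<noteq> (\<lambda>_. 0); height_one_prime R Q\<rbrakk> \<Longrightarrow> \<exists>t. uniformized_prime R Q t"
  using normal_or_zero height_one_uniformizer by blast

lemma fraction_mem_Mod: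
  assumes D: "D \<noteq> (\<lambda>_. 0)" and a: "a \<in> carrier R" and b: "b \<in> carrier R" "b \<noteq> \<zero>"
  shows "K.fr a b \<in> carrier DM \<longleftrightarrow> a = \<zero> \<or>
    (\<forall>Q. height_one_prime R Q \<longrightarrow> int (order_at R Q a) - int (order_at R Q b) + D Q \<ge> 0)"
proof -
  interpret domain R by (rule domain_if_nonzero[OF D])
  have bN: "b \<in> nonzerodivisors R" using b by (simp add: nonzerodivisors_eq)
  have val: "valuation_at R Q (K.fr a b) = int (order_at R Q a) - int (order_at R Q b)"
    if Q: "height_one_prime R Q" and a0: "a \<noteq> \<zero>" for Q
  proof -
    obtain t where "uniformized_prime R Q t" using uniformizer[OF D Q] by blast
    then show ?thesis using a b a0 by (intro uniformized_prime.valuation_at_fraction)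
  qed
  show ?thesis
    using D K.fraction_carrier[OF a bN] fraction_zero_iff[OF domain_axioms a bN] val
    by (auto simp: divisor_module_def total_fractions_K)
qed

lemma fraction_cases:
  assumes "domain R" "x \<in> carrier K.L"
  obtains a b where "a \<in> carrier R" "b \<in> carrier R" "b \<noteq> \<zero>" "x = K.fr a b"
proof -
  interpret domain R by (rule assms(1))
  obtain a b where ab: "a \<in> carrier R" "b \<in> nonzerodivisors R" "x = K.fr a b"
    using assms(2) unfolding K.carrier_L by blast
  then show ?thesis using that[of a b] nonzerodivisors_eq by simp
qed

lemma scale_fraction:
  assumes "r \<in> carrier R" "a \<in> carrier R" "b \<in> nonzerodivisors R"
  shows "to_fractions R r \<otimes>\<^bsub>K.L\<^esub> K.fr a b = K.fr (r \<otimes> a) b"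
  using assms K.S_one by (simp add: to_fractions_K K.fraction_mult K.S_carr)

lemma to_fractions_mem_Mod:
  assumes r: "r \<in> carrier R"
  shows "to_fractions R r \<in> carrier DM"
proof (cases "D = (\<lambda>_. 0)")
  case True
  then show ?thesis using r Mod_carrier_zero by simp
next
  case False
  interpret domain R by (rule domain_if_nonzero[OF False])
  have "order_at R Q \<one> = 0" if Q: "height_one_prime R Q" for Q
  proof -
    obtain t where "uniformized_prime R Q t" using uniformizer[OF False Q] by blast
    then interpret Q: uniformized_prime R Q t .
    show ?thesis using Q.order_at_zero_iff[of \<one>] Q.loc.S_one by simp
  qed
  then show ?thesis
    unfolding to_fractions_K using fraction_mem_Mod[OF False r one_closed one_not_zero] D_nonneg by simp
qed

lemma Mod_smult_closed:
  assumes r: "r \<in> carrier R" and x: "x \<in> carrier DM"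
  shows "to_fractions R r \<otimes>\<^bsub>K.L\<^esub> x \<in> carrier DM"
proof (cases "D = (\<lambda>_. 0)")
  case True
  then obtain a where "a \<in> carrier R" "x = to_fractions R a" using x Mod_carrier_zero by auto
  then have "to_fractions R r \<otimes>\<^bsub>K.L\<^esub> x = to_fractions R (r \<otimes> a)"
    using r scale_fraction[of r a \<one>] K.S_one by (simp add: to_fractions_K)
  then show ?thesis using to_fractions_mem_Mod r \<open>a \<in> carrier R\<close> by simp
next
  case False
  interpret domain R by (rule domain_if_nonzero[OF False])
  obtain a b where a: "a \<in> carrier R" and b: "b \<in> carrier R" "b \<noteq> \<zero>" and xab: "x = K.fr a b"
    using fraction_cases[OF domain_axioms] x Mod_subset by blast
  have bN: "b \<in> nonzerodivisors R" using b by (simp add: nonzerodivisors_eq)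
  have "K.fr (r \<otimes> a) b \<in> carrier DM"
  proof (cases "r = \<zero> \<or> a = \<zero>")
    case True
    then have "r \<otimes> a = \<zero>" using r a by auto
    then show ?thesis using fraction_mem_Mod[OF False _ b] r a by simp
  next
    case nz: False
    have "int (order_at R Q (r \<otimes> a)) - int (order_at R Q b) + D Q \<ge> 0"
      if Q: "height_one_prime R Q" for Q
    proof -
      obtain t where "uniformized_prime R Q t" using uniformizer[OF False Q] by blast
      then interpret Q: uniformized_prime R Q t .
      have "int (order_at R Q a) - int (order_at R Q b) + D Q \<ge> 0"
        using x nz Q unfolding xab fraction_mem_Mod[OF False a b] by blast
      then show ?thesis using Q.order_at_mult[of r a] nz r a by simp
    qed
    then show ?thesis using fraction_mem_Mod[OF False _ b] r a by simp
  qed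
  then show ?thesis using scale_fraction[OF r a bN] by (simp add: xab)
qed

lemma Mod_add_closed:
  assumes x: "x \<in> carrier DM" and y: "y \<in> carrier DM"
  shows "x \<oplus>\<^bsub>K.L\<^esub> y \<in> carrier DM"
proof (cases "D = (\<lambda>_. 0)")
  case True
  obtain a where a: "a \<in> carrier R" "x = to_fractions R a"
    using x unfolding Mod_carrier_zero[OF True] by blast
  obtain b where b: "b \<in> carrier R" "y = to_fractions R b"
    using y unfolding Mod_carrier_zero[OF True] by blast
  have "x \<oplus>\<^bsub>K.L\<^esub> y = to_fractions R (a \<oplus> b)"
    using a b K.fraction_common_denominator[of a b \<one>] K.S_one by (simp add: to_fractions_K)
  then show ?thesis using to_fractions_mem_Mod a b by simp
next
  case False
  interpret domain R by (rule domain_if_nonzero[OF False])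
  obtain a b where a: "a \<in> carrier R" and b: "b \<in> carrier R" "b \<noteq> \<zero>" and xab: "x = K.fr a b"
    using fraction_cases[OF domain_axioms] x Mod_subset by blast
  obtain c d where c: "c \<in> carrier R" and d: "d \<in> carrier R" "d \<noteq> \<zero>" and ycd: "y = K.fr c d"
    using fraction_cases[OF domain_axioms] y Mod_subset by blast
  have N: "b \<in> nonzerodivisors R" "d \<in> nonzerodivisors R" using b d by (auto simp: nonzerodivisors_eq)
  let ?n = "a \<otimes> d \<oplus> c \<otimes> b"
  have sum: "x \<oplus>\<^bsub>K.L\<^esub> y = K.fr ?n (b \<otimes> d)" unfolding xab ycd using a c N by (simp add: K.fraction_add)
  have bd: "b \<otimes> d \<in> carrier R" "b \<otimes> d \<noteq> \<zero>" using b d by (auto simp: integral_iff)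
  have nc: "?n \<in> carrier R" using a b c d by simp
  consider "a = \<zero>" | "c = \<zero>" | "?n = \<zero>" | "a \<noteq> \<zero>" "c \<noteq> \<zero>" "?n \<noteq> \<zero>" by blast
  then show ?thesis
  proof cases
    case 1
    then have "x = \<zero>\<^bsub>K.L\<^esub>" unfolding xab using K.fraction_zero N by simp
    then show ?thesis using y Mod_subset by (simp add: subset_iff)
  next
    case 2
    then have "y = \<zero>\<^bsub>K.L\<^esub>" unfolding ycd using K.fraction_zero N by simp
    then show ?thesis using x Mod_subset by (simp add: subset_iff)
  next
    case 3
    then show ?thesis unfolding sum using fraction_mem_Mod[OF False nc bd] by simp
  next
    case 4
    have "int (order_at R Q ?n) - int (order_at R Q (b \<otimes> d)) + D Q \<ge> 0"
      if Q: "height_one_prime R Q" for Q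
    proof -
      obtain t where "uniformized_prime R Q t" using uniformizer[OF False Q] by blast
      then interpret Q: uniformized_prime R Q t .
      have 1: "int (order_at R Q a) - int (order_at R Q b) + D Q \<ge> 0"
        using x 4 Q unfolding xab fraction_mem_Mod[OF False a b] by blast
      have 2: "int (order_at R Q c) - int (order_at R Q d) + D Q \<ge> 0"
        using y 4 Q unfolding ycd fraction_mem_Mod[OF False c d] by blast
      have "min (order_at R Q (a \<otimes> d)) (order_at R Q (c \<otimes> b)) \<le> order_at R Q ?n"
        using 4 a b c d by (intro Q.order_at_add) (auto simp: integral_iff)
      then show ?thesis
        using 1 2 Q.order_at_mult[of a d] Q.order_at_mult[of c b] Q.order_at_mult[of b d] 4 a b c d
        by (simp add: min_def split: if_splits)
    qed
    then show ?thesis unfolding sum using fraction_mem_Mod[OF False nc bd] by blast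
  qed
qed

end

section \<open>Localizing maps out of a submodule of the fraction ring\<close>

locale prime_localization = primeideal P R for P :: "'a set" and R :: "('a, 'm) ring_scheme" (structure)
begin

sublocale loc: localized R "carrier R - P" by (rule localized_complement)
sublocale K: localized R "nonzerodivisors R" by (rule localized_nonzerodivisors)
sublocale T: localized loc.L "nonzerodivisors loc.L" by (rule loc.L.localized_nonzerodivisors)

abbreviation local_mult (infixl "\<otimes>\<^sub>L" 70) where "x \<otimes>\<^sub>L y \<equiv> x \<otimes>\<^bsub>loc.L\<^esub> y"
abbreviation local_add (infixl "\<oplus>\<^sub>L" 65) where "x \<oplus>\<^sub>L y \<equiv> x \<oplus>\<^bsub>loc.L\<^esub> y"
abbreviation local_zero ("\<zero>\<^sub>L") where "\<zero>\<^sub>L \<equiv> \<zero>\<^bsub>loc.L\<^esub>"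
abbreviation local_one ("\<one>\<^sub>L") where "\<one>\<^sub>L \<equiv> \<one>\<^bsub>loc.L\<^esub>"
abbreviation frac_mult (infixl "\<otimes>\<^sub>K" 70) where "x \<otimes>\<^sub>K y \<equiv> x \<otimes>\<^bsub>K.L\<^esub> y"
abbreviation frac_add (infixl "\<oplus>\<^sub>K" 65) where "x \<oplus>\<^sub>K y \<equiv> x \<oplus>\<^bsub>K.L\<^esub> y"
abbreviation local_frac_mult (infixl "\<otimes>\<^sub>T" 70) where "x \<otimes>\<^sub>T y \<equiv> x \<otimes>\<^bsub>T.L\<^esub> y"
abbreviation local_frac_add (infixl "\<oplus>\<^sub>T" 65) where "x \<oplus>\<^sub>T y \<equiv> x \<oplus>\<^bsub>T.L\<^esub> y"

abbreviation l :: "'a \<Rightarrow> ('a \<times> 'a) set" where "l \<equiv> to_local_at R P"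
abbreviation k :: "'a \<Rightarrow> ('a \<times> 'a) set" where "k \<equiv> to_fractions R"
abbreviation \<tau> :: "('a \<times> 'a) set \<Rightarrow> (('a \<times> 'a) set \<times> ('a \<times> 'a) set) set"
  where "\<tau> \<equiv> to_fractions loc.L"

lemma l_hom: "l \<in> ring_hom R loc.L" unfolding to_local_at_def by (rule loc.to_localization_hom)
lemma k_hom: "k \<in> ring_hom R K.L" unfolding to_fractions_def by (rule K.to_localization_hom)
lemma \<tau>_hom: "\<tau> \<in> ring_hom loc.L T.L" unfolding to_fractions_def by (rule T.to_localization_hom)

lemma l_fr: "l a = loc.fr a \<one>" by (simp add: to_local_at_def to_localization_def)
lemma k_fr: "k a = K.fr a \<one>" by (simp add: to_fractions_def to_localization_def)
lemma \<tau>_fr: "\<tau> x = T.fr x \<one>\<^sub>L" by (simp add: to_fractions_def to_localization_def)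

lemmas l_closed [simp] = ring_hom_closed[OF l_hom]
  and k_closed [simp] = ring_hom_closed[OF k_hom]
  and \<tau>_closed [simp] = ring_hom_closed[OF \<tau>_hom]

lemmas l_mult = ring_hom_mult[OF l_hom] and l_add = ring_hom_add[OF l_hom] and l_one = ring_hom_one[OF l_hom]
  and k_mult = ring_hom_mult[OF k_hom] and \<tau>_mult = ring_hom_mult[OF \<tau>_hom] and \<tau>_one = ring_hom_one[OF \<tau>_hom]

lemma l_power: "a \<in> carrier R \<Longrightarrow> l (a [^] (n::nat)) = l a [^]\<^bsub>loc.L\<^esub> n"
proof (induction n)
  case 0
  then show ?case by (simp add: l_one)
next
  case (Suc n)
  then show ?case using l_mult[of "a [^] n" a] by simp
qed

lemma l_nonzerodivisor:
  assumes b: "b \<in> nonzerodivisors R"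
  shows "l b \<in> nonzerodivisors loc.L"
proof -
  have bc: "b \<in> carrier R" using b by (rule K.S_carr)
  have bz: "a = \<zero>" if "a \<in> carrier R" "a \<otimes> b = \<zero>" for a
    using b that unfolding nonzerodivisors_def by blast
  have "x = \<zero>\<^sub>L" if x: "x \<in> carrier loc.L" "x \<otimes>\<^sub>L l b = \<zero>\<^sub>L" for x
  proof -
    obtain a s where a: "a \<in> carrier R" and s: "s \<in> carrier R - P" and xa: "x = loc.fr a s"
      using x unfolding loc.carrier_L by blast
    have "loc.fr (a \<otimes> b) s = \<zero>\<^sub>L"
      using x(2) a s bc loc.S_one unfolding xa l_fr by (simp add: loc.fraction_mult)
    then obtain u where u: "u \<in> carrier R - P" "u \<otimes> (a \<otimes> b) = \<zero>"
      using loc.fraction_eq_zero_iff[of "a \<otimes> b" s] a bc s by auto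
    then have "u \<otimes> a = \<zero>" using bz[of "u \<otimes> a"] a bc by (simp add: m_assoc)
    then show ?thesis unfolding xa using loc.fraction_eq_zero_iff[OF a s] u by blast
  qed
  then show ?thesis unfolding nonzerodivisors_def using bc by simp
qed

text \<open>The map of total rings of fractions induced by \<open>R \<rightarrow> R\<^sub>P\<close>, defined on a chosen representative;
  \<open>\<kappa>_fraction\<close> shows that the choice does not matter.\<close>

definition \<kappa> :: "('a \<times> 'a) set \<Rightarrow> (('a \<times> 'a) set \<times> ('a \<times> 'a) set) set" where
  "\<kappa> x = T.fr (l (fst (SOME z. z \<in> x))) (l (snd (SOME z. z \<in> x)))"

lemma \<kappa>_fraction:
  assumes a: "a \<in> carrier R" and b: "b \<in> nonzerodivisors R"
  shows "\<kappa> (K.fr a b) = T.fr (l a) (l b)"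
proof -
  let ?z = "SOME z. z \<in> K.fr a b"
  have "?z \<in> K.fr a b" using K.self_mem_fraction[OF a b] by (rule someI)
  then obtain c d where z: "?z = (c, d)" and cd: "(c, d) \<in> K.fr a b" by (metis surj_pair)
  then obtain u where c: "c \<in> carrier R" and d: "d \<in> nonzerodivisors R"
    and u: "u \<in> nonzerodivisors R" "u \<otimes> (a \<otimes> d) = u \<otimes> (c \<otimes> b)"
    unfolding K.mem_fraction by blast
  have carr: "b \<in> carrier R" "d \<in> carrier R" "u \<in> carrier R" using b d u K.S_carr by auto
  have "a \<otimes> d = c \<otimes> b" using nonzerodivisor_cancel[OF u] a c carr by simp
  then have "l c \<otimes>\<^sub>L l b = l a \<otimes>\<^sub>L l d" using a c carr l_mult by metis
  then have "T.fr (l c) (l d) = T.fr (l a) (l b)"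
    using a c b d l_nonzerodivisor by (intro T.fraction_eqI) auto
  then show ?thesis unfolding \<kappa>_def z by simp
qed

lemma \<kappa>_closed [simp]: "x \<in> carrier K.L \<Longrightarrow> \<kappa> x \<in> carrier T.L"
  unfolding K.carrier_L using \<kappa>_fraction l_nonzerodivisor by auto

lemma \<kappa>_to_fractions: "a \<in> carrier R \<Longrightarrow> \<kappa> (k a) = \<tau> (l a)"
  unfolding k_fr \<tau>_fr using \<kappa>_fraction[of a \<one>] K.S_one by (simp add: l_one)

lemma \<kappa>_hom:
  assumes x: "x \<in> carrier K.L" and y: "y \<in> carrier K.L"
  shows \<kappa>_mult: "\<kappa> (x \<otimes>\<^sub>K y) = \<kappa> x \<otimes>\<^sub>T \<kappa> y" and \<kappa>_add: "\<kappa> (x \<oplus>\<^sub>K y) = \<kappa> x \<oplus>\<^sub>T \<kappa> y"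
proof -
  obtain a b c d where a: "a \<in> carrier R" "b \<in> nonzerodivisors R" "x = K.fr a b"
    and c: "c \<in> carrier R" "d \<in> nonzerodivisors R" "y = K.fr c d"
    using x y unfolding K.carrier_L by blast
  note facts = a c K.S_mult K.S_carr l_nonzerodivisor
  show "\<kappa> (x \<otimes>\<^sub>K y) = \<kappa> x \<otimes>\<^sub>T \<kappa> y"
    using facts by (simp add: K.fraction_mult \<kappa>_fraction T.fraction_mult l_mult)
  show "\<kappa> (x \<oplus>\<^sub>K y) = \<kappa> x \<oplus>\<^sub>T \<kappa> y"
    using facts by (simp add: K.fraction_add \<kappa>_fraction T.fraction_add l_mult l_add)
qed

text \<open>The map \<open>\<kappa>\<close> is injective up to multiplication by elements outside \<open>P\<close>; this makes the localized map
  in \<open>localize_map\<close> well defined.\<close>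

lemma \<kappa>_eq:
  assumes x: "x \<in> carrier K.L" and y: "y \<in> carrier K.L" and eq: "\<kappa> x = \<kappa> y"
  shows "\<exists>u\<in>carrier R - P. k u \<otimes>\<^sub>K x = k u \<otimes>\<^sub>K y"
proof -
  obtain a b c d where a: "a \<in> carrier R" "b \<in> nonzerodivisors R" "x = K.fr a b"
    and c: "c \<in> carrier R" "d \<in> nonzerodivisors R" "y = K.fr c d"
    using x y unfolding K.carrier_L by blast
  have carr: "b \<in> carrier R" "d \<in> carrier R" using a c K.S_carr by auto
  have nz: "l b \<in> nonzerodivisors loc.L" "l d \<in> nonzerodivisors loc.L" using a c l_nonzerodivisor by auto
  have "T.fr (l a) (l b) = T.fr (l c) (l d)" using eq a c \<kappa>_fraction by simp
  then obtain v where v: "v \<in> nonzerodivisors loc.L"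
    "v \<otimes>\<^sub>L (l a \<otimes>\<^sub>L l d) = v \<otimes>\<^sub>L (l c \<otimes>\<^sub>L l b)"
    using T.fraction_eq_iff[of "l a" "l c" "l b" "l d"] a(1) c(1) nz by auto
  have "l a \<otimes>\<^sub>L l d = l c \<otimes>\<^sub>L l b"
    using loc.L.nonzerodivisor_cancel[OF v] a c carr by simp
  then have "l (a \<otimes> d) = l (c \<otimes> b)" using a c carr by (simp add: l_mult)
  then obtain u where u: "u \<in> carrier R - P" "u \<otimes> (a \<otimes> d \<otimes> \<one>) = u \<otimes> (c \<otimes> b \<otimes> \<one>)"
    unfolding l_fr using loc.fraction_eq_iff[of "a \<otimes> d" "c \<otimes> b" \<one> \<one>] loc.S_one a c carr by auto
  have uc: "u \<in> carrier R" using u by blast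
  have "K.fr (u \<otimes> a) b = K.fr (u \<otimes> c) d"
    using a c carr uc u(2) by (intro K.fraction_eqI) (auto simp: m_assoc)
  then have "k u \<otimes>\<^sub>K x = k u \<otimes>\<^sub>K y"
    unfolding k_fr using a c carr uc K.S_one by (simp add: K.fraction_mult)
  then show ?thesis using u(1) by blast
qed

text \<open>The elements of the fraction ring of \<open>R\<^sub>P\<close> that lie in the localization of \<open>N\<close>.\<close>

definition local_span :: "('a \<times> 'a) set set \<Rightarrow> (('a \<times> 'a) set \<times> ('a \<times> 'a) set) set set" where
  "local_span N = {y \<in> carrier T.L. \<exists>s\<in>carrier R - P. \<exists>x\<in>N. \<tau> (l s) \<otimes>\<^sub>T y = \<kappa> x}"

text \<open>A \<open>q\<close>-inverse linear map extends by \<open>\<psi>(x / s\<^sup>q) = \<psi>(x) / s\<close>.\<close>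

lemma localize_map:
  assumes q: "0 < (q::nat)" and N: "N \<subseteq> carrier K.L"
    and N_add: "\<And>x y. \<lbrakk>x \<in> N; y \<in> N\<rbrakk> \<Longrightarrow> x \<oplus>\<^sub>K y \<in> N"
    and N_mult: "\<And>r x. \<lbrakk>r \<in> carrier R; x \<in> N\<rbrakk> \<Longrightarrow> k r \<otimes>\<^sub>K x \<in> N"
    and \<psi>: "\<And>x. x \<in> N \<Longrightarrow> \<psi> x \<in> carrier R"
    and \<psi>_add: "\<And>x y. \<lbrakk>x \<in> N; y \<in> N\<rbrakk> \<Longrightarrow> \<psi> (x \<oplus>\<^sub>K y) = \<psi> x \<oplus> \<psi> y"
    and \<psi>_mult: "\<And>r x. \<lbrakk>r \<in> carrier R; x \<in> N\<rbrakk> \<Longrightarrow> \<psi> (k (r [^] q) \<otimes>\<^sub>K x) = r \<otimes> \<psi> x"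
  obtains \<Psi> where "\<And>y. y \<in> local_span N \<Longrightarrow> \<Psi> y \<in> carrier loc.L"
    and "\<And>y z. \<lbrakk>y \<in> local_span N; z \<in> local_span N\<rbrakk> \<Longrightarrow> \<Psi> (y \<oplus>\<^sub>T z) = \<Psi> y \<oplus>\<^sub>L \<Psi> z"
    and "\<And>r y. \<lbrakk>r \<in> carrier loc.L; y \<in> local_span N\<rbrakk> \<Longrightarrow>
      \<Psi> (\<tau> (r [^]\<^bsub>loc.L\<^esub> q) \<otimes>\<^sub>T y) = r \<otimes>\<^sub>L \<Psi> y"
    and "\<And>x. x \<in> N \<Longrightarrow> \<Psi> (\<kappa> x) = l (\<psi> x)"
proof -
  \<comment> \<open>\<open>w\<close> is the value at \<open>y\<close> computed from some representation \<open>y = x / s\<^sup>q\<close>.\<close>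
  define rel where "rel y w \<longleftrightarrow> (\<exists>s\<in>carrier R - P. \<exists>x\<in>N.
    \<tau> (l (s [^] q)) \<otimes>\<^sub>T y = \<kappa> x \<and> w = loc.fr (\<psi> x) s)" for y w
  have Nc: "x \<in> carrier K.L" if "x \<in> N" for x using that N by blast
  have Spow: "s [^] (n::nat) \<in> carrier R - P" if "s \<in> carrier R - P" for s n
    using that loc.S_one loc.S_mult by (induction n) auto
  have \<kappa>k: "\<kappa> (k r \<otimes>\<^sub>K x) = \<tau> (l r) \<otimes>\<^sub>T \<kappa> x" if "r \<in> carrier R" "x \<in> N" for r x
    using that Nc by (simp add: \<kappa>_mult \<kappa>_to_fractions)
  have \<tau>lm: "\<tau> (l (a \<otimes> b)) = \<tau> (l a) \<otimes>\<^sub>T \<tau> (l b)" if "a \<in> carrier R" "b \<in> carrier R" for a b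
    using that by (simp add: l_mult \<tau>_mult)
  have ex: "\<exists>w. rel y w" if y: "y \<in> local_span N" for y
  proof -
    obtain s x where s: "s \<in> carrier R - P" and x: "x \<in> N"
      and eq: "\<tau> (l s) \<otimes>\<^sub>T y = \<kappa> x" and yc: "y \<in> carrier T.L" using y unfolding local_span_def by blast
    have sc: "s \<in> carrier R" using s by blast
    have "s [^] q = s [^] (q - 1) \<otimes> s" using q sc nat_pow_Suc[of s "q - 1"] by simp
    then have "\<tau> (l (s [^] q)) \<otimes>\<^sub>T y = \<tau> (l (s [^] (q - 1))) \<otimes>\<^sub>T (\<tau> (l s) \<otimes>\<^sub>T y)"
      using sc yc by (simp add: \<tau>lm T.L.m_assoc)
    also have "\<dots> = \<kappa> (k (s [^] (q - 1)) \<otimes>\<^sub>K x)" unfolding eq using \<kappa>k sc x by simp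
    finally show ?thesis using s N_mult[of "s [^] (q - 1)" x] sc x unfolding rel_def by fastforce
  qed
  have uniq: "w = w'" if yc: "y \<in> carrier T.L" and w: "rel y w" and w': "rel y w'" for y w w'
  proof -
    obtain s x t x' where s: "s \<in> carrier R - P" and x: "x \<in> N"
      and eq: "\<tau> (l (s [^] q)) \<otimes>\<^sub>T y = \<kappa> x" and ww: "w = loc.fr (\<psi> x) s"
      and t: "t \<in> carrier R - P" and x': "x' \<in> N"
      and eq': "\<tau> (l (t [^] q)) \<otimes>\<^sub>T y = \<kappa> x'" and ww': "w' = loc.fr (\<psi> x') t"
      using w w' unfolding rel_def by blast
    have sc: "s \<in> carrier R" and tc: "t \<in> carrier R" using s t by auto
    have "\<kappa> (k (t [^] q) \<otimes>\<^sub>K x) = \<tau> (l (t [^] q)) \<otimes>\<^sub>T (\<tau> (l (s [^] q)) \<otimes>\<^sub>T y)"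
      unfolding eq using \<kappa>k tc x by simp
    also have "\<dots> = \<tau> (l (s [^] q)) \<otimes>\<^sub>T (\<tau> (l (t [^] q)) \<otimes>\<^sub>T y)"
      using sc tc yc by (simp add: T.L.m_lcomm)
    also have "\<dots> = \<kappa> (k (s [^] q) \<otimes>\<^sub>K x')" unfolding eq' using \<kappa>k sc x' by simp
    finally obtain u where u: "u \<in> carrier R - P"
      and equ: "k u \<otimes>\<^sub>K (k (t [^] q) \<otimes>\<^sub>K x) = k u \<otimes>\<^sub>K (k (s [^] q) \<otimes>\<^sub>K x')"
      using \<kappa>_eq[of "k (t [^] q) \<otimes>\<^sub>K x" "k (s [^] q) \<otimes>\<^sub>K x'"] Nc[OF x] Nc[OF x'] sc tc by auto
    have uc: "u \<in> carrier R" using u by blast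
    have pw: "k ((u \<otimes> v) [^] q) \<otimes>\<^sub>K z = k (u [^] (q - 1)) \<otimes>\<^sub>K (k u \<otimes>\<^sub>K (k (v [^] q) \<otimes>\<^sub>K z))"
      if "v \<in> carrier R" "z \<in> N" for v z
    proof -
      have "(u \<otimes> v) [^] q = u [^] (q - 1) \<otimes> u \<otimes> v [^] q"
        using q uc that nat_pow_Suc[of u "q - 1"] by (simp add: nat_pow_distrib)
      then show ?thesis using that uc Nc by (simp add: k_mult K.L.m_assoc)
    qed
    have "\<psi> (k ((u \<otimes> t) [^] q) \<otimes>\<^sub>K x) = \<psi> (k ((u \<otimes> s) [^] q) \<otimes>\<^sub>K x')"
      unfolding pw[OF tc x] pw[OF sc x'] equ ..
    then have "u \<otimes> t \<otimes> \<psi> x = u \<otimes> s \<otimes> \<psi> x'" using \<psi>_mult uc sc tc x x' by simp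
    then have "u \<otimes> (\<psi> x \<otimes> t) = u \<otimes> (\<psi> x' \<otimes> s)" using uc sc tc \<psi> x x' by (simp add: m_ac)
    then show ?thesis unfolding ww ww' using loc.fraction_eq_iff[OF \<psi>[OF x] \<psi>[OF x'] s t] u by blast
  qed
  define \<Psi> where "\<Psi> y = (SOME w. rel y w)" for y
  have \<Psi>_rel: "rel y (\<Psi> y)" if "y \<in> local_span N" for y
    unfolding \<Psi>_def using ex[OF that] by (rule someI_ex)
  have \<Psi>_eq: "\<Psi> y = w" if "y \<in> carrier T.L" "rel y w" for y w
    unfolding \<Psi>_def using that uniq by (intro some_equality) auto
  have span_c: "y \<in> carrier T.L" if "y \<in> local_span N" for y using that unfolding local_span_def by blast
  have 1: "\<Psi> y \<in> carrier loc.L" if y: "y \<in> local_span N" for y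
    using \<Psi>_rel[OF y] \<psi> loc.fraction_carrier unfolding rel_def by metis
  have 2: "\<Psi> (y \<oplus>\<^sub>T z) = \<Psi> y \<oplus>\<^sub>L \<Psi> z" if y: "y \<in> local_span N" and z: "z \<in> local_span N" for y z
  proof (rule \<Psi>_eq)
    have yc: "y \<in> carrier T.L" and zc: "z \<in> carrier T.L" using span_c y z by auto
    then show "y \<oplus>\<^sub>T z \<in> carrier T.L" by simp
    obtain s x where s: "s \<in> carrier R - P" and x: "x \<in> N"
      and eq: "\<tau> (l (s [^] q)) \<otimes>\<^sub>T y = \<kappa> x" and yy: "\<Psi> y = loc.fr (\<psi> x) s"
      using \<Psi>_rel[OF y] unfolding rel_def by blast
    obtain t x' where t: "t \<in> carrier R - P" and x': "x' \<in> N"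
      and eq': "\<tau> (l (t [^] q)) \<otimes>\<^sub>T z = \<kappa> x'" and zz: "\<Psi> z = loc.fr (\<psi> x') t"
      using \<Psi>_rel[OF z] unfolding rel_def by blast
    have sc: "s \<in> carrier R" and tc: "t \<in> carrier R" using s t by auto
    let ?x = "k (t [^] q) \<otimes>\<^sub>K x \<oplus>\<^sub>K k (s [^] q) \<otimes>\<^sub>K x'"
    have in1: "k (t [^] q) \<otimes>\<^sub>K x \<in> N" "k (s [^] q) \<otimes>\<^sub>K x' \<in> N" using N_mult sc tc x x' by auto
    have xN: "?x \<in> N" using N_add in1 by blast
    have "\<tau> (l ((s \<otimes> t) [^] q)) \<otimes>\<^sub>T (y \<oplus>\<^sub>T z) =
        \<tau> (l (t [^] q)) \<otimes>\<^sub>T (\<tau> (l (s [^] q)) \<otimes>\<^sub>T y) \<oplus>\<^sub>T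
        \<tau> (l (s [^] q)) \<otimes>\<^sub>T (\<tau> (l (t [^] q)) \<otimes>\<^sub>T z)"
      using sc tc yc zc by (simp add: nat_pow_distrib \<tau>lm T.L.r_distr T.L.m_ac)
    also have "\<dots> = \<kappa> ?x"
      unfolding eq eq' using \<kappa>_add[OF Nc[OF in1(1)] Nc[OF in1(2)]] \<kappa>k sc tc x x' by simp
    finally have e: "\<tau> (l ((s \<otimes> t) [^] q)) \<otimes>\<^sub>T (y \<oplus>\<^sub>T z) = \<kappa> ?x" .
    have "\<psi> ?x = t \<otimes> \<psi> x \<oplus> s \<otimes> \<psi> x'" using \<psi>_add in1 \<psi>_mult sc tc x x' by simp
    then have "\<Psi> y \<oplus>\<^sub>L \<Psi> z = loc.fr (\<psi> ?x) (s \<otimes> t)"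
      unfolding yy zz using loc.fraction_add[OF \<psi>[OF x] \<psi>[OF x'] s t] \<psi> x x' sc tc by (simp add: m_comm)
    then show "rel (y \<oplus>\<^sub>T z) (\<Psi> y \<oplus>\<^sub>L \<Psi> z)"
      unfolding rel_def using loc.S_mult[OF s t] xN e by blast
  qed
  have 3: "\<Psi> (\<tau> (r [^]\<^bsub>loc.L\<^esub> q) \<otimes>\<^sub>T y) = r \<otimes>\<^sub>L \<Psi> y"
    if r: "r \<in> carrier loc.L" and y: "y \<in> local_span N" for r y
  proof (rule \<Psi>_eq)
    have yc: "y \<in> carrier T.L" using span_c y by auto
    have rq: "\<tau> (r [^]\<^bsub>loc.L\<^esub> q) \<in> carrier T.L" using r by simp
    then show "\<tau> (r [^]\<^bsub>loc.L\<^esub> q) \<otimes>\<^sub>T y \<in> carrier T.L" using yc by simp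
    obtain s x where s: "s \<in> carrier R - P" and x: "x \<in> N"
      and eq: "\<tau> (l (s [^] q)) \<otimes>\<^sub>T y = \<kappa> x" and yy: "\<Psi> y = loc.fr (\<psi> x) s"
      using \<Psi>_rel[OF y] unfolding rel_def by blast
    obtain a t where a: "a \<in> carrier R" and t: "t \<in> carrier R - P" and ra: "r = loc.fr a t"
      using r unfolding loc.carrier_L by blast
    have sc: "s \<in> carrier R" and tc: "t \<in> carrier R" using s t by auto
    have "l t \<otimes>\<^sub>L r = l a"
      unfolding ra to_local_at_def using a t by (rule loc.fraction_times_denominator)
    then have "l (t [^] q) \<otimes>\<^sub>L r [^]\<^bsub>loc.L\<^esub> q = l (a [^] q)"
      using a tc r loc.L.nat_pow_distrib[of "l t" r q] by (simp add: l_power)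
    then have tr: "\<tau> (l (t [^] q)) \<otimes>\<^sub>T \<tau> (r [^]\<^bsub>loc.L\<^esub> q) = \<tau> (l (a [^] q))"
      using tc r \<tau>_mult[of "l (t [^] q)" "r [^]\<^bsub>loc.L\<^esub> q"] by simp
    have "\<tau> (l ((t \<otimes> s) [^] q)) \<otimes>\<^sub>T (\<tau> (r [^]\<^bsub>loc.L\<^esub> q) \<otimes>\<^sub>T y) =
        (\<tau> (l (t [^] q)) \<otimes>\<^sub>T \<tau> (r [^]\<^bsub>loc.L\<^esub> q)) \<otimes>\<^sub>T (\<tau> (l (s [^] q)) \<otimes>\<^sub>T y)"
      using sc tc rq yc by (simp add: nat_pow_distrib \<tau>lm T.L.m_ac)
    also have "\<dots> = \<kappa> (k (a [^] q) \<otimes>\<^sub>K x)" unfolding tr eq using \<kappa>k a x by simp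
    finally have e: "\<tau> (l ((t \<otimes> s) [^] q)) \<otimes>\<^sub>T (\<tau> (r [^]\<^bsub>loc.L\<^esub> q) \<otimes>\<^sub>T y) =
      \<kappa> (k (a [^] q) \<otimes>\<^sub>K x)" .
    have "r \<otimes>\<^sub>L \<Psi> y = loc.fr (\<psi> (k (a [^] q) \<otimes>\<^sub>K x)) (t \<otimes> s)"
      unfolding ra yy using loc.fraction_mult[OF a \<psi>[OF x] t s] \<psi>_mult[OF a x] by simp
    moreover have "k (a [^] q) \<otimes>\<^sub>K x \<in> N" using N_mult a x by simp
    ultimately show "rel (\<tau> (r [^]\<^bsub>loc.L\<^esub> q) \<otimes>\<^sub>T y) (r \<otimes>\<^sub>L \<Psi> y)"
      unfolding rel_def using loc.S_mult[OF t s] e by blast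
  qed
  have 4: "\<Psi> (\<kappa> x) = l (\<psi> x)" if x: "x \<in> N" for x
  proof (rule \<Psi>_eq)
    show "\<kappa> x \<in> carrier T.L" using Nc[OF x] by simp
    have "\<tau> (l (\<one> [^] q)) \<otimes>\<^sub>T \<kappa> x = \<kappa> x" using Nc[OF x] by (simp add: l_one \<tau>_one)
    then show "rel (\<kappa> x) (l (\<psi> x))" unfolding rel_def l_fr using loc.S_one x by blast
  qed
  show thesis by (rule that[OF 1 2 3 4])
qed

end

section \<open>Divisors on a localization\<close>

context prime_localization
begin

lemma fr_eq_domain:
  assumes "domain R" "a \<in> carrier R" "b \<in> carrier R" "s \<in> carrier R - P" "t \<in> carrier R - P"
  shows "loc.fr a s = loc.fr b t \<longleftrightarrow> a \<otimes> t = b \<otimes> s"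
proof
  interpret domain R by (rule assms(1))
  assume "loc.fr a s = loc.fr b t"
  then obtain u where u: "u \<in> carrier R - P" "u \<otimes> (a \<otimes> t) = u \<otimes> (b \<otimes> s)"
    using loc.fraction_eq_iff[OF assms(2-5)] by blast
  then have "u \<noteq> \<zero>" using zero_closed by auto
  then show "a \<otimes> t = b \<otimes> s" using cancel_left[OF u(2)] u(1) assms by blast
next
  assume "a \<otimes> t = b \<otimes> s"
  then show "loc.fr a s = loc.fr b t" using assms by (intro loc.fraction_eqI)
qed

lemma fr_zero_domain:
  assumes "domain R" "a \<in> carrier R" "s \<in> carrier R - P"
  shows "loc.fr a s = \<zero>\<^sub>L \<longleftrightarrow> a = \<zero>"
proof -
  have "s \<in> carrier R" "\<one> \<in> carrier R" using assms by auto
  then show ?thesis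
    unfolding loc.zero_L using fr_eq_domain[OF assms(1,2) _ assms(3) loc.S_one, of \<zero>] assms by simp
qed

lemma domain_local:
  assumes "domain R"
  shows "domain loc.L"
proof -
  interpret domain R by (rule assms)
  show ?thesis
  proof (rule domain.intro[OF loc.cring_L], unfold_locales)
    show "\<one>\<^sub>L \<noteq> \<zero>\<^sub>L"
      unfolding loc.one_L using fr_zero_domain[OF assms one_closed loc.S_one] one_not_zero by simp
    fix x y assume xy: "x \<otimes>\<^sub>L y = \<zero>\<^sub>L" "x \<in> carrier loc.L" "y \<in> carrier loc.L"
    obtain a s where a: "a \<in> carrier R" "s \<in> carrier R - P" "x = loc.fr a s"
      using xy unfolding loc.carrier_L by blast
    obtain b t where b: "b \<in> carrier R" "t \<in> carrier R - P" "y = loc.fr b t"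
      using xy unfolding loc.carrier_L by blast
    have "loc.fr (a \<otimes> b) (s \<otimes> t) = \<zero>\<^sub>L" using xy(1) a b by (simp add: loc.fraction_mult)
    then have "a \<otimes> b = \<zero>"
      using fr_zero_domain[OF assms _ loc.S_mult[OF a(2) b(2)], of "a \<otimes> b"] a(1) b(1) by simp
    then have "a = \<zero> \<or> b = \<zero>" using integral a b by blast
    then show "x = \<zero>\<^sub>L \<or> y = \<zero>\<^sub>L" using a b loc.fraction_zero by auto
  qed
qed

text \<open>The ideal \<open>Q R\<^sub>P\<close>; it is a proper ideal when \<open>Q \<subseteq> P\<close>.\<close>

definition ext :: "'a set \<Rightarrow> ('a \<times> 'a) set set" where
  "ext Q = {loc.fr a s | a s. a \<in> Q \<and> s \<in> carrier R - P}"

lemma fr_mem_ext_iff: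
  assumes Q: "primeideal Q R" "Q \<subseteq> P" and a: "a \<in> carrier R" and s: "s \<in> carrier R - P"
  shows "loc.fr a s \<in> ext Q \<longleftrightarrow> a \<in> Q"
proof
  interpret Q: primeideal Q R by (rule Q)
  assume "loc.fr a s \<in> ext Q"
  then obtain b t where b: "b \<in> Q" and t: "t \<in> carrier R - P" and eq: "loc.fr a s = loc.fr b t"
    unfolding ext_def by blast
  have bc: "b \<in> carrier R" using b Q.Icarr by blast
  obtain u where u: "u \<in> carrier R - P" "u \<otimes> (a \<otimes> t) = u \<otimes> (b \<otimes> s)"
    using eq loc.fraction_eq_iff[OF a bc s t] by blast
  have "u \<otimes> (b \<otimes> s) \<in> Q" using Q.I_l_closed Q.I_r_closed b u(1) s by auto
  then have "u \<otimes> (a \<otimes> t) \<in> Q" using u(2) by simp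
  then have "a \<otimes> t \<in> Q" using Q.I_prime[of u "a \<otimes> t"] u(1) a t Q(2) by auto
  then show "a \<in> Q" using Q.I_prime[of a t] a t Q(2) by auto
next
  assume "a \<in> Q"
  then show "loc.fr a s \<in> ext Q" using s unfolding ext_def by blast
qed

lemma contraction_ext:
  assumes Q: "primeideal Q R" "Q \<subseteq> P"
  shows "{a \<in> carrier R. l a \<in> ext Q} = Q"
proof -
  interpret Q: primeideal Q R by (rule Q)
  show ?thesis using fr_mem_ext_iff[OF Q _ loc.S_one] Q.Icarr unfolding l_fr by blast
qed

lemma ext_prime:
  assumes Q: "primeideal Q R" "Q \<subseteq> P"
  shows "primeideal (ext Q) loc.L"
proof -
  interpret Q: primeideal Q R by (rule Q)
  show ?thesis
  proof (rule primeidealI)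
    have m: "x \<otimes>\<^sub>L y \<in> ext Q" if x: "x \<in> carrier loc.L" and y: "y \<in> ext Q" for x y
    proof -
      obtain a s where a: "a \<in> carrier R" "s \<in> carrier R - P" "x = loc.fr a s"
        using x unfolding loc.carrier_L by blast
      obtain b t where b: "b \<in> Q" "t \<in> carrier R - P" "y = loc.fr b t"
        using y unfolding ext_def by blast
      have "x \<otimes>\<^sub>L y = loc.fr (a \<otimes> b) (s \<otimes> t)"
        using a b Q.Icarr by (simp add: loc.fraction_mult)
      moreover have "a \<otimes> b \<in> Q" using Q.I_l_closed[OF b(1) a(1)] .
      ultimately show ?thesis using loc.S_mult[OF a(2) b(2)] unfolding ext_def by blast
    qed
    have sub: "ext Q \<subseteq> carrier loc.L" unfolding ext_def using Q.Icarr loc.fraction_carrier by blast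
    show "ideal (ext Q) loc.L"
    proof (rule loc.L.ideal_by_closure[OF sub _ _ m])
      show "\<zero>\<^sub>L \<in> ext Q"
        unfolding loc.zero_L ext_def using Q.zero_closed loc.S_one by blast
      fix x y assume x: "x \<in> ext Q" and y: "y \<in> ext Q"
      obtain a s where a: "a \<in> Q" "s \<in> carrier R - P" "x = loc.fr a s"
        using x unfolding ext_def by blast
      obtain b t where b: "b \<in> Q" "t \<in> carrier R - P" "y = loc.fr b t"
        using y unfolding ext_def by blast
      have "x \<oplus>\<^sub>L y = loc.fr (a \<otimes> t \<oplus> b \<otimes> s) (s \<otimes> t)"
        using a b Q.Icarr by (simp add: loc.fraction_add)
      moreover have "a \<otimes> t \<oplus> b \<otimes> s \<in> Q"
        using a b by (intro Q.a_closed Q.I_r_closed) auto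
      ultimately show "x \<oplus>\<^sub>L y \<in> ext Q"
        using loc.S_mult[OF a(2) b(2)] unfolding ext_def by blast
    qed
    have "\<one> \<notin> Q" using Q(2) loc.S_one by blast
    then have "\<one>\<^sub>L \<notin> ext Q" unfolding loc.one_L using fr_mem_ext_iff[OF Q one_closed loc.S_one] by simp
    then show "carrier loc.L \<noteq> ext Q" using loc.L.one_closed by blast
    fix x y assume x: "x \<in> carrier loc.L" and y: "y \<in> carrier loc.L" and xy: "x \<otimes>\<^sub>L y \<in> ext Q"
    obtain a s where a: "a \<in> carrier R" "s \<in> carrier R - P" "x = loc.fr a s"
      using x unfolding loc.carrier_L by blast
    obtain b t where b: "b \<in> carrier R" "t \<in> carrier R - P" "y = loc.fr b t"
      using y unfolding loc.carrier_L by blast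
    have "loc.fr (a \<otimes> b) (s \<otimes> t) \<in> ext Q"
      using xy loc.fraction_mult[OF a(1) b(1) a(2) b(2)] unfolding a(3) b(3) by simp
    then have "a \<otimes> b \<in> Q"
      using fr_mem_ext_iff[OF Q m_closed[OF a(1) b(1)] loc.S_mult[OF a(2) b(2)]] by blast
    then have "a \<in> Q \<or> b \<in> Q" using Q.I_prime a b by blast
    then show "x \<in> ext Q \<or> y \<in> ext Q"
      using fr_mem_ext_iff[OF Q] a b by blast
  qed (rule loc.cring_L)
qed

lemma contraction_prime:
  assumes "primeideal Q' loc.L"
  shows "primeideal {a \<in> carrier R. l a \<in> Q'} R"
proof -
  interpret Q': primeideal Q' loc.L by (rule assms)
  show ?thesis
  proof (rule primeidealI)
    have "l \<zero> \<in> Q'" using Q'.zero_closed by (simp add: l_fr loc.zero_L)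
    then show "ideal {a \<in> carrier R. l a \<in> Q'} R"
      using Q'.a_closed Q'.I_l_closed by (intro ideal_by_closure) (auto simp: l_add l_mult)
    have "\<one>\<^sub>L \<notin> Q'" using Q'.I_notcarr Q'.one_imp_carrier by blast
    then show "carrier R \<noteq> {a \<in> carrier R. l a \<in> Q'}" using l_one by (metis (mono_tags, lifting) mem_Collect_eq one_closed)
    show "a \<in> {a \<in> carrier R. l a \<in> Q'} \<or> b \<in> {a \<in> carrier R. l a \<in> Q'}"
      if "a \<in> carrier R" "b \<in> carrier R" "a \<otimes> b \<in> {a \<in> carrier R. l a \<in> Q'}" for a b
      using that Q'.I_prime[of "l a" "l b"] by (simp add: l_mult)
  qed (rule is_cring)
qed

lemma contraction_strict_mono:
  assumes "primeideal Q1 loc.L" "primeideal Q2 loc.L" "Q1 \<subset> Q2"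
  shows "{a \<in> carrier R. l a \<in> Q1} \<subset> {a \<in> carrier R. l a \<in> Q2}"
proof -
  interpret Q1: primeideal Q1 loc.L by (rule assms)
  interpret Q2: primeideal Q2 loc.L by (rule assms)
  obtain x where x: "x \<in> Q2" "x \<notin> Q1" using assms(3) by blast
  have "x \<in> carrier loc.L" using x Q2.Icarr by blast
  then obtain a s where a: "a \<in> carrier R" "s \<in> carrier R - P" "x = loc.fr a s"
    unfolding loc.carrier_L by blast
  have sx: "l s \<otimes>\<^sub>L x = l a"
    unfolding a(3) to_local_at_def using a(1,2) by (rule loc.fraction_times_denominator)
  have fa: "x = loc.fr \<one> s \<otimes>\<^sub>L l a"
    unfolding a(3) l_fr using a(1,2) loc.S_one by (simp add: loc.fraction_mult)
  have "l a \<in> Q2" using Q2.I_l_closed[OF x(1), of "l s"] a(2) sx by simp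
  moreover have "l a \<notin> Q1"
  proof
    assume "l a \<in> Q1"
    then have "x \<in> Q1" unfolding fa using Q1.I_l_closed a(2) by simp
    then show False using x(2) by contradiction
  qed
  ultimately show ?thesis using a(1) assms(3) by blast
qed

text \<open>A chain of primes below \<open>Q R\<^sub>P\<close> contracts to a chain below \<open>Q\<close>, and contraction from \<open>R\<^sub>P\<close> preserves
  strict inclusions.\<close>

lemma ext_height_one:
  assumes R: "domain R" and Q: "height_one_prime R Q" "Q \<subseteq> P"
  shows "height_one_prime loc.L (ext Q)"
proof -
  interpret domain R by (rule R)
  interpret L': domain loc.L by (rule domain_local[OF R])
  have Qp: "primeideal Q R" using Q(1) by (simp add: height_one_prime_def)
  interpret Q: primeideal Q R by (rule Qp)
  obtain b where b: "b \<in> Q" "b \<noteq> \<zero>" using height_one_nonzero[OF Q(1)] by blast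
  have bc: "b \<in> carrier R" using b Q.Icarr by blast
  have "l b \<in> ext Q" unfolding l_fr using fr_mem_ext_iff[OF Qp Q(2) bc loc.S_one] b by simp
  moreover have "l b \<noteq> \<zero>\<^sub>L" unfolding l_fr using fr_zero_domain[OF R bc loc.S_one] b by simp
  moreover have "\<zero>\<^sub>L \<in> ext Q" unfolding loc.zero_L ext_def using Q.zero_closed loc.S_one by blast
  ultimately have "{\<zero>\<^sub>L} \<subset> ext Q" by blast
  then have 1: "\<exists>M. primeideal M loc.L \<and> M \<subset> ext Q" using L'.zeroprimeideal by blast
  have 2: False if "primeideal Q1 loc.L" "primeideal Q2 loc.L" "Q1 \<subset> Q2" "Q2 \<subset> ext Q" for Q1 Q2
  proof -
    have "{a \<in> carrier R. l a \<in> Q2} \<subset> Q"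
      using contraction_strict_mono[OF that(2) ext_prime[OF Qp Q(2)] that(4)]
      unfolding contraction_ext[OF Qp Q(2)] .
    moreover have "{a \<in> carrier R. l a \<in> Q1} \<subset> {a \<in> carrier R. l a \<in> Q2}"
      by (rule contraction_strict_mono[OF that(1-3)])
    ultimately show False
      using Q(1) contraction_prime[OF that(1)] contraction_prime[OF that(2)]
      unfolding height_one_prime_def by blast
  qed
  show ?thesis
    unfolding height_one_prime_def using ext_prime[OF Qp Q(2)] 1 2 by blast
qed

text \<open>A factorization \<open>ra = t\<^sup>n u\<close> in \<open>R\<close> remains one in \<open>R\<^sub>P\<close>, and \<open>s \<notin> P\<close> is a unit for \<open>Q\<close>: the same
  uniformizer works and orders do not change.\<close>

lemma ext_uniformizer:
  assumes t: "uniformized_prime R Q t" and QP: "Q \<subseteq> P"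
  shows "uniformized_prime loc.L (ext Q) (l t)"
    and "\<And>a. \<lbrakk>a \<in> carrier R; a \<noteq> \<zero>\<rbrakk> \<Longrightarrow> order_at loc.L (ext Q) (l a) = order_at R Q a"
proof -
  interpret Q: uniformized_prime R Q t by (rule t)
  have Qp: "primeideal Q R" by (rule Q.Q.primeideal_axioms)
  interpret E: primeideal "ext Q" loc.L by (rule ext_prime[OF Qp QP])
  have out: "l u \<in> carrier loc.L - ext Q" if "u \<in> carrier R - Q" for u
    using that fr_mem_ext_iff[OF Qp QP _ loc.S_one] unfolding l_fr using loc.S_one by auto
  show u: "uniformized_prime loc.L (ext Q) (l t)"
  proof (intro uniformized_prime.intro uniformized_prime_axioms.intro)
    show "domain loc.L" using Q.domain_axioms by (rule domain_local)
    show "primeideal (ext Q) loc.L" by (rule E.primeideal_axioms)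
    show "l t \<in> ext Q" unfolding l_fr using fr_mem_ext_iff[OF Qp QP _ loc.S_one] Q.t_in by simp
    show "l t \<noteq> \<zero>\<^sub>L"
      unfolding l_fr using fr_zero_domain[OF Q.domain_axioms _ loc.S_one] Q.t_nonzero by simp
    fix x assume x: "x \<in> carrier loc.L" "x \<noteq> \<zero>\<^sub>L"
    obtain a s where a: "a \<in> carrier R" "s \<in> carrier R - P" "x = loc.fr a s"
      using x unfolding loc.carrier_L by blast
    have "a \<noteq> \<zero>" using x(2) a loc.fraction_zero by auto
    then obtain n :: nat and r u where r: "r \<in> carrier R - Q" and u: "u \<in> carrier R - Q"
      and eq: "r \<otimes> a = t [^] n \<otimes> u" using Q.factorization[OF a(1)] by blast
    have sQ: "s \<in> carrier R - Q" using a(2) QP by blast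
    have rc: "r \<in> carrier R" "s \<in> carrier R" "u \<in> carrier R" using r sQ u by auto
    have "l (s \<otimes> r) \<otimes>\<^sub>L x = l r \<otimes>\<^sub>L (l s \<otimes>\<^sub>L x)"
      using rc x(1) by (simp add: l_mult loc.L.m_ac)
    also have "l s \<otimes>\<^sub>L x = l a"
      unfolding a(3) to_local_at_def using a(1,2) by (rule loc.fraction_times_denominator)
    also have "l r \<otimes>\<^sub>L l a = l (t [^] n \<otimes> u)" using l_mult[OF rc(1) a(1)] eq by simp
    also have "\<dots> = l t [^]\<^bsub>loc.L\<^esub> n \<otimes>\<^sub>L l u" using rc by (simp add: l_mult l_power)
    finally have e: "l (s \<otimes> r) \<otimes>\<^sub>L x = l t [^]\<^bsub>loc.L\<^esub> n \<otimes>\<^sub>L l u" .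
    show "\<exists>(n::nat) s u. s \<in> carrier loc.L - ext Q \<and> u \<in> carrier loc.L - ext Q \<and>
        s \<otimes>\<^sub>L x = l t [^]\<^bsub>loc.L\<^esub> n \<otimes>\<^sub>L u"
      using e out[OF Q.loc.S_mult[OF sQ r]] out[OF u] by blast
  qed
  fix a assume a: "a \<in> carrier R" "a \<noteq> \<zero>"
  obtain s u where s: "s \<in> carrier R - Q" and u': "u \<in> carrier R - Q"
    and eq: "s \<otimes> a = t [^] order_at R Q a \<otimes> u" using Q.order_at_factorization[OF a] by blast
  have sc: "s \<in> carrier R" "u \<in> carrier R" using s u' by auto
  have "l s \<otimes>\<^sub>L l a = l (t [^] order_at R Q a \<otimes> u)" using l_mult[OF sc(1) a(1)] eq by simp
  also have "\<dots> = l t [^]\<^bsub>loc.L\<^esub> order_at R Q a \<otimes>\<^sub>L l u" using sc by (simp add: l_mult l_power)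
  finally show "order_at loc.L (ext Q) (l a) = order_at R Q a"
    by (intro uniformized_prime.order_atI[OF u _ out[OF s] out[OF u']]) (use a in auto)
qed

end

text \<open>The divisor \<open>D'\<close> stands for the restriction of \<open>D\<close> to \<open>Spec R\<^sub>P\<close>.\<close>

locale divisor_localization = prime_localization P R + divisor_data R D
  for P :: "'a set" and R :: "('a, 'm) ring_scheme" (structure) and D :: "'a set \<Rightarrow> int" +
  fixes D' :: "('a \<times> 'a) set set \<Rightarrow> int"
  assumes D'_zero: "D = (\<lambda>_. 0) \<Longrightarrow> D' = (\<lambda>_. 0)"
    and D'_ext: "\<And>Q. \<lbrakk>height_one_prime R Q; Q \<subseteq> P; height_one_prime loc.L (ext Q)\<rbrakk> \<Longrightarrow> D' (ext Q) = D Q"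
begin

text \<open>Let \<open>y\<close> satisfy the valuation conditions at the height one primes inside \<open>P\<close>. The denominators
  \<open>r\<close> with \<open>ry \<in> R(D)\<close> form an ideal; if it were contained in \<open>P\<close>, a multiple of \<open>y\<close> outside
  \<open>R(D)\<close> would have a nonzero prime \<open>M \<subseteq> P\<close> as its ideal of denominators. A height one prime \<open>Q\<close> at
  which this multiple violates its condition contains \<open>M\<close>, so \<open>Q = M \<subseteq> P\<close>. But at such \<open>Q\<close> the
  condition holds for \<open>y\<close>, hence for all its multiples.\<close>

lemma local_divisor_module_subset:
  "carrier (divisor_module loc.L D') \<subseteq> local_span (carrier DM)"
proof
  fix y assume y: "y \<in> carrier (divisor_module loc.L D')"
  show "y \<in> local_span (carrier DM)"
  proof (cases "D' = (\<lambda>_. 0)")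
    case True
    then obtain z where z: "z \<in> carrier loc.L" and yz: "y = \<tau> z" using y by (auto simp: divisor_module_def)
    obtain a s where a: "a \<in> carrier R" and s: "s \<in> carrier R - P" and za: "z = loc.fr a s"
      using z unfolding loc.carrier_L by blast
    have "l s \<otimes>\<^sub>L z = l a"
      unfolding za to_local_at_def using a s by (rule loc.fraction_times_denominator)
    then have "\<tau> (l s) \<otimes>\<^sub>T y = \<kappa> (k a)"
      unfolding yz using \<tau>_mult[of "l s" z] s z a by (simp add: \<kappa>_to_fractions)
    then show ?thesis
      unfolding local_span_def using s to_fractions_mem_Mod[OF a] yz z by auto
  next
    case D'nz: False
    then have Dnz: "D \<noteq> (\<lambda>_. 0)" using D'_zero by blast
    have noeth: "noetherian_ring R" using normal_or_zero[OF Dnz] by blast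
    interpret domain R by (rule domain_if_nonzero[OF Dnz])
    interpret L': domain loc.L by (rule domain_local[OF domain_axioms])
    have yT: "y \<in> carrier T.L" and yval: "y = \<zero>\<^bsub>T.L\<^esub> \<or>
        (\<forall>Q. height_one_prime loc.L Q \<longrightarrow> valuation_at loc.L Q y + D' Q \<ge> 0)"
      using y D'nz by (auto simp: divisor_module_def total_fractions_def)
    obtain \<alpha> \<beta> where \<alpha>: "\<alpha> \<in> carrier R" and \<beta>: "\<beta> \<in> carrier R" "\<beta> \<noteq> \<zero>"
      and y\<alpha>\<beta>: "y = T.fr (l \<alpha>) (l \<beta>)"
    proof -
      obtain u v where u: "u \<in> carrier loc.L" and v: "v \<in> carrier loc.L" "v \<noteq> \<zero>\<^sub>L"
        and yuv: "y = T.fr u v"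
        using yT L'.nonzerodivisors_eq unfolding T.carrier_L by blast
      obtain a s where a: "a \<in> carrier R" "s \<in> carrier R - P" "u = loc.fr a s"
        using u unfolding loc.carrier_L by blast
      obtain b t where b: "b \<in> carrier R" "t \<in> carrier R - P" "v = loc.fr b t"
        using v unfolding loc.carrier_L by blast
      have sc: "s \<in> carrier R" "t \<in> carrier R" using a b by auto
      have nz: "b \<noteq> \<zero>" "s \<noteq> \<zero>" using v(2) b a loc.fraction_zero zero_closed by auto
      have bs: "b \<otimes> s \<noteq> \<zero>" using nz b sc by (simp add: integral_iff)
      have e1: "l s \<otimes>\<^sub>L u = l a"
        unfolding a(3) to_local_at_def using a(1,2) by (rule loc.fraction_times_denominator)
      have e2: "l t \<otimes>\<^sub>L v = l b"
        unfolding b(3) to_local_at_def using b(1,2) by (rule loc.fraction_times_denominator)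
      have "l b \<otimes>\<^sub>L l s \<otimes>\<^sub>L u = l a \<otimes>\<^sub>L l t \<otimes>\<^sub>L v"
        unfolding e1[symmetric] e2[symmetric] using sc u v by (simp add: loc.L.m_ac)
      then have e: "u \<otimes>\<^sub>L l (b \<otimes> s) = l (a \<otimes> t) \<otimes>\<^sub>L v"
        using sc a b u v by (simp add: l_mult loc.L.m_comm)
      have "l (b \<otimes> s) \<noteq> \<zero>\<^sub>L"
        unfolding l_fr using fr_zero_domain[OF domain_axioms _ loc.S_one] bs b sc by simp
      then have "T.fr u v = T.fr (l (a \<otimes> t)) (l (b \<otimes> s))"
        using e u v a b sc by (intro T.fraction_eqI) (auto simp: L'.nonzerodivisors_eq)
      then show thesis using that[of "a \<otimes> t" "b \<otimes> s"] a b sc bs yuv by simp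
    qed
    define x where "x = K.fr \<alpha> \<beta>"
    have \<beta>N: "\<beta> \<in> nonzerodivisors R" using \<beta> nonzerodivisors_eq by simp
    have xK: "x \<in> carrier K.L" using \<alpha> \<beta>N by (simp add: x_def)
    have y\<kappa>: "y = \<kappa> x" unfolding x_def y\<alpha>\<beta> using \<kappa>_fraction[OF \<alpha> \<beta>N] by simp
    show ?thesis
    proof (cases "\<alpha> = \<zero>")
      case True
      then have "x \<in> carrier DM" unfolding x_def using fraction_mem_Mod[OF Dnz \<alpha> \<beta>] by simp
      moreover have "\<tau> (l \<one>) \<otimes>\<^sub>T y = \<kappa> x" using yT by (simp add: l_one \<tau>_one y\<kappa>)
      ultimately show ?thesis unfolding local_span_def using yT loc.S_one by blast
    next
      case \<alpha>nz: False
      have kx: "k r \<otimes>\<^sub>K x = K.fr (r \<otimes> \<alpha>) \<beta>" if "r \<in> carrier R" for r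
        unfolding x_def using scale_fraction[OF that \<alpha> \<beta>N] .
      define J where "J = {r \<in> carrier R. k r \<otimes>\<^sub>K x \<in> carrier DM}"
      have Jmult: "r \<otimes> a \<in> J" if "r \<in> carrier R" "a \<in> J" for r a
        using that Mod_smult_closed[of r "k a \<otimes>\<^sub>K x"] xK
        by (auto simp: J_def k_mult K.L.m_assoc)
      have \<beta>J: "\<beta> \<in> J"
      proof -
        have "k \<beta> \<otimes>\<^sub>K x = k \<alpha>"
          unfolding x_def to_fractions_def using \<alpha> \<beta>N by (rule K.fraction_times_denominator)
        then show ?thesis using to_fractions_mem_Mod[OF \<alpha>] \<beta> by (simp add: J_def)
      qed
      have J: "ideal J R"
      proof (rule ideal_by_closure[OF _ _ _ Jmult])
        show "J \<subseteq> carrier R" by (auto simp: J_def)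
        show "\<zero> \<in> J" using Jmult[OF zero_closed \<beta>J] \<beta> by simp
        fix a b assume a: "a \<in> J" and b: "b \<in> J"
        have ab: "a \<in> carrier R" "b \<in> carrier R" using a b by (auto simp: J_def)
        have "k (a \<oplus> b) \<otimes>\<^sub>K x = k a \<otimes>\<^sub>K x \<oplus>\<^sub>K k b \<otimes>\<^sub>K x"
          using ring_hom_add[OF k_hom ab] ab xK by (simp add: K.L.l_distr)
        then show "a \<oplus> b \<in> J" using Mod_add_closed a b by (simp add: J_def)
      qed
      show ?thesis
      proof (cases "J \<subseteq> P")
        case False
        then obtain s where s: "s \<in> carrier R - P" "k s \<otimes>\<^sub>K x \<in> carrier DM"
          unfolding J_def by blast
        have "\<tau> (l s) \<otimes>\<^sub>T y = \<kappa> (k s \<otimes>\<^sub>K x)"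
          unfolding y\<kappa> using s(1) xK by (simp add: \<kappa>_mult \<kappa>_to_fractions)
        then show ?thesis unfolding local_span_def using yT s by blast
      next
        case True
        obtain r where r: "r \<in> carrier R" and M: "primeideal (colon R J {r}) R"
          and MP: "colon R J {r} \<subseteq> P"
          using exists_prime_colon[OF noeth J primeideal_axioms True] by blast
        have mem: "s \<in> colon R J {r} \<longleftrightarrow> s \<in> carrier R \<and> r \<otimes> s \<in> J" for s
          unfolding colon_def by blast
        have "r \<notin> J"
        proof
          assume "r \<in> J"
          then have "\<one> \<in> colon R J {r}" using r by (simp add: mem)
          then show False using MP loc.S_one by blast
        qed
        then have notin: "K.fr (r \<otimes> \<alpha>) \<beta> \<notin> carrier DM" using kx[OF r] r by (simp add: J_def)
        have r\<alpha>: "r \<otimes> \<alpha> \<in> carrier R" using r \<alpha> by simp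
        obtain Q where nz: "r \<otimes> \<alpha> \<noteq> \<zero>" and Q: "height_one_prime R Q"
          and neg: "int (order_at R Q (r \<otimes> \<alpha>)) - int (order_at R Q \<beta>) + D Q < 0"
          using notin unfolding fraction_mem_Mod[OF Dnz r\<alpha> \<beta>] by force
        obtain t where t: "uniformized_prime R Q t" using uniformizer[OF Dnz Q] by blast
        interpret Q: uniformized_prime R Q t by (rule t)
        have rnz: "r \<noteq> \<zero>" using nz \<alpha> by auto
        have "colon R J {r} \<subseteq> Q"
        proof
          fix s assume "s \<in> colon R J {r}"
          then have s: "s \<in> carrier R" "r \<otimes> s \<in> J" by (auto simp: mem)
          show "s \<in> Q"
          proof (cases "s = \<zero>")
            case True
            then show ?thesis using Q.Q.zero_closed by simp
          next
            case snz: False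
            have "K.fr (r \<otimes> s \<otimes> \<alpha>) \<beta> \<in> carrier DM" using s kx[of "r \<otimes> s"] r by (simp add: J_def)
            moreover have e: "r \<otimes> s \<otimes> \<alpha> = s \<otimes> (r \<otimes> \<alpha>)" using r s \<alpha> by (simp add: m_ac)
            moreover have "s \<otimes> (r \<otimes> \<alpha>) \<noteq> \<zero>" using snz nz s r\<alpha> integral by blast
            ultimately have "int (order_at R Q (s \<otimes> (r \<otimes> \<alpha>))) - int (order_at R Q \<beta>) + D Q \<ge> 0"
              using fraction_mem_Mod[OF Dnz _ \<beta>, of "s \<otimes> (r \<otimes> \<alpha>)"] s r\<alpha> Q by simp
            then have "order_at R Q s \<noteq> 0" using neg Q.order_at_mult[OF s(1) snz r\<alpha> nz] by linarith
            then show ?thesis using Q.order_at_zero_iff[OF s(1) snz] by simp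
          qed
        qed
        moreover have "colon R J {r} \<noteq> {\<zero>}"
        proof -
          have "\<beta> \<in> colon R J {r}" using Jmult[OF r \<beta>J] \<beta> by (simp add: mem)
          then show ?thesis using \<beta> by blast
        qed
        ultimately have "colon R J {r} = Q" using height_one_minimal[OF Q M] by blast
        then have QP: "Q \<subseteq> P" using MP by simp
        have hQ: "height_one_prime loc.L (ext Q)" by (rule ext_height_one[OF domain_axioms Q QP])
        note E = ext_uniformizer[OF t QP]
        have lnz: "l \<alpha> \<noteq> \<zero>\<^sub>L" "l \<beta> \<noteq> \<zero>\<^sub>L"
          unfolding l_fr using fr_zero_domain[OF domain_axioms _ loc.S_one] \<alpha> \<alpha>nz \<beta> by simp_all
        have "valuation_at loc.L (ext Q) y = int (order_at R Q \<alpha>) - int (order_at R Q \<beta>)"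
          unfolding y\<alpha>\<beta> using uniformized_prime.valuation_at_fraction[OF E(1) _ lnz(1) _ lnz(2)]
            E(2)[OF \<alpha> \<alpha>nz] E(2)[OF \<beta>] \<alpha> \<beta> by simp
        moreover have "y \<noteq> \<zero>\<^bsub>T.L\<^esub>"
        proof
          assume "y = \<zero>\<^bsub>T.L\<^esub>"
          then obtain u where "u \<in> nonzerodivisors loc.L" "u \<otimes>\<^sub>L l \<alpha> = \<zero>\<^sub>L"
            using T.fraction_eq_zero_iff[of "l \<alpha>" "l \<beta>"] \<alpha> \<beta> lnz y\<alpha>\<beta> L'.nonzerodivisors_eq by auto
          then show False using L'.integral[of u "l \<alpha>"] lnz \<alpha> L'.nonzerodivisors_eq by auto
        qed
        ultimately have "int (order_at R Q \<alpha>) - int (order_at R Q \<beta>) + D Q \<ge> 0"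
          using yval hQ D'_ext[OF Q QP hQ] by auto
        moreover have "order_at R Q (r \<otimes> \<alpha>) = order_at R Q r + order_at R Q \<alpha>"
          by (rule Q.order_at_mult[OF r rnz \<alpha> \<alpha>nz])
        ultimately show ?thesis using neg by linarith
      qed
    qed
  qed
qed

end

section \<open>Compatible ideals and centers\<close>

lemma round_up_mult_nonneg:
  assumes "effective_divisor R \<Delta>"
  shows "0 \<le> round_up_mult n \<Delta> Q"
proof -
  have "0 \<le> real n * \<Delta> Q" using assms by (simp add: effective_divisor_def)
  then show ?thesis unfolding round_up_mult_def by linarith
qed

lemma round_up_mult_zero:
  assumes eff: "effective_divisor R \<Delta>" and n: "0 < n" and z: "round_up_mult n \<Delta> = (\<lambda>_. 0)"
  shows "\<Delta> = (\<lambda>_. 0)"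
proof
  fix Q
  have "\<lceil>real n * \<Delta> Q\<rceil> = 0" using fun_cong[OF z, of Q] by (simp add: round_up_mult_def)
  then have "real n * \<Delta> Q \<le> 0" by linarith
  moreover have "0 \<le> \<Delta> Q" using eff by (simp add: effective_divisor_def)
  ultimately show "\<Delta> Q = 0" using n by (simp add: mult_le_0_iff)
qed

lemma power_minus_one_pos:
  assumes "Factorial_Ring.prime (p::nat)" "0 < e"
  shows "0 < p ^ e - 1" "2 \<le> p ^ e"
proof -
  have "2 \<le> p" using assms(1) by (rule prime_ge_2_nat)
  also have "p = p ^ 1" by simp
  also have "\<dots> \<le> p ^ e" using assms prime_gt_0_nat[OF assms(1)] by (intro power_increasing) auto
  finally show "2 \<le> p ^ e" .
  then show "0 < p ^ e - 1" by simp
qed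

lemma triple_divisor_data:
  assumes F: "F_finite_noetherian p R" and T: "is_triple R \<Delta> \<aa>"
  shows "divisor_data R (round_up_mult n \<Delta>)"
proof -
  have eff: "effective_divisor R \<Delta>" using T by (simp add: is_triple_def)
  show ?thesis
  proof (intro divisor_data.intro divisor_data_axioms.intro)
    show "cring R" using F by (simp add: F_finite_noetherian_def)
    show "0 \<le> round_up_mult n \<Delta> Q" for Q by (rule round_up_mult_nonneg[OF eff])
    assume "round_up_mult n \<Delta> \<noteq> (\<lambda>_. 0)"
    then have "\<Delta> \<noteq> (\<lambda>_. 0)" by (auto simp: round_up_mult_def)
    then show "normal_domain R \<and> noetherian_ring R"
      using F T by (simp add: is_triple_def F_finite_noetherian_def)
  qed
qed

lemma frobenius_divisor_module_simps:
  fixes R :: "('a, 'm) ring_scheme"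
  shows "carrier (frobenius_divisor_module p e R \<Delta>) = carrier (divisor_module R (round_up_mult (p ^ e - 1) \<Delta>))"
    and "x \<oplus>\<^bsub>frobenius_divisor_module p e R \<Delta>\<^esub> y = x \<oplus>\<^bsub>total_fractions R\<^esub> y"
    and "r \<odot>\<^bsub>frobenius_divisor_module p e R \<Delta>\<^esub> x = to_fractions R (r [^]\<^bsub>R\<^esub> (p ^ e)) \<otimes>\<^bsub>total_fractions R\<^esub> x"
  by (simp_all add: frobenius_divisor_module_def frobenius_push_def divisor_module_def)

lemma self_module_simps:
  "carrier (self_module R) = carrier R" "x \<oplus>\<^bsub>self_module R\<^esub> y = x \<oplus>\<^bsub>R\<^esub> y"
  "r \<odot>\<^bsub>self_module R\<^esub> x = r \<otimes>\<^bsub>R\<^esub> x"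
  by (simp_all add: self_module_def)

lemma graded_system_subset:
  assumes "is_triple R \<Delta> \<aa>" "a \<in> \<aa> i"
  shows "a \<in> carrier R"
proof -
  have "ideal (\<aa> i) R" using assms(1) by (simp add: is_triple_def graded_system_def)
  then show ?thesis using assms(2) by (rule ideal.Icarr)
qed

text \<open>A splitting \<open>\<psi>\<close> of \<open>1 \<mapsto> d\<close> restricts to the Frobenius splitting \<open>x \<mapsto> \<psi>(dx)\<close> of \<open>R\<close>, and
  compatible ideals are stable under it.\<close>

lemma finite_compatible_ideals:
  fixes R :: "('a, 'm) ring_scheme" (structure)
  assumes F: "F_finite_noetherian p R" and T: "is_triple R \<Delta> \<aa>" and S: "sharply_F_pure p R \<Delta> \<aa>"
  shows "finite {I. uniformly_F_compatible p R \<Delta> \<aa> I}"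
proof -
  obtain e d where e: "0 < e" and d: "d \<in> \<aa> (p ^ e - 1)"
    and sp: "splits_at R (frobenius_divisor_module p e R \<Delta>) (to_fractions R d)"
    using S unfolding sharply_F_pure_def by blast
  let ?M = "frobenius_divisor_module p e R \<Delta>" and ?q = "p ^ e"
  interpret divisor_data R "round_up_mult (p ^ e - 1) \<Delta>" by (rule triple_divisor_data[OF F T])
  have cr: "cring R" and noeth: "noetherian_ring R" and p: "Factorial_Ring.prime p"
    and char: "add_pow R p \<one> = \<zero>"
    and fg: "finitely_generated R (frobenius_push p 1 R (self_module R))"
    using F by (auto simp: F_finite_noetherian_def)
  obtain \<psi> where \<psi>: "\<psi> \<in> module_hom R ?M (self_module R)"
    and spl: "\<And>r. r \<in> carrier R \<Longrightarrow> \<psi> (r \<odot>\<^bsub>?M\<^esub> to_fractions R d) = r"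
    using sp unfolding splits_at_def by blast
  have dc: "d \<in> carrier R" by (rule graded_system_subset[OF T d])
  have k_hom: "to_fractions R \<in> ring_hom R K.L"
    unfolding to_fractions_def by (rule K.to_localization_hom)
  have inM: "to_fractions R r \<in> carrier ?M" if "r \<in> carrier R" for r
    unfolding frobenius_divisor_module_simps using that by (rule to_fractions_mem_Mod)
  have \<psi>c: "\<psi> z \<in> carrier R" if "z \<in> carrier ?M" for z
    using \<psi> that unfolding module_hom_def self_module_simps by blast
  have \<psi>a: "\<psi> (z \<oplus>\<^bsub>K.L\<^esub> w) = \<psi> z \<oplus> \<psi> w" if "z \<in> carrier ?M" "w \<in> carrier ?M" for z w
    using \<psi> that unfolding module_hom_def self_module_simps frobenius_divisor_module_simps total_fractions_K
    by blast
  have \<psi>m: "\<psi> (to_fractions R (r [^] ?q) \<otimes>\<^bsub>K.L\<^esub> z) = r \<otimes> \<psi> z"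
    if "r \<in> carrier R" "z \<in> carrier ?M" for r z
    using \<psi> that unfolding module_hom_def self_module_simps frobenius_divisor_module_simps total_fractions_K
    by blast
  define \<phi> where "\<phi> x = \<psi> (to_fractions R (d \<otimes> x))" for x
  obtain B0 where "power_generating R p B0" using F_finite_generating[OF fg] by blast
  then obtain B where B: "power_generating R ?q B"
    using power_generating_iterate[OF p char] by blast
  interpret split: frobenius_split R ?q \<phi>
  proof (intro frobenius_split.intro frobenius_split_axioms.intro)
    show "noetherian_ring R" by (rule noeth)
    show "cring R" by (rule cr)
    show "2 \<le> ?q" by (rule power_minus_one_pos(2)[OF p e])
    show "\<phi> \<one> = \<one>"
    proof -
      have "\<one> \<odot>\<^bsub>?M\<^esub> to_fractions R d = to_fractions R (\<one> \<otimes> d)"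
        unfolding frobenius_divisor_module_simps total_fractions_K
        using ring_hom_mult[OF k_hom one_closed dc] by simp
      then show ?thesis using spl[OF one_closed] dc by (simp add: \<phi>_def)
    qed
  next
    fix x y assume x: "x \<in> carrier R" and y: "y \<in> carrier R"
    show "(x \<oplus> y) [^] ?q = x [^] ?q \<oplus> y [^] ?q"
      by (rule iterated_frobenius_add[OF p char x y])
    show "\<phi> (x \<oplus> y) = \<phi> x \<oplus> \<phi> y"
      unfolding \<phi>_def using x y dc \<psi>a[OF inM inM] ring_hom_add[OF k_hom] by (simp add: r_distr)
    have "d \<otimes> (x [^] ?q \<otimes> y) = x [^] ?q \<otimes> (d \<otimes> y)"
      using x y dc by (simp add: m_lcomm)
    then show "\<phi> (x [^] ?q \<otimes> y) = x \<otimes> \<phi> y"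
      unfolding \<phi>_def
      using \<psi>m[OF x inM, of "d \<otimes> y"] ring_hom_mult[OF k_hom, of "x [^] ?q" "d \<otimes> y"] x y dc
      by simp
  next
    fix x assume "x \<in> carrier R"
    then show "\<phi> x \<in> carrier R" unfolding \<phi>_def using \<psi>c inM dc by simp
  qed
  have "split.stable I" if "uniformly_F_compatible p R \<Delta> \<aa> I" for I
    using that e d \<psi> unfolding uniformly_F_compatible_def split.stable_def \<phi>_def by blast
  then have "{I. uniformly_F_compatible p R \<Delta> \<aa> I} \<subseteq> {I. split.stable I}" by blast
  then show ?thesis using split.finite_stable_ideals[OF B] finite_subset by blast
qed

text \<open>If \<open>\<phi>(ax) \<notin> P\<close> for some \<open>x \<in> P\<close>, then \<open>\<phi>(ax)\<close> is a unit of \<open>R\<^sub>P\<close>; dividing the localized map by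
  it splits \<open>1 \<mapsto> xa\<close>.\<close>

lemma center_is_compatible:
  fixes R :: "('a, 'm) ring_scheme" (structure)
  assumes F: "F_finite_noetherian p R" and T: "is_triple R \<Delta> \<aa>"
    and C: "center_of_sharp_F_purity p R \<Delta> \<aa> P"
  shows "uniformly_F_compatible p R \<Delta> \<aa> P"
proof -
  have P: "primeideal P R" using C by (simp add: center_of_sharp_F_purity_def)
  have "\<phi> (to_fractions R (a \<otimes> x)) \<in> P"
    if e: "0 < e" and a: "a \<in> \<aa> (p ^ e - 1)"
      and \<phi>: "\<phi> \<in> module_hom R (frobenius_divisor_module p e R \<Delta>) (self_module R)" and x: "x \<in> P"
    for e a \<phi> x
  proof (rule ccontr)
    assume neg: "\<phi> (to_fractions R (a \<otimes> x)) \<notin> P"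
    let ?M = "frobenius_divisor_module p e R \<Delta>" and ?q = "p ^ e"
    let ?D = "round_up_mult (p ^ e - 1) \<Delta>"
    let ?D' = "round_up_mult (p ^ e - 1) (restrict_divisor R P \<Delta>)"
    interpret prime_localization P R using P by (simp add: prime_localization_def)
    have p: "Factorial_Ring.prime p" using F by (simp add: F_finite_noetherian_def)
    have eff: "effective_divisor R \<Delta>" using T by (simp add: is_triple_def)
    have L: "local_at R P = loc.L" by (simp add: local_at_def)
    interpret DL: divisor_localization P R ?D ?D'
    proof (intro divisor_localization.intro divisor_localization_axioms.intro)
      show "prime_localization P R" by (rule prime_localization_axioms)
      show "divisor_data R ?D" by (rule triple_divisor_data[OF F T])
      show "?D' = (\<lambda>_. 0)" if "?D = (\<lambda>_. 0)"
        using round_up_mult_zero[OF eff power_minus_one_pos(1)[OF p e] that]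
        by (simp add: round_up_mult_def restrict_divisor_def)
      fix Q assume Q: "height_one_prime R Q" "Q \<subseteq> P" "height_one_prime loc.L (ext Q)"
      have "primeideal Q R" using Q(1) by (simp add: height_one_prime_def)
      then show "?D' (ext Q) = ?D Q"
        using Q(3) contraction_ext[OF _ Q(2)] by (simp add: round_up_mult_def restrict_divisor_def L)
    qed
    have ac: "a \<in> carrier R" by (rule graded_system_subset[OF T a])
    have xc: "x \<in> carrier R" using x Icarr by blast
    let ?N = "carrier (divisor_module R ?D)"
    have q0: "0 < ?q" using p by (simp add: prime_gt_0_nat)
    have M: "carrier ?M = ?N" by (rule frobenius_divisor_module_simps)
    have \<phi>a: "\<phi> (z \<oplus>\<^bsub>K.L\<^esub> w) = \<phi> z \<oplus> \<phi> w" if "z \<in> ?N" "w \<in> ?N" for z w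
      using \<phi> that
      unfolding module_hom_def self_module_simps frobenius_divisor_module_simps DL.total_fractions_K
      by blast
    have \<phi>m: "\<phi> (k (r [^] ?q) \<otimes>\<^bsub>K.L\<^esub> z) = r \<otimes> \<phi> z" if "r \<in> carrier R" "z \<in> ?N" for r z
      using \<phi> that
      unfolding module_hom_def self_module_simps frobenius_divisor_module_simps DL.total_fractions_K
      by blast
    have \<phi>c: "\<phi> z \<in> carrier R" if "z \<in> ?N" for z
      using \<phi> that
      unfolding module_hom_def self_module_simps frobenius_divisor_module_simps by blast
    obtain \<Psi> where \<Psi>c: "\<And>y. y \<in> local_span ?N \<Longrightarrow> \<Psi> y \<in> carrier loc.L"
      and \<Psi>a: "\<And>y z. \<lbrakk>y \<in> local_span ?N; z \<in> local_span ?N\<rbrakk> \<Longrightarrow>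
        \<Psi> (y \<oplus>\<^bsub>T.L\<^esub> z) = \<Psi> y \<oplus>\<^bsub>loc.L\<^esub> \<Psi> z"
      and \<Psi>m: "\<And>r y. \<lbrakk>r \<in> carrier loc.L; y \<in> local_span ?N\<rbrakk> \<Longrightarrow>
        \<Psi> (\<tau> (r [^]\<^bsub>loc.L\<^esub> ?q) \<otimes>\<^bsub>T.L\<^esub> y) = r \<otimes>\<^bsub>loc.L\<^esub> \<Psi> y"
      and \<Psi>l: "\<And>x. x \<in> ?N \<Longrightarrow> \<Psi> (\<kappa> x) = l (\<phi> x)"
      by (rule localize_map[of ?q ?N \<phi>, OF q0 DL.Mod_subset])
        (rule DL.Mod_add_closed DL.Mod_smult_closed \<phi>c \<phi>a \<phi>m that; assumption)+
    define w where "w = \<phi> (k (a \<otimes> x))"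
    have axN: "k (a \<otimes> x) \<in> ?N" using ac xc by (intro DL.to_fractions_mem_Mod) simp
    have wc: "w \<in> carrier R" using \<phi>c axN by (simp add: w_def)
    then have wS: "w \<in> carrier R - P" using neg by (simp add: w_def)
    define v where "v = loc.fr \<one> w"
    have vc: "v \<in> carrier loc.L" using wS by (simp add: v_def)
    have wv: "l w \<otimes>\<^bsub>loc.L\<^esub> v = \<one>\<^bsub>loc.L\<^esub>"
      unfolding v_def to_local_at_def using wS by (rule loc.denominator_unit)
    let ?FL = "frobenius_divisor_module p e (local_at R P) (restrict_divisor R P \<Delta>)"
    have FLc: "carrier ?FL \<subseteq> local_span ?N"
      unfolding frobenius_divisor_module_simps L by (rule DL.local_divisor_module_subset)
    have TL: "total_fractions loc.L = T.L" by (simp add: total_fractions_def)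
    have "splits_at (local_at R P) ?FL (to_fractions (local_at R P) (l x \<otimes>\<^bsub>local_at R P\<^esub> l a))"
      unfolding splits_at_def
    proof (intro bexI ballI)
      let ?\<theta> = "\<lambda>y. v \<otimes>\<^bsub>loc.L\<^esub> \<Psi> y"
      show "?\<theta> \<in> module_hom (local_at R P) ?FL (self_module (local_at R P))"
        unfolding module_hom_def
      proof (intro CollectI conjI ballI)
        show "?\<theta> \<in> carrier ?FL \<rightarrow> carrier (self_module (local_at R P))"
          unfolding self_module_simps L using FLc vc \<Psi>c by (auto simp: L)
      next
        fix y z assume "y \<in> carrier ?FL" "z \<in> carrier ?FL"
        then have yz: "y \<in> local_span ?N" "z \<in> local_span ?N" using FLc by auto
        show "?\<theta> (y \<oplus>\<^bsub>?FL\<^esub> z) = ?\<theta> y \<oplus>\<^bsub>self_module (local_at R P)\<^esub> ?\<theta> z"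
          unfolding self_module_simps frobenius_divisor_module_simps L TL
          using \<Psi>a[OF yz] \<Psi>c[OF yz(1)] \<Psi>c[OF yz(2)] vc by (simp add: loc.L.r_distr)
      next
        fix r y assume r: "r \<in> carrier (local_at R P)" and "y \<in> carrier ?FL"
        then have y: "y \<in> local_span ?N" using FLc by auto
        have rc: "r \<in> carrier loc.L" using r by (simp add: L)
        show "?\<theta> (r \<odot>\<^bsub>?FL\<^esub> y) = r \<odot>\<^bsub>self_module (local_at R P)\<^esub> ?\<theta> y"
          unfolding self_module_simps frobenius_divisor_module_simps L TL
          using \<Psi>m[OF rc y] \<Psi>c[OF y] vc rc by (simp add: loc.L.m_lcomm)
      qed
      fix r assume "r \<in> carrier (local_at R P)"
      then have rc: "r \<in> carrier loc.L" by (simp add: L)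
      have eq: "\<tau> (l x \<otimes>\<^bsub>loc.L\<^esub> l a) = \<kappa> (k (a \<otimes> x))"
        using ac xc by (simp add: \<kappa>_to_fractions l_mult loc.L.m_comm)
      have kap: "\<kappa> (k (a \<otimes> x)) \<in> local_span ?N"
      proof -
        have c: "\<kappa> (k (a \<otimes> x)) \<in> carrier T.L" using ac xc by simp
        moreover have "\<tau> (l \<one>) \<otimes>\<^bsub>T.L\<^esub> \<kappa> (k (a \<otimes> x)) = \<kappa> (k (a \<otimes> x))"
          using c by (simp add: l_one \<tau>_one)
        ultimately show ?thesis unfolding local_span_def using loc.S_one axN by blast
      qed
      have "?\<theta> (\<tau> (r [^]\<^bsub>loc.L\<^esub> ?q) \<otimes>\<^bsub>T.L\<^esub> \<kappa> (k (a \<otimes> x))) = v \<otimes>\<^bsub>loc.L\<^esub> (r \<otimes>\<^bsub>loc.L\<^esub> l w)"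
        using \<Psi>m[OF rc kap] \<Psi>l[OF axN] by (simp add: w_def)
      also have "\<dots> = r \<otimes>\<^bsub>loc.L\<^esub> (l w \<otimes>\<^bsub>loc.L\<^esub> v)"
        using vc rc wc by (simp add: loc.L.m_ac)
      also have "\<dots> = r" using wv rc by simp
      finally show "?\<theta> (r \<odot>\<^bsub>?FL\<^esub> to_fractions (local_at R P) (l x \<otimes>\<^bsub>local_at R P\<^esub> l a)) = r"
        unfolding frobenius_divisor_module_simps L TL eq .
    qed
    moreover have "l x \<in> extended_prime R P"
      unfolding l_fr extended_prime_def using x loc.S_one by blast
    ultimately show False using C e a unfolding center_of_sharp_F_purity_def by blast
  qed
  then show ?thesis
    unfolding uniformly_F_compatible_def using P primeideal.axioms(1) by blast
qed

theorem corollary5p3: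
  fixes p :: nat
    and R :: "('a, 'm) ring_scheme"
    and \<Delta> :: "'a set \<Rightarrow> real"
    and \<aa> :: "nat \<Rightarrow> 'a set"
  assumes "F_finite_noetherian p R"
    and "local_ring R"
    and "reduced_ring R"
    and "is_triple R \<Delta> \<aa>"
    and "sharply_F_pure p R \<Delta> \<aa>"
  shows "finite {I. uniformly_F_compatible p R \<Delta> \<aa> I} \<and>
         finite {P. center_of_sharp_F_purity p R \<Delta> \<aa> P}"
proof
  show fin: "finite {I. uniformly_F_compatible p R \<Delta> \<aa> I}"
    by (rule finite_compatible_ideals[OF assms(1,4,5)])
  have "{P. center_of_sharp_F_purity p R \<Delta> \<aa> P} \<subseteq> {I. uniformly_F_compatible p R \<Delta> \<aa> I}"
    using center_is_compatible[OF assms(1,4)] by blast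
  then show "finite {P. center_of_sharp_F_purity p R \<Delta> \<aa> P}"
    using fin by (rule finite_subset)
qed

end
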